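(* Let $E$ be a Banach space and let $A\colon\mathbb{R}\to\mathcal{L}(E)$ be an asymptotically hyperbolic path. Let $F_A\colon C_0^1(\mathbb{R},E)\to C_0(\mathbb{R},E)$, $F_Au=u'-Au$. Then: (i) $F_A$ has closed range if and only if $W_A^s+W_A^u$ is closed; (ii) $F_A$ is onto if and only if $W_A^s+W_A^u=E$; (iii) $F_A$ is semi-Fredholm if and only if $(W_A^s,W_A^u)$ is a semi-Fredholm pair; in this case $\operatorname{ind}F_A=\operatorname{ind}(W_A^s,W_A^u)$.
   Context: A path $A\colon\mathbb{R}\to\mathcal{L}(E)$ is asymptotically hyperbolic if it is norm-continuous and has norm limits $A(+\infty)$, $A(-\infty)$ as $t\to\pm\infty$, both hyperbolic, i.e. with spectrum disjoint from $i\mathbb{R}$ (for real $E$, spectra are those of the complexification). $C_0(\mathbb{R},E)=\{u\in C(\mathbb{R},E):\lim_{t\to\pm\infty}u(t)=0\}$ and $C_0^1(\mathbb{R},E)=\{u\in C^1(\mathbb{R},E):\lim_{t\to\pm\infty}u(t)=0,\ \lim_{t\to\pm\infty}u'(t)=0\}$, with norms $\sup|u|$ and $\sup|u|+\sup|u'|$ respectively. $X_A$ is the solution of $X'=AX$, $X(0)=I$ in $\mathcal{L}(E)$; $W_A^s=\{x:\lim_{t\to+\infty}X_A(t)x=0\}$ and $W_A^u=\{x:\lim_{t\to-\infty}X_A(t)x=0\}$ (these are closed complemented subspaces). A bounded operator $T$ is semi-Fredholm if its range is closed and at least one of $\ker T$, $\operatorname{coker}T$ is finite dimensional; $\operatorname{ind}T=\dim\ker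 T-\dim\operatorname{coker}T\in\mathbb{Z}\cup\{\pm\infty\}$. A pair $(X,Y)$ of closed subspaces of $E$ is semi-Fredholm if $X+Y$ is closed and at least one of $X\cap Y$, $E/(X+Y)$ is finite dimensional; $\operatorname{ind}(X,Y)=\dim(X\cap Y)-\operatorname{codim}(X+Y)\in\mathbb{Z}\cup\{\pm\infty\}$. *)

theory Defs
  imports "HOL-Analysis.Analysis"
begin

section \<open>Complex Banach spaces\<close>

text \<open>The library's class \<open>banach\<close> is that of real Banach spaces.  A complex Banach space is a
  real one together with a compatible multiplication by complex scalars.\<close>

class complex_normed_vector = real_normed_vector +
  fixes scaleC :: "complex \<Rightarrow> 'a \<Rightarrow> 'a" (infixr \<open>*\<^sub>C\<close> 75)
  assumes scaleC_add_right: "a *\<^sub>C (x + y) = a *\<^sub>C x + a *\<^sub>C y"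
    and scaleC_add_left: "(a + b) *\<^sub>C x = a *\<^sub>C x + b *\<^sub>C x"
    and scaleC_scaleC: "a *\<^sub>C (b *\<^sub>C x) = (a * b) *\<^sub>C x"
    and scaleC_of_real: "complex_of_real r *\<^sub>C x = r *\<^sub>R x"
    and norm_scaleC: "norm (a *\<^sub>C x) = cmod a * norm x"

class complex_banach = complex_normed_vector + banach

lemma vector_space_scaleC: "vector_space (scaleC :: complex \<Rightarrow> 'a::complex_normed_vector \<Rightarrow> 'a)"
  using scaleC_of_real[of 1]
  by unfold_locales (auto simp: scaleC_add_right scaleC_add_left scaleC_scaleC)

lemma bounded_linear_scaleC:
  "bounded_linear (scaleC c :: 'a::complex_normed_vector \<Rightarrow> 'a)"
proof (rule bounded_linear_intro)
  fix r and x :: 'a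
  show "c *\<^sub>C (r *\<^sub>R x) = r *\<^sub>R (c *\<^sub>C x)"
    by (simp add: scaleC_scaleC mult.commute flip: scaleC_of_real)
  show "norm (c *\<^sub>C x) \<le> norm x * cmod c" by (simp add: norm_scaleC mult.commute)
qed (rule scaleC_add_right)

definition clinear_op :: "('a::complex_normed_vector \<Rightarrow> 'a) \<Rightarrow> bool" where
  "clinear_op T \<longleftrightarrow> Vector_Spaces.linear scaleC scaleC T"


section \<open>The function spaces\<close>

definition vanishes_at_infty :: "(real \<Rightarrow> 'a::real_normed_vector) \<Rightarrow> bool" where
  "vanishes_at_infty u \<longleftrightarrow> (u \<longlongrightarrow> 0) at_top \<and> (u \<longlongrightarrow> 0) at_bot"

lemma vanishes_at_infty_add:
  "vanishes_at_infty u \<Longrightarrow> vanishes_at_infty v \<Longrightarrow> vanishes_at_infty (\<lambda>t. u t + v t)"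
  unfolding vanishes_at_infty_def by (auto intro: tendsto_add_zero)

lemma vanishes_at_infty_diff:
  "vanishes_at_infty u \<Longrightarrow> vanishes_at_infty v \<Longrightarrow> vanishes_at_infty (\<lambda>t. u t - v t)"
  unfolding vanishes_at_infty_def using tendsto_diff[of u 0 _ v 0] by simp

lemma vanishes_at_infty_bounded_linear:
  "bounded_linear T \<Longrightarrow> vanishes_at_infty u \<Longrightarrow> vanishes_at_infty (\<lambda>t. T (u t))"
  unfolding vanishes_at_infty_def by (auto intro: bounded_linear.tendsto_zero)

lemma vanishes_at_infty_zero [simp]: "vanishes_at_infty (\<lambda>t. 0)"
  unfolding vanishes_at_infty_def by simp

typedef (overloaded) 'a c0 =
  "{u :: real \<Rightarrow> 'a::real_normed_vector. continuous_on UNIV u \<and> vanishes_at_infty u}"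
  morphisms apply_c0 Abs_c0
  by (rule exI[of _ "\<lambda>_. 0"]) simp

setup_lifting type_definition_c0

lemma c0_eqI: "(\<And>t. apply_c0 u t = apply_c0 v t) \<Longrightarrow> u = v"
  by (simp add: apply_c0_inject[symmetric] fun_eq_iff)

lemma bounded_range_c0: "bounded (range (apply_c0 u))"
proof -
  let ?u = "apply_c0 u"
  have cont: "continuous_on UNIV ?u" and lim: "(?u \<longlongrightarrow> 0) at_top" "(?u \<longlongrightarrow> 0) at_bot"
    using apply_c0[of u] by (auto simp: vanishes_at_infty_def)
  obtain N where N: "\<And>t. t \<ge> N \<Longrightarrow> norm (?u t) < 1"
    using tendstoD[OF lim(1), of 1] unfolding eventually_at_top_linorder dist_norm by auto
  obtain M where M: "\<And>t. t \<le> M \<Longrightarrow> norm (?u t) < 1"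
    using tendstoD[OF lim(2), of 1] unfolding eventually_at_bot_linorder dist_norm by auto
  have "bounded (?u ` {M..N})"
    by (intro compact_imp_bounded compact_continuous_image continuous_on_subset[OF cont]) auto
  then obtain b where b: "\<And>t. t \<in> {M..N} \<Longrightarrow> norm (?u t) \<le> b"
    unfolding bounded_iff by blast
  have "norm (?u t) \<le> max 1 b" for t
    using less_imp_le[OF N, of t] less_imp_le[OF M, of t] b[of t]
    by (cases "t \<le> M"; cases "t \<ge> N") (simp_all add: le_max_iff_disj)
  then show ?thesis unfolding bounded_iff by auto
qed

instantiation c0 :: (real_normed_vector) real_normed_vector
begin

lift_definition zero_c0 :: "'a c0" is "\<lambda>t. 0" by simp

lift_definition plus_c0 :: "'a c0 \<Rightarrow> 'a c0 \<Rightarrow> 'a c0" is "\<lambda>u v t. u t + v t"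
  by (auto intro: continuous_on_add vanishes_at_infty_add)

lift_definition uminus_c0 :: "'a c0 \<Rightarrow> 'a c0" is "\<lambda>u t. - u t"
  by (auto intro: continuous_on_minus
      vanishes_at_infty_bounded_linear[OF bounded_linear_minus[OF bounded_linear_ident]])

definition minus_c0 :: "'a c0 \<Rightarrow> 'a c0 \<Rightarrow> 'a c0" where "minus_c0 u v = u + - v"

lift_definition scaleR_c0 :: "real \<Rightarrow> 'a c0 \<Rightarrow> 'a c0" is "\<lambda>r u t. r *\<^sub>R u t"
  by (auto intro: continuous_on_scaleR
      vanishes_at_infty_bounded_linear[OF bounded_linear_scaleR_right])

definition norm_c0 :: "'a c0 \<Rightarrow> real" where "norm_c0 u = (SUP t. norm (apply_c0 u t))"

definition sgn_c0 :: "'a c0 \<Rightarrow> 'a c0" where "sgn_c0 u = inverse (norm u) *\<^sub>R u"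

definition dist_c0 :: "'a c0 \<Rightarrow> 'a c0 \<Rightarrow> real" where "dist_c0 u v = norm (u - v)"

definition uniformity_c0 :: "('a c0 \<times> 'a c0) filter"
  where "uniformity_c0 = (INF e\<in>{0 <..}. principal {(x, y). dist x y < e})"

definition open_c0 :: "'a c0 set \<Rightarrow> bool"
  where "open_c0 S = (\<forall>x\<in>S. \<forall>\<^sub>F (x', y) in uniformity. x' = x \<longrightarrow> y \<in> S)"

lemma norm_apply_c0_le: "norm (apply_c0 u t) \<le> norm u"
proof -
  have "bdd_above (range (\<lambda>t. norm (apply_c0 u t)))"
    using bounded_range_c0[of u] unfolding bounded_iff bdd_above_def by auto
  then show ?thesis unfolding norm_c0_def by (rule cSUP_upper2) auto
qed

lemma norm_c0_le: "(\<And>t. norm (apply_c0 u t) \<le> b) \<Longrightarrow> norm u \<le> b"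
  unfolding norm_c0_def by (rule cSUP_least) auto

instance
proof
  fix u v w :: "'a c0" and r s :: real
  show "u + v + w = u + (v + w)" "u + v = v + u" "0 + u = u" "- u + u = 0"
    by (transfer, simp add: add_ac fun_eq_iff)+
  show "u - v = u + - v" by (rule minus_c0_def)
  show "r *\<^sub>R (u + v) = r *\<^sub>R u + r *\<^sub>R v" "(r + s) *\<^sub>R u = r *\<^sub>R u + s *\<^sub>R u"
    "r *\<^sub>R s *\<^sub>R u = (r * s) *\<^sub>R u" "1 *\<^sub>R u = u"
    by (transfer, simp add: algebra_simps fun_eq_iff)+
  show "norm u = 0 \<longleftrightarrow> u = 0"
  proof
    assume "norm u = 0"
    then show "u = 0"
      using norm_apply_c0_le[of u] by (intro c0_eqI) (simp add: zero_c0.rep_eq)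
  qed (simp add: norm_c0_def zero_c0.rep_eq)
  show "norm (u + v) \<le> norm u + norm v"
    by (rule norm_c0_le) (simp only: plus_c0.rep_eq norm_triangle_mono norm_apply_c0_le)
  have le: "norm (r *\<^sub>R u) \<le> \<bar>r\<bar> * norm u" for r and u :: "'a c0"
    by (rule norm_c0_le) (simp add: scaleR_c0.rep_eq mult_left_mono norm_apply_c0_le)
  show "norm (r *\<^sub>R u) = \<bar>r\<bar> * norm u"
  proof (rule antisym)
    show "norm (r *\<^sub>R u) \<le> \<bar>r\<bar> * norm u" by (rule le)
    show "\<bar>r\<bar> * norm u \<le> norm (r *\<^sub>R u)"
    proof (cases "r = 0")
      case True
      have "0 \<le> norm (r *\<^sub>R u)"
        by (rule order_trans[OF norm_ge_zero norm_apply_c0_le])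
      with True show ?thesis by simp
    next
      case False
      have "inverse r *\<^sub>R r *\<^sub>R u = u"
        by (rule c0_eqI) (simp add: scaleR_c0.rep_eq False)
      with le[of "inverse r" "r *\<^sub>R u"] have "norm u \<le> inverse \<bar>r\<bar> * norm (r *\<^sub>R u)"
        by simp
      then have "\<bar>r\<bar> * norm u \<le> \<bar>r\<bar> * (inverse \<bar>r\<bar> * norm (r *\<^sub>R u))"
        by (rule mult_left_mono) simp
      also have "\<dots> = norm (r *\<^sub>R u)" using False by (simp flip: mult.assoc)
      finally show ?thesis .
    qed
  qed
qed (auto simp: sgn_c0_def dist_c0_def uniformity_c0_def open_c0_def)

end

lemma apply_c0_minus: "apply_c0 (u - v) t = apply_c0 u t - apply_c0 v t"
  unfolding minus_c0_def plus_c0.rep_eq uminus_c0.rep_eq by simp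

instantiation c0 :: (complex_normed_vector) complex_normed_vector
begin

lift_definition scaleC_c0 :: "complex \<Rightarrow> 'a c0 \<Rightarrow> 'a c0" is "\<lambda>c u t. c *\<^sub>C u t"
  by (auto intro: vanishes_at_infty_bounded_linear[OF bounded_linear_scaleC]
      bounded_linear.continuous_on[OF bounded_linear_scaleC])

instance
proof
  fix u v :: "'a c0" and a b :: complex and r :: real
  show "a *\<^sub>C (u + v) = a *\<^sub>C u + a *\<^sub>C v" "(a + b) *\<^sub>C u = a *\<^sub>C u + b *\<^sub>C u"
    "a *\<^sub>C b *\<^sub>C u = (a * b) *\<^sub>C u" "complex_of_real r *\<^sub>C u = r *\<^sub>R u"
    by (rule c0_eqI; simp add: scaleC_c0.rep_eq plus_c0.rep_eq scaleR_c0.rep_eq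
        scaleC_add_right scaleC_add_left scaleC_scaleC scaleC_of_real)+
  have le: "norm (a *\<^sub>C u) \<le> cmod a * norm u" for a and u :: "'a c0"
    by (rule norm_c0_le) (simp add: scaleC_c0.rep_eq norm_scaleC mult_left_mono norm_apply_c0_le)
  show "norm (a *\<^sub>C u) = cmod a * norm u"
  proof (rule antisym[OF le])
    show "cmod a * norm u \<le> norm (a *\<^sub>C u)"
    proof (cases "a = 0")
      case False
      have "inverse a *\<^sub>C a *\<^sub>C u = u"
        by (rule c0_eqI) (use False scaleC_of_real[of 1] in \<open>simp add: scaleC_c0.rep_eq scaleC_scaleC\<close>)
      with le[of "inverse a" "a *\<^sub>C u"] have "norm u \<le> inverse (cmod a) * norm (a *\<^sub>C u)"
        by (simp add: norm_inverse)
      then have "cmod a * norm u \<le> cmod a * (inverse (cmod a) * norm (a *\<^sub>C u))"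
        by (rule mult_left_mono) simp
      also have "\<dots> = norm (a *\<^sub>C u)" using False by (simp flip: mult.assoc)
      finally show ?thesis .
    qed simp
  qed
qed

end

typedef (overloaded) 'a c01 =
  "{u :: real \<Rightarrow> 'a::real_normed_vector. u C1_differentiable_on UNIV \<and> vanishes_at_infty u
      \<and> vanishes_at_infty (\<lambda>t. vector_derivative u (at t))}"
  morphisms apply_c01 Abs_c01
  by (rule exI[of _ "\<lambda>_. 0"]) simp

setup_lifting type_definition_c01

lemma c01_eqI: "(\<And>t. apply_c01 u t = apply_c01 v t) \<Longrightarrow> u = v"
  by (simp add: apply_c01_inject[symmetric] fun_eq_iff)

lemma c01_vanishes: "vanishes_at_infty (apply_c01 u)"
  and c01_C1: "apply_c01 u C1_differentiable_on UNIV"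
  using apply_c01[of u] by auto

lemma c01_has_vector_derivative:
  "(apply_c01 u has_vector_derivative vector_derivative (apply_c01 u) (at t)) (at t)"
  using c01_C1[of u] by (auto simp: C1_differentiable_on_eq vector_derivative_works)

lift_definition c01_incl :: "'a::real_normed_vector c01 \<Rightarrow> 'a c0" is "\<lambda>u. u"
  by (auto intro: C1_differentiable_imp_continuous_on)

lift_definition c01_deriv :: "'a::real_normed_vector c01 \<Rightarrow> 'a c0"
  is "\<lambda>u t. vector_derivative u (at t)"
  by (auto simp: C1_differentiable_on_eq)

lemma C1_bounded_linear:
  assumes T: "bounded_linear T" and u: "u C1_differentiable_on UNIV"
  shows "(\<lambda>t. T (u t)) C1_differentiable_on UNIV"
    and "vector_derivative (\<lambda>t. T (u t)) (at t) = T (vector_derivative u (at t))"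
proof -
  from u obtain D where D: "\<And>t. (u has_vector_derivative D t) (at t)" "continuous_on UNIV D"
    unfolding C1_differentiable_on_def by auto
  have TD: "((\<lambda>t. T (u t)) has_vector_derivative T (D t)) (at t)" for t
    by (rule bounded_linear.has_vector_derivative[OF T D(1)])
  then show "(\<lambda>t. T (u t)) C1_differentiable_on UNIV"
    unfolding C1_differentiable_on_def using bounded_linear.continuous_on[OF T D(2)]
    by (intro exI[of _ "\<lambda>t. T (D t)"]) simp
  show "vector_derivative (\<lambda>t. T (u t)) (at t) = T (vector_derivative u (at t))"
    using vector_derivative_at[OF TD] vector_derivative_at[OF D(1)] by metis
qed

lemma C1_add:
  assumes u: "u C1_differentiable_on UNIV" and v: "v C1_differentiable_on UNIV"
  shows "(\<lambda>t. u t + v t) C1_differentiable_on UNIV"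
    and "vector_derivative (\<lambda>t. u t + v t) (at t)
      = vector_derivative u (at t) + vector_derivative v (at t)"
proof -
  show "(\<lambda>t. u t + v t) C1_differentiable_on UNIV"
    by (rule C1_differentiable_on_add[OF u v])
  show "vector_derivative (\<lambda>t. u t + v t) (at t)
      = vector_derivative u (at t) + vector_derivative v (at t)"
    using u v by (intro vector_derivative_add_at) (auto simp: C1_differentiable_on_eq)
qed

lemma c01_bounded_linear_closed:
  assumes "bounded_linear T"
    and "u C1_differentiable_on UNIV \<and> vanishes_at_infty u
      \<and> vanishes_at_infty (\<lambda>t. vector_derivative u (at t))"
  shows "(\<lambda>t. T (u t)) C1_differentiable_on UNIV \<and> vanishes_at_infty (\<lambda>t. T (u t))
      \<and> vanishes_at_infty (\<lambda>t. vector_derivative (\<lambda>t. T (u t)) (at t))"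
  using assms C1_bounded_linear[of T u] vanishes_at_infty_bounded_linear[of T] by simp

instantiation c01 :: (real_normed_vector) real_normed_vector
begin

lift_definition zero_c01 :: "'a c01" is "\<lambda>t. 0" by simp

lift_definition plus_c01 :: "'a c01 \<Rightarrow> 'a c01 \<Rightarrow> 'a c01" is "\<lambda>u v t. u t + v t"
  by (simp add: C1_add vanishes_at_infty_add)

lift_definition uminus_c01 :: "'a c01 \<Rightarrow> 'a c01" is "\<lambda>u t. - u t"
  by (rule c01_bounded_linear_closed[OF bounded_linear_minus[OF bounded_linear_ident]])

definition minus_c01 :: "'a c01 \<Rightarrow> 'a c01 \<Rightarrow> 'a c01" where "minus_c01 u v = u + - v"

lift_definition scaleR_c01 :: "real \<Rightarrow> 'a c01 \<Rightarrow> 'a c01" is "\<lambda>r u t. r *\<^sub>R u t"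
  by (rule c01_bounded_linear_closed[OF bounded_linear_scaleR_right])

definition norm_c01 :: "'a c01 \<Rightarrow> real" where "norm_c01 u = norm (c01_incl u) + norm (c01_deriv u)"

definition sgn_c01 :: "'a c01 \<Rightarrow> 'a c01" where "sgn_c01 u = inverse (norm u) *\<^sub>R u"

definition dist_c01 :: "'a c01 \<Rightarrow> 'a c01 \<Rightarrow> real" where "dist_c01 u v = norm (u - v)"

definition uniformity_c01 :: "('a c01 \<times> 'a c01) filter"
  where "uniformity_c01 = (INF e\<in>{0 <..}. principal {(x, y). dist x y < e})"

definition open_c01 :: "'a c01 set \<Rightarrow> bool"
  where "open_c01 S = (\<forall>x\<in>S. \<forall>\<^sub>F (x', y) in uniformity. x' = x \<longrightarrow> y \<in> S)"

lemma c01_incl_simps: "c01_incl (u + v) = c01_incl u + c01_incl v"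
    "c01_incl (r *\<^sub>R u) = r *\<^sub>R c01_incl u"
  by (transfer, simp)+

lemma c01_deriv_simps: "c01_deriv (u + v) = c01_deriv u + c01_deriv v"
    "c01_deriv (r *\<^sub>R u) = r *\<^sub>R c01_deriv u"
  by (transfer, simp add: C1_add C1_bounded_linear(2)[OF bounded_linear_scaleR_right])+

instance
proof
  fix u v w :: "'a c01" and r s :: real
  show "u + v + w = u + (v + w)" "u + v = v + u" "0 + u = u" "- u + u = 0"
    by (transfer, simp add: add_ac fun_eq_iff)+
  show "u - v = u + - v" by (rule minus_c01_def)
  show "r *\<^sub>R (u + v) = r *\<^sub>R u + r *\<^sub>R v" "(r + s) *\<^sub>R u = r *\<^sub>R u + s *\<^sub>R u"
    "r *\<^sub>R s *\<^sub>R u = (r * s) *\<^sub>R u" "1 *\<^sub>R u = u"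
    by (transfer, simp add: algebra_simps fun_eq_iff)+
  show "norm u = 0 \<longleftrightarrow> u = 0"
  proof
    assume "norm u = 0"
    then have "c01_incl u = 0"
      by (simp add: norm_c01_def add_nonneg_eq_0_iff)
    then show "u = 0" by transfer
  next
    assume "u = 0"
    moreover have "c01_incl 0 = (0 :: 'a c0)" "c01_deriv 0 = (0 :: 'a c0)"
      by (transfer, simp)+
    ultimately show "norm u = 0" by (simp add: norm_c01_def)
  qed
  show "norm (u + v) \<le> norm u + norm v"
    using norm_triangle_ineq[of "c01_incl u" "c01_incl v"]
      norm_triangle_ineq[of "c01_deriv u" "c01_deriv v"]
    by (simp add: norm_c01_def c01_incl_simps c01_deriv_simps)
  show "norm (r *\<^sub>R u) = \<bar>r\<bar> * norm u"
    by (simp add: norm_c01_def c01_incl_simps c01_deriv_simps distrib_left)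
qed (auto simp: sgn_c01_def dist_c01_def uniformity_c01_def open_c01_def)

end

instantiation c01 :: (complex_normed_vector) complex_normed_vector
begin

lift_definition scaleC_c01 :: "complex \<Rightarrow> 'a c01 \<Rightarrow> 'a c01" is "\<lambda>c u t. c *\<^sub>C u t"
  by (rule c01_bounded_linear_closed[OF bounded_linear_scaleC])

lemma c01_scaleC_simps: "c01_incl (c *\<^sub>C u) = c *\<^sub>C c01_incl u" "c01_deriv (c *\<^sub>C u) = c *\<^sub>C c01_deriv u"
  by (transfer, simp add: C1_bounded_linear(2)[OF bounded_linear_scaleC])+

instance
proof
  fix u v :: "'a c01" and a b :: complex and r :: real
  show "a *\<^sub>C (u + v) = a *\<^sub>C u + a *\<^sub>C v" "(a + b) *\<^sub>C u = a *\<^sub>C u + b *\<^sub>C u"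
    "a *\<^sub>C b *\<^sub>C u = (a * b) *\<^sub>C u" "complex_of_real r *\<^sub>C u = r *\<^sub>R u"
    by (rule c01_eqI; simp add: scaleC_c01.rep_eq plus_c01.rep_eq scaleR_c01.rep_eq
        scaleC_add_right scaleC_add_left scaleC_scaleC scaleC_of_real)+
  show "norm (a *\<^sub>C u) = cmod a * norm u"
    by (simp add: norm_c01_def c01_scaleC_simps norm_scaleC distrib_left)
qed

end


section \<open>Dimension, codimension and semi-Fredholm notions\<close>

text \<open>The scalar multiplication is a parameter, since over a complex space dimensions are complex
  dimensions.  The library's \<open>dim\<close> is a natural number, and \<open>0\<close> in infinite dimension.\<close>

definition edim :: "('k::field \<Rightarrow> 'e::ab_group_add \<Rightarrow> 'e) \<Rightarrow> 'e set \<Rightarrow> enat" where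
  "edim sc V = (if \<exists>B. finite B \<and> V \<subseteq> module.span sc B
     then enat (vector_space.dim sc V) else \<infinity>)"

text \<open>The classes of the elements of \<open>B\<close> are pairwise distinct and form a basis of the quotient of
  the whole space by the subspace \<open>W\<close>.\<close>

definition quotient_basis :: "('k::field \<Rightarrow> 'e::ab_group_add \<Rightarrow> 'e) \<Rightarrow> 'e set \<Rightarrow> 'e set \<Rightarrow> bool" where
  "quotient_basis sc W B \<longleftrightarrow> module.span sc (W \<union> B) = UNIV \<and>
     (\<forall>S c. finite S \<longrightarrow> S \<subseteq> B \<longrightarrow> (\<Sum>b\<in>S. sc (c b) b) \<in> W \<longrightarrow> (\<forall>b\<in>S. c b = 0))"

definition ecodim :: "('k::field \<Rightarrow> 'e::ab_group_add \<Rightarrow> 'e) \<Rightarrow> 'e set \<Rightarrow> enat" where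
  "ecodim sc W = (if \<exists>B. finite B \<and> quotient_basis sc W B
     then enat (card (SOME B. finite B \<and> quotient_basis sc W B)) else \<infinity>)"

lemma quotient_basis_card_le:
  assumes vs: "vector_space sc" and W: "module.subspace sc W"
    and B: "finite B" "quotient_basis sc W B" and C: "finite C" "quotient_basis sc W C"
  shows "card C \<le> card B"
proof -
  interpret vector_space sc by fact
  have "\<exists>s. s \<in> span B \<and> c - s \<in> W" for c
  proof -
    have "c \<in> span (W \<union> B)" using B(2) by (simp add: quotient_basis_def)
    then obtain w s where "c = w + s" "w \<in> span W" "s \<in> span B"
      unfolding span_Un by auto
    moreover have "span W = W" using W by (simp add: span_eq_iff)
    ultimately show ?thesis by (intro exI[of _ s]) auto
  qed
  then obtain p where p: "\<And>c. p c \<in> span B" "\<And>c. c - p c \<in> W" by metis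
  have ind: "\<forall>b\<in>S. c b = 0" if "finite S" "S \<subseteq> C" "(\<Sum>b\<in>S. sc (c b) (p b)) = 0" for S c
  proof -
    have "(\<Sum>b\<in>S. sc (c b) (b - p b)) \<in> W"
      by (intro subspace_sum[OF W] subspace_scale[OF W] p(2))
    moreover have "(\<Sum>b\<in>S. sc (c b) (b - p b)) = (\<Sum>b\<in>S. sc (c b) b)"
      using that(3) by (simp add: scale_right_diff_distrib sum_subtractf)
    ultimately show ?thesis
      using C(2) that(1,2) unfolding quotient_basis_def by auto
  qed
  have inj: "inj_on p C"
  proof (rule inj_onI, rule ccontr)
    fix x y assume xy: "x \<in> C" "y \<in> C" "p x = p y" "x \<noteq> y"
    have "\<forall>b\<in>{x,y}. (if b = x then 1 else - 1 :: 'a) = 0"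
      by (rule ind) (use xy in auto)
    then show False by auto
  qed
  have "independent (p ` C)"
  proof (rule independent_if_scalars_zero)
    fix f x assume sum: "(\<Sum>x\<in>p ` C. sc (f x) x) = 0" and x: "x \<in> p ` C"
    have "(\<Sum>b\<in>C. sc (f (p b)) (p b)) = 0"
      using sum by (simp add: sum.reindex[OF inj])
    from ind[OF C(1) order_refl this] x show "f x = 0" by auto
  qed (use C in simp)
  with independent_span_bound[OF B(1), of "p ` C"] p(1) have "card (p ` C) \<le> card B" by auto
  then show ?thesis by (simp add: card_image[OF inj])
qed

lemma ecodim_eq_card:
  assumes "vector_space sc" "module.subspace sc W" "finite B" "quotient_basis sc W B"
  shows "ecodim sc W = enat (card B)"
proof -
  let ?S = "SOME B. finite B \<and> quotient_basis sc W B"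
  have "finite ?S \<and> quotient_basis sc W ?S"
    using assms(3,4) by (intro someI[where P="\<lambda>B. finite B \<and> quotient_basis sc W B"]) simp
  then have "card ?S = card B"
    using quotient_basis_card_le[OF assms(1,2)] assms(3,4) by (meson antisym)
  then show ?thesis using assms(3,4) by (auto simp: ecodim_def)
qed

definition semi_fredholm ::
  "('k::field \<Rightarrow> 'e::real_normed_vector \<Rightarrow> 'e) \<Rightarrow> ('k \<Rightarrow> 'f::real_normed_vector \<Rightarrow> 'f)
     \<Rightarrow> ('e \<Rightarrow> 'f) \<Rightarrow> bool" where
  "semi_fredholm sc1 sc2 T \<longleftrightarrow>
     Vector_Spaces.linear sc1 sc2 T \<and> (\<exists>K. \<forall>x. norm (T x) \<le> K * norm x) \<and>
     closed (range T) \<and>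
     (edim sc1 {x. T x = 0} \<noteq> \<infinity> \<or> ecodim sc2 (range T) \<noteq> \<infinity>)"

text \<open>Both indices below are only meaningful in the semi-Fredholm case, where \<open>\<infinity> - \<infinity>\<close> is excluded.\<close>

definition fredholm_index ::
  "('k::field \<Rightarrow> 'e::real_normed_vector \<Rightarrow> 'e) \<Rightarrow> ('k \<Rightarrow> 'f::real_normed_vector \<Rightarrow> 'f)
     \<Rightarrow> ('e \<Rightarrow> 'f) \<Rightarrow> ereal" where
  "fredholm_index sc1 sc2 T =
     ereal_of_enat (edim sc1 {x. T x = 0}) - ereal_of_enat (ecodim sc2 (range T))"

definition subspace_sum :: "'e::ab_group_add set \<Rightarrow> 'e set \<Rightarrow> 'e set" where
  "subspace_sum X Y = {x + y | x y. x \<in> X \<and> y \<in> Y}"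

definition semi_fredholm_pair ::
  "('k::field \<Rightarrow> 'e::real_normed_vector \<Rightarrow> 'e) \<Rightarrow> 'e set \<Rightarrow> 'e set \<Rightarrow> bool" where
  "semi_fredholm_pair sc X Y \<longleftrightarrow>
     module.subspace sc X \<and> closed X \<and> module.subspace sc Y \<and> closed Y \<and>
     closed (subspace_sum X Y) \<and>
     (edim sc (X \<inter> Y) \<noteq> \<infinity> \<or> ecodim sc (subspace_sum X Y) \<noteq> \<infinity>)"

definition pair_index ::
  "('k::field \<Rightarrow> 'e::real_normed_vector \<Rightarrow> 'e) \<Rightarrow> 'e set \<Rightarrow> 'e set \<Rightarrow> ereal" where
  "pair_index sc X Y =
     ereal_of_enat (edim sc (X \<inter> Y)) - ereal_of_enat (ecodim sc (subspace_sum X Y))"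


section \<open>Spectra and asymptotically hyperbolic paths\<close>

definition op_spectrum ::
  "(complex \<Rightarrow> 'e::real_normed_vector \<Rightarrow> 'e) \<Rightarrow> ('e \<Rightarrow> 'e) \<Rightarrow> complex set" where
  "op_spectrum sc T = {z. \<not> (\<exists>R. bounded_linear R \<and> Vector_Spaces.linear sc sc R \<and>
     (\<forall>x. R (sc z x - T x) = x) \<and> (\<forall>y. sc z (R y) - T (R y) = y))}"

text \<open>The complexification of a real space is its square, \<open>(x, y)\<close> standing for \<open>x + i y\<close>.
  The product norm is equivalent to any of the usual complex norms on the complexification, and the
  spectrum depends on the norm only through its equivalence class.\<close>

definition complexify_scale :: "complex \<Rightarrow> 'a::real_vector \<times> 'a \<Rightarrow> 'a \<times> 'a" where
  "complexify_scale z = (\<lambda>(x, y). (Re z *\<^sub>R x - Im z *\<^sub>R y, Re z *\<^sub>R y + Im z *\<^sub>R x))"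

definition hyperbolic_real :: "('a::real_normed_vector \<Rightarrow>\<^sub>L 'a) \<Rightarrow> bool" where
  "hyperbolic_real L \<longleftrightarrow>
     op_spectrum complexify_scale (map_prod (blinfun_apply L) (blinfun_apply L)) \<inter> {z. Re z = 0} = {}"

definition hyperbolic_complex :: "('a::complex_normed_vector \<Rightarrow>\<^sub>L 'a) \<Rightarrow> bool" where
  "hyperbolic_complex L \<longleftrightarrow>
     clinear_op (blinfun_apply L) \<and> op_spectrum scaleC (blinfun_apply L) \<inter> {z. Re z = 0} = {}"

definition asymptotically_hyperbolic_real :: "(real \<Rightarrow> 'a::real_normed_vector \<Rightarrow>\<^sub>L 'a) \<Rightarrow> bool" where
  "asymptotically_hyperbolic_real A \<longleftrightarrow> continuous_on UNIV A \<and>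
     (\<exists>L. (A \<longlongrightarrow> L) at_top \<and> hyperbolic_real L) \<and>
     (\<exists>L. (A \<longlongrightarrow> L) at_bot \<and> hyperbolic_real L)"

definition asymptotically_hyperbolic_complex ::
    "(real \<Rightarrow> 'a::complex_normed_vector \<Rightarrow>\<^sub>L 'a) \<Rightarrow> bool" where
  "asymptotically_hyperbolic_complex A \<longleftrightarrow> continuous_on UNIV A \<and>
     (\<forall>t. clinear_op (blinfun_apply (A t))) \<and>
     (\<exists>L. (A \<longlongrightarrow> L) at_top \<and> hyperbolic_complex L) \<and>
     (\<exists>L. (A \<longlongrightarrow> L) at_bot \<and> hyperbolic_complex L)"


section \<open>The propagator, the stable and unstable spaces, and the operator\<close>

text \<open>For continuous \<open>A\<close> the linear Cauchy problem has exactly one global solution; if \<open>A\<close> takes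
  complex linear values, then so does that solution.\<close>

definition propagator :: "(real \<Rightarrow> 'a::real_normed_vector \<Rightarrow>\<^sub>L 'a) \<Rightarrow> real \<Rightarrow> 'a \<Rightarrow>\<^sub>L 'a" where
  "propagator A = (THE X. X 0 = id_blinfun \<and>
     (\<forall>t. (X has_vector_derivative (A t o\<^sub>L X t)) (at t)))"

definition stable_space :: "(real \<Rightarrow> 'a::real_normed_vector \<Rightarrow>\<^sub>L 'a) \<Rightarrow> 'a set" where
  "stable_space A = {x. ((\<lambda>t. propagator A t x) \<longlongrightarrow> 0) at_top}"

definition unstable_space :: "(real \<Rightarrow> 'a::real_normed_vector \<Rightarrow>\<^sub>L 'a) \<Rightarrow> 'a set" where
  "unstable_space A = {x. ((\<lambda>t. propagator A t x) \<longlongrightarrow> 0) at_bot}"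

definition F_op :: "(real \<Rightarrow> 'a::real_normed_vector \<Rightarrow>\<^sub>L 'a) \<Rightarrow> 'a c01 \<Rightarrow> 'a c0" where
  "F_op A u = Abs_c0 (\<lambda>t. vector_derivative (apply_c01 u) (at t) - A t (apply_c01 u t))"

text \<open>\<open>F_op\<close> is given by the expected formula because its values do belong to the function space.\<close>

lemma apply_F_op:
  assumes cont: "continuous_on UNIV A" and top: "(A \<longlongrightarrow> L1) at_top" and bot: "(A \<longlongrightarrow> L2) at_bot"
  shows "apply_c0 (F_op A u) t = vector_derivative (apply_c01 u) (at t) - A t (apply_c01 u t)"
proof -
  have "vanishes_at_infty (\<lambda>t. A t (apply_c01 u t))"
    unfolding vanishes_at_infty_def
    using blinfun.tendsto[OF top, of "apply_c01 u" 0] blinfun.tendsto[OF bot, of "apply_c01 u" 0]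
      c01_vanishes[of u]
    by (simp add: vanishes_at_infty_def)
  then have "vanishes_at_infty (\<lambda>t. vector_derivative (apply_c01 u) (at t) - A t (apply_c01 u t))"
    using apply_c01[of u] by (auto intro: vanishes_at_infty_diff)
  moreover have "continuous_on UNIV (\<lambda>t. A t (apply_c01 u t))"
    using C1_differentiable_imp_continuous_on[OF c01_C1[of u]] cont
    by (intro blinfun.continuous_on)
  moreover have "continuous_on UNIV (\<lambda>t. vector_derivative (apply_c01 u) (at t))"
    using c01_C1[of u] by (simp add: C1_differentiable_on_eq)
  ultimately show ?thesis
    unfolding F_op_def by (subst Abs_c0_inverse) (auto intro: continuous_on_diff)
qed

end

theory Submission
  imports Defs
begin

text \<open>
  Suppose that for every \<open>f\<close> the equation \<open>u' = A u + f\<close> has, on each half-line, a solution that decays at the infinite end and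
  whose value at \<open>0\<close> is controlled by \<open>f\<close>.  By the global existence theorem for the Cauchy problem
  these solutions extend to all of the real line, giving \<open>v\<close> (decaying at \<open>+\<infinity>\<close>) and \<open>w\<close>
  (decaying at \<open>-\<infinity>\<close>), each unique up to \<open>X t a\<close> with \<open>a\<close> in the stable, respectively the
  unstable space, where \<open>X\<close> is the propagator.  A solution decaying at both ends is therefore a way of
  writing \<open>w 0 - v 0\<close> as the sum of a stable and an unstable vector, and \<open>f\<close> is in the range of the
  operator exactly when \<open>w 0 - v 0\<close> lies in the sum \<open>W\<close> of the two spaces (\<open>range_criterion\<close>).
  Since \<open>v 0\<close> and \<open>w 0\<close> are controlled by \<open>f\<close>, the range is closed if \<open>W\<close> is.  In the other
  direction, for a bump function \<open>\<phi>\<close> of integral \<open>1\<close> on \<open>[0, 1]\<close> the map sending \<open>x\<close> to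
  \<open>\<lambda>t. \<phi> t *\<^sub>R X t x\<close> is bounded and induces an isomorphism of the quotients by \<open>W\<close> and by the range
  (\<open>bump_operator\<close>).  The kernel of the operator is identified with the intersection of the two spaces
  by evaluation at \<open>0\<close>.  All parts of the theorem follow, over both scalar fields.

  The analytic input is thus solvability on half-lines together with the closedness of the stable space;
  the unstable space is the stable space of the time-reversed path.  Near \<open>+\<infinity>\<close> the path is a small
  perturbation of its limit \<open>L\<close>, so both follow once the operator sending \<open>u\<close> to \<open>u' - L u\<close> is known to
  be invertible on continuous functions vanishing at infinity (\<open>c0_invertible_constant\<close>), an
  invertibility that survives small perturbations of \<open>L\<close> (\<open>c0_invertible_perturbation\<close>).

  This invertibility is usually obtained from the Green function, that is from the spectral projections of
  \<open>L\<close>.  Here approximate projections are enough, and they come from algebra.  For small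
  \<open>h > 0\<close> the operator \<open>M = exp (h L)\<close> has no spectrum on the unit circle, so \<open>(1 - z M)\<close> has an inverse
  that is uniformly bounded for \<open>z\<close> near the circle.  The average of \<open>(1 - a \<zeta> M)\<close>-inverses over the \<open>n\<close>-th
  roots of unity \<open>\<zeta>\<close> is the inverse of \<open>1 - a^n M^n\<close>.  Hence \<open>p = (1 - a^n M^n)\<close>-inverse and
  \<open>q = (1 - a^(-n) M^n)\<close>-inverse are bounded uniformly in \<open>n\<close>, and, by the resolvent identity, they are
  close to each other uniformly in \<open>n\<close> if \<open>a < 1\<close> is close to \<open>1\<close>
  (\<open>approximate_spectral_projections\<close>).  Taking \<open>n\<close> so large that \<open>a^n\<close> is negligible, these two
  operators yield an inverse of the map from \<open>u\<close> to \<open>u' - L u\<close> up to an error of norm at most \<open>1/2\<close>.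
\<close>

section \<open>Antiderivatives and differential inequalities\<close>

lemma antiderivative_on_real_line:
  fixes f :: "real \<Rightarrow> 'a::banach"
  assumes f: "continuous_on UNIV f"
  obtains W where "W c = 0" "\<And>t. (W has_vector_derivative f t) (at t)"
proof -
  define W where "W u = integral {c..u} f - integral {u..c} f" for u
  have "(W has_vector_derivative f t) (at t)" for t
  proof -
    define a b where "a = min c t - 1" and "b = max c t + 1"
    have ab: "a < t" "t < b" "a < c" "c < b" by (auto simp: a_def b_def)
    have int: "f integrable_on {x..y}" for x y
      by (intro integrable_continuous_real continuous_on_subset[OF f]) auto
    have W: "integral {a..u} f - integral {a..c} f = W u" if "u \<in> {a..b}" for u
    proof (cases "u \<le> c")
      case True
      then have "integral {a..u} f + integral {u..c} f = integral {a..c} f"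
        using that by (intro Henstock_Kurzweil_Integration.integral_combine int) auto
      then show ?thesis using True by (cases "u = c") (simp_all add: W_def algebra_simps)
    next
      case False
      then have "integral {a..c} f + integral {c..u} f = integral {a..u} f"
        using that ab by (intro Henstock_Kurzweil_Integration.integral_combine int) auto
      then show ?thesis using False by (simp add: W_def algebra_simps)
    qed
    have "((\<lambda>u. integral {a..u} f) has_vector_derivative f t) (at t within {a..b})"
      using ab by (intro integral_has_vector_derivative continuous_on_subset[OF f]) auto
    then have "((\<lambda>u. integral {a..u} f - integral {a..c} f) has_vector_derivative f t)
        (at t within {a..b})"
      by (auto intro!: derivative_eq_intros)
    then have "(W has_vector_derivative f t) (at t within {a..b})"
      by (rule has_vector_derivative_transform[rotated 2]) (use ab W in \<open>auto simp: less_imp_le\<close>)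
    then show ?thesis using ab by (simp add: at_within_Icc_at)
  qed
  moreover have "W c = 0" by (simp add: W_def)
  ultimately show ?thesis using that by blast
qed

lemma has_vector_derivative_reflect:
  "(u has_vector_derivative u') (at (- t)) \<Longrightarrow>
    ((\<lambda>t. u (- t)) has_vector_derivative - u') (at t)"
proof -
  assume "(u has_vector_derivative u') (at (- t))"
  moreover have "(uminus has_vector_derivative (- 1 :: real)) (at t)"
    by (auto intro!: derivative_eq_intros)
  ultimately show ?thesis using vector_diff_chain_at[of uminus "-1" t u u'] by (simp add: o_def)
qed

lemma has_vector_derivative_shift:
  "(u has_vector_derivative u') (at (t + c)) \<Longrightarrow>
    ((\<lambda>t. u (t + c)) has_vector_derivative u') (at t)"
proof -
  assume "(u has_vector_derivative u') (at (t + c))"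
  moreover have "((\<lambda>t. t + c) has_vector_derivative (1 :: real)) (at t)"
    by (auto intro!: derivative_eq_intros)
  ultimately show ?thesis
    using vector_diff_chain_at[of "\<lambda>t. t + c" "1" t u u'] by (simp add: o_def)
qed

text \<open>In the weight \<open>exp (b * \<bar>t\<bar>)\<close> integration from \<open>0\<close> has norm at most \<open>1 / b\<close>.  A large \<open>b\<close> therefore
  makes the Picard iteration a contraction on the whole line at once.\<close>

lemma exp_weighted_integral_bound:
  fixes W :: "real \<Rightarrow> 'a::real_normed_vector"
  assumes W: "\<And>t. (W has_vector_derivative f t) (at t)" "W 0 = 0"
    and f: "\<And>t. norm (f t) \<le> m * exp (b * \<bar>t\<bar>)" and b: "b > 0" and m: "m \<ge> 0"
  shows "norm (W t) \<le> m / b * exp (b * \<bar>t\<bar>)"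
proof -
  have *: "norm (V t) \<le> m / b * exp (b * t)"
    if V: "\<And>t. (V has_vector_derivative g t) (at t)" "V 0 = 0"
      and g: "\<And>t. norm (g t) \<le> m * exp (b * \<bar>t\<bar>)" and t: "t \<ge> 0"
    for V g and t :: real
  proof (cases "t = 0")
    case True then show ?thesis using V b m by auto
  next
    case False
    have "norm (V t - V 0) \<le> m / b * exp (b * t) - m / b * exp (b * 0)"
    proof (rule differentiable_bound_general)
      show "0 < t" using t False by auto
      show "continuous_on {0..t} V"
        using V(1) by (meson continuous_at_imp_continuous_on has_vector_derivative_continuous)
      show "continuous_on {0..t} (\<lambda>t. m / b * exp (b * t))" by (intro continuous_intros)
      show "(V has_vector_derivative g x) (at x)" for x by (rule V)
      show "((\<lambda>t. m / b * exp (b * t)) has_vector_derivative m * exp (b * x)) (at x)" for x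
        using b by (auto intro!: derivative_eq_intros
            simp flip: has_real_derivative_iff_has_vector_derivative)
      show "norm (g x) \<le> m * exp (b * x)" if "0 < x" for x using g[of x] that by simp
    qed
    moreover have "0 \<le> m / b" using m b by simp
    ultimately show ?thesis using V(2) by simp
  qed
  show ?thesis
  proof (cases "t \<ge> 0")
    case True
    then show ?thesis using *[OF W f] by simp
  next
    case False
    have "norm (W (- (- t))) \<le> m / b * exp (b * (- t))"
    proof (rule *)
      show "((\<lambda>t. W (- t)) has_vector_derivative - f (- x)) (at x)" for x
        by (rule has_vector_derivative_reflect[OF W(1)])
      show "norm (- f (- x)) \<le> m * exp (b * \<bar>x\<bar>)" for x using f[of "- x"] by simp
    qed (use False W in auto)
    then show ?thesis using False by simp
  qed
qed

text \<open>The maximum of \<open>norm (z t)\<close> divided by the weight \<open>exp (2 * K * (t - a))\<close> reproduces itself with factor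
  \<open>1/2\<close> in the integrated inequality, and can be absorbed.\<close>

lemma gronwall:
  fixes z :: "real \<Rightarrow> 'a::real_normed_vector"
  assumes z: "\<And>t. a \<le> t \<Longrightarrow> t \<le> b \<Longrightarrow> (z has_vector_derivative z' t) (at t)"
    and bnd: "\<And>t. a \<le> t \<Longrightarrow> t \<le> b \<Longrightarrow> norm (z' t) \<le> K * norm (z t) + m"
    and K: "K > 0" and m: "m \<ge> 0" and t: "a \<le> t" "t \<le> b"
  shows "norm (z t) \<le> 2 * exp (2 * K * (t - a)) * (norm (z a) + m * (b - a))"
proof -
  define g where "g t = norm (z t) * exp (- (2 * K * (t - a)))" for t
  have cz: "continuous_on {a..b} z"
    using z by (meson atLeastAtMost_iff continuous_at_imp_continuous_on has_vector_derivative_continuous)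
  have "continuous_on {a..b} g"
    unfolding g_def by (intro continuous_intros cz)
  then obtain s where s: "s \<in> {a..b}" "\<And>t. t \<in> {a..b} \<Longrightarrow> g t \<le> g s"
    using continuous_attains_sup[of "{a..b}" g] t by (auto simp: compact_Icc)
  define M where "M = g s"
  have M: "norm (z t) \<le> M * exp (2 * K * (t - a))" if "t \<in> {a..b}" for t
  proof -
    have "norm (z t) = g t * exp (2 * K * (t - a))" by (simp add: g_def flip: exp_add)
    then show ?thesis using s(2)[OF that] by (simp add: M_def mult_right_mono)
  qed
  have M0: "M \<ge> 0" by (simp add: M_def g_def)
  have "norm (z s) \<le> norm (z a) + M / 2 * exp (2 * K * (s - a)) + m * (b - a)"
  proof (cases "s = a")
    case True
    then show ?thesis using M0 m t by simp
  next
    case False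
    let ?p = "\<lambda>t. M / 2 * exp (2 * K * (t - a)) + m * t"
    have "norm (z s - z a) \<le> ?p s - ?p a"
    proof (rule differentiable_bound_general)
      show "a < s" using s(1) False by auto
      show "continuous_on {a..s} z" by (rule continuous_on_subset[OF cz]) (use s in auto)
      show "continuous_on {a..s} ?p" by (intro continuous_intros)
      fix x assume x: "a < x" "x < s"
      show "(z has_vector_derivative z' x) (at x)" using z x s by auto
      show "(?p has_vector_derivative M * K * exp (2 * K * (x - a)) + m) (at x)"
        by (auto intro!: derivative_eq_intros
            simp flip: has_real_derivative_iff_has_vector_derivative)
      have "norm (z' x) \<le> K * norm (z x) + m" using bnd x s by auto
      also have "\<dots> \<le> K * (M * exp (2 * K * (x - a))) + m"
        using M[of x] x s K by auto
      finally show "norm (z' x) \<le> M * K * exp (2 * K * (x - a)) + m" by (simp add: mult_ac)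
    qed
    moreover have "norm (z s) \<le> norm (z a) + norm (z s - z a)" by norm
    moreover have "m * (s - a) \<le> m * (b - a)" using m s by (intro mult_left_mono) auto
    ultimately show ?thesis using M0 by (simp add: algebra_simps)
  qed
  then have "norm (z s) * exp (- (2 * K * (s - a))) \<le>
     (norm (z a) + M / 2 * exp (2 * K * (s - a)) + m * (b - a)) * exp (- (2 * K * (s - a)))"
    by (rule mult_right_mono) simp
  then have "M \<le> (norm (z a) + m * (b - a)) * exp (- (2 * K * (s - a))) + M / 2"
    by (simp add: M_def g_def algebra_simps flip: exp_add)
  also have "(norm (z a) + m * (b - a)) * exp (- (2 * K * (s - a))) \<le> (norm (z a) + m * (b - a)) * 1"
    using s K t m by (intro mult_left_mono) auto
  finally have "M \<le> 2 * (norm (z a) + m * (b - a))" by simp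
  then have "M * exp (2 * K * (t - a)) \<le> 2 * (norm (z a) + m * (b - a)) * exp (2 * K * (t - a))"
    by (rule mult_right_mono) simp
  then show ?thesis using M[of t] t order_trans by (fastforce simp: mult.assoc mult.left_commute)
qed

lemma vanishing_derivative_const:
  fixes z :: "real \<Rightarrow> 'a::real_normed_vector"
  assumes "convex S" "\<And>t. t \<in> S \<Longrightarrow> (z has_vector_derivative 0) (at t)" "a \<in> S" "b \<in> S"
  shows "z a = z b"
proof -
  obtain c where "\<And>x. x \<in> S \<Longrightarrow> z x = c"
    using has_vector_derivative_zero_constant[OF assms(1)] assms(2)
    by (metis has_vector_derivative_at_within)
  then show ?thesis using assms by auto
qed

section \<open>Ordinary differential equations with a global Lipschitz bound\<close>

text \<open>Write \<open>u t = exp (2 * K * \<bar>t\<bar>) *\<^sub>R w t\<close> with \<open>w\<close> bounded and continuous.  The integral equation then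
  becomes a fixed point equation for \<open>w\<close> with contraction constant \<open>1/2\<close>.  Nonlinear right-hand sides
  make the statement apply both to inhomogeneous equations and to the operator equation of the propagator.\<close>

lemma global_picard_lindeloef:
  fixes F :: "real \<Rightarrow> 'a::banach \<Rightarrow> 'a"
  assumes lip: "\<And>t x y. norm (F t x - F t y) \<le> K * norm (x - y)"
    and cont: "\<And>u. continuous_on UNIV u \<Longrightarrow> continuous_on UNIV (\<lambda>t. F t (u t))"
    and bnd: "\<And>t. norm (F t 0) \<le> m" and K: "K > 0"
  obtains u where "u t0 = x0" "\<And>t. (u has_vector_derivative F t (u t)) (at t)"
proof -
  have m: "m \<ge> 0" using bnd[of 0] norm_ge_zero order_trans by blast
  have zero: "\<exists>u. u 0 = x0 \<and> (\<forall>t. (u has_vector_derivative F t (u t)) (at t))"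
    if lip: "\<And>t x y. norm (F t x - F t y) \<le> K * norm (x - y)"
      and cont: "\<And>u. continuous_on UNIV u \<Longrightarrow> continuous_on UNIV (\<lambda>t. F t (u t))"
      and bnd: "\<And>t. norm (F t 0) \<le> m"
    for F :: "real \<Rightarrow> 'a \<Rightarrow> 'a"
  proof -
    define e where "e t = exp (2 * K * \<bar>t\<bar>)" for t
    have e1: "e t \<ge> 1" for t using K by (simp add: e_def)
    have ce: "continuous_on UNIV e" unfolding e_def by (intro continuous_intros)
    have cG: "continuous_on UNIV (\<lambda>t. F t (e t *\<^sub>R apply_bcontfun w t))" for w
      by (intro cont continuous_intros ce) auto
    have "\<exists>W. W 0 = 0 \<and> (\<forall>t. (W has_vector_derivative F t (e t *\<^sub>R apply_bcontfun w t)) (at t))"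
      for w :: "real \<Rightarrow>\<^sub>C 'a"
      using antiderivative_on_real_line[OF cG, of 0] by metis
    then obtain W where W: "\<And>w. W w 0 = 0"
      "\<And>w t. (W w has_vector_derivative F t (e t *\<^sub>R apply_bcontfun w t)) (at t)"
      by metis
    have bW: "norm (W w t) \<le> (m + K * norm w) / (2 * K) * exp (2 * K * \<bar>t\<bar>)" for w t
    proof (rule exp_weighted_integral_bound[OF W(2) W(1)])
      show "norm (F t (e t *\<^sub>R apply_bcontfun w t)) \<le> (m + K * norm w) * exp (2 * K * \<bar>t\<bar>)" for t
      proof -
        have "norm (F t (e t *\<^sub>R apply_bcontfun w t)) \<le>
            norm (F t 0) + norm (F t (e t *\<^sub>R apply_bcontfun w t) - F t 0)" by norm
        also have "\<dots> \<le> m + K * norm (e t *\<^sub>R apply_bcontfun w t)"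
          using bnd lip[of t "e t *\<^sub>R apply_bcontfun w t" 0] by (intro add_mono) auto
        also have "\<dots> \<le> m * e t + K * (e t * norm w)"
          using e1[of t] m K norm_bounded[of w t]
          by (intro add_mono mult_left_mono) (auto intro: mult_left_mono simp: mult_le_cancel_left1)
        finally show ?thesis by (simp add: e_def algebra_simps)
      qed
    qed (use K m in auto)
    have dW: "norm (W w t - W v t) \<le> (K * norm (w - v)) / (2 * K) * exp (2 * K * \<bar>t\<bar>)" for w v t
    proof (rule exp_weighted_integral_bound[where W="\<lambda>t. W w t - W v t"])
      show "((\<lambda>t. W w t - W v t) has_vector_derivative
        (F t (e t *\<^sub>R apply_bcontfun w t) - F t (e t *\<^sub>R apply_bcontfun v t))) (at t)" for t
        by (intro has_vector_derivative_diff W)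
      show "norm (F t (e t *\<^sub>R apply_bcontfun w t) - F t (e t *\<^sub>R apply_bcontfun v t))
        \<le> K * norm (w - v) * exp (2 * K * \<bar>t\<bar>)" for t
      proof -
        have "norm (e t *\<^sub>R apply_bcontfun w t - e t *\<^sub>R apply_bcontfun v t) \<le> e t * norm (w - v)"
          using norm_bounded[of "w - v" t] e1[of t]
          by (simp add: minus_bcontfun.rep_eq mult_left_mono flip: scaleR_diff_right)
        then have "K * norm (e t *\<^sub>R apply_bcontfun w t - e t *\<^sub>R apply_bcontfun v t)
            \<le> K * (e t * norm (w - v))"
          using K by (intro mult_left_mono) auto
        from order_trans[OF lip this] show ?thesis by (simp add: e_def mult_ac)
      qed
    qed (use K W in auto)
    define T where "T w = Bcontfun (\<lambda>t. (1 / e t) *\<^sub>R (x0 + W w t))" for w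
    have cW: "continuous_on UNIV (W w)" for w
      using W(2) by (meson continuous_at_imp_continuous_on has_vector_derivative_continuous)
    have T: "apply_bcontfun (T w) t = (1 / e t) *\<^sub>R (x0 + W w t)" for w t
      unfolding T_def
    proof (subst Bcontfun_inverse)
      have e0: "e t \<noteq> 0" for t using e1[of t] by linarith
      show "(\<lambda>t. (1 / e t) *\<^sub>R (x0 + W w t)) \<in> bcontfun"
      proof (rule bcontfun_normI)
        show "continuous_on UNIV (\<lambda>t. (1 / e t) *\<^sub>R (x0 + W w t))"
          by (intro continuous_intros ce cW) (use e0 in auto)
        fix t
        have "norm ((1 / e t) *\<^sub>R (x0 + W w t)) \<le> (1 / e t) * (norm x0 + norm (W w t))"
          using e1[of t] by (simp add: norm_triangle_ineq divide_right_mono)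
        also have "\<dots> \<le> (1 / e t) * (norm x0 * e t + (m + K * norm w) / (2 * K) * e t)"
          using bW[of w t] e1[of t]
          by (intro mult_left_mono add_mono) (auto simp: e_def mult_le_cancel_left1)
        also have "\<dots> = norm x0 + (m + K * norm w) / (2 * K)"
          using e1[of t] by (auto simp: field_simps)
        finally show "norm ((1 / e t) *\<^sub>R (x0 + W w t)) \<le> norm x0 + (m + K * norm w) / (2 * K)" .
      qed
    qed simp
    have "\<exists>!w. T w = w"
    proof (rule banach_fix_type[of "1/2"]; (intro allI)?)
      fix w v
      show "dist (T w) (T v) \<le> 1 / 2 * dist w v"
      proof (rule dist_bound)
        fix t
        have "dist (apply_bcontfun (T w) t) (apply_bcontfun (T v) t) = 1 / e t * norm (W w t - W v t)"
          using e1[of t] by (simp add: T dist_norm flip: scaleR_diff_right)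
        also have "\<dots> \<le> 1 / e t * ((K * norm (w - v)) / (2 * K) * e t)"
          using dW[of w t v] e1[of t] by (intro mult_left_mono) (auto simp: e_def)
        also have "\<dots> = 1 / 2 * dist w v"
          using e1[of t] K by (auto simp: field_simps dist_norm)
        finally show "dist (apply_bcontfun (T w) t) (apply_bcontfun (T v) t) \<le> 1 / 2 * dist w v" .
      qed
    qed auto
    then obtain w where w: "T w = w" by auto
    define u where "u t = x0 + W w t" for t
    have ue: "e t *\<^sub>R apply_bcontfun w t = u t" for t
      using T[of w t] w e1[of t] by (auto simp: u_def)
    have "(u has_vector_derivative F t (u t)) (at t)" for t
      unfolding u_def using W(2)[of w t, unfolded ue, unfolded u_def]
      by (auto intro!: derivative_eq_intros)
    moreover have "u 0 = x0" by (simp add: u_def W)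
    ultimately show ?thesis by blast
  qed
  have "\<exists>u. u 0 = x0 \<and> (\<forall>t. (u has_vector_derivative F (t + t0) (u t)) (at t))"
  proof (rule zero[where F="\<lambda>t. F (t + t0)"])
    fix u :: "real \<Rightarrow> 'a" assume u: "continuous_on UNIV u"
    have "continuous_on UNIV (\<lambda>t. F t (u (t - t0)))"
      by (intro cont continuous_on_compose2[OF u] continuous_intros) auto
    then have "continuous_on UNIV (\<lambda>t. (\<lambda>t. F t (u (t - t0))) (t + t0))"
      by (rule continuous_on_compose2) (auto intro!: continuous_intros)
    then show "continuous_on UNIV (\<lambda>t. F (t + t0) (u t))" by simp
  qed (use lip bnd in auto)
  then obtain u where u: "u 0 = x0" "\<And>t. (u has_vector_derivative F (t + t0) (u t)) (at t)"
    by auto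
  show ?thesis
  proof (rule that[of "\<lambda>t. u (t - t0)"])
    show "((\<lambda>t. u (t - t0)) has_vector_derivative F t (u (t - t0))) (at t)" for t
      using has_vector_derivative_shift[of u _ t "- t0"] u(2)[of "t - t0"] by simp
  qed (use u in auto)
qed

section \<open>Inverses in Banach algebras\<close>

definition inverses :: "'a::monoid_mult \<Rightarrow> 'a \<Rightarrow> bool" where
  "inverses x y \<longleftrightarrow> x * y = 1 \<and> y * x = 1"

lemma inverses_mult: "inverses x x' \<Longrightarrow> inverses y y' \<Longrightarrow> inverses (x * y) (y' * x')"
  unfolding inverses_def by (metis mult.assoc mult.right_neutral)

lemma inverses_minus: "inverses x x' \<Longrightarrow> inverses (- x) (- x' :: 'a::ring_1)"
  unfolding inverses_def by simp

lemma inverses_scaleR: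
  "inverses x x' \<Longrightarrow> r \<noteq> 0 \<Longrightarrow> inverses (r *\<^sub>R x) ((1 / r) *\<^sub>R x' :: 'a::real_algebra_1)"
  unfolding inverses_def by simp

lemma neumann_inverse:
  fixes x :: "'a::{real_normed_algebra_1,banach}"
  assumes "norm (1 - x) < 1"
  shows "\<exists>y. inverses x y \<and> norm y \<le> 1 / (1 - norm (1 - x))"
proof -
  define e y where "e = 1 - x" and "y = (\<Sum>i. e ^ i)"
  have e: "norm e < 1" using assms by (simp add: e_def)
  have sum: "summable (\<lambda>i. e ^ i)" by (rule complete_algebra_summable_geometric[OF e])
  have split: "y = 1 + (\<Sum>i. e ^ Suc i)"
    unfolding y_def using suminf_split_head[OF sum] by simp
  have "(\<Sum>i. e ^ Suc i) = e * y"
    unfolding y_def power_Suc by (rule suminf_mult[OF sum])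
  moreover have "(\<Sum>i. e ^ Suc i) = y * e"
    unfolding y_def power_Suc2 by (rule suminf_mult2[OF sum, symmetric])
  ultimately have y: "y = 1 + e * y" "y = 1 + y * e" using split by auto
  have "norm y \<le> 1 + norm e * norm y"
    by (subst y(1)) (metis norm_mult_ineq norm_one norm_triangle_le add_left_mono)
  then have "norm y \<le> 1 / (1 - norm e)" using e by (simp add: field_simps)
  moreover have "inverses x y"
    using y unfolding inverses_def e_def by (simp add: algebra_simps)
  ultimately show ?thesis by (auto simp: e_def)
qed

lemma inverse_perturbation:
  fixes x y :: "'a::{real_normed_algebra_1,banach}"
  assumes x: "inverses x x'" and y: "norm (y - x) * (2 * norm x') \<le> 1"
  shows "\<exists>y'. inverses y y' \<and> norm y' \<le> 2 * norm x'"
proof -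
  define w where "w = x' * y"
  have "1 - w = x' * (x - y)" using x by (simp add: w_def inverses_def algebra_simps)
  then have "norm (1 - w) \<le> norm x' * norm (x - y)" by (simp add: norm_mult_ineq)
  also have "\<dots> \<le> 1 / 2" using y by (simp add: norm_minus_commute mult_ac)
  finally have w: "norm (1 - w) \<le> 1 / 2" .
  then obtain v where v: "inverses w v" "norm v \<le> 1 / (1 - norm (1 - w))"
    using neumann_inverse[of w] by auto
  have "1 / (1 - norm (1 - w)) \<le> 2" using w by (simp add: field_simps)
  with v have v2: "norm v \<le> 2" by simp
  have "y = x * w" using x by (simp add: w_def inverses_def flip: mult.assoc)
  then have "inverses y (v * x')" using inverses_mult[OF x v(1)] by simp
  moreover have "norm (v * x') \<le> 2 * norm x'"
    using v2 by (meson norm_mult_ineq mult_right_mono norm_ge_zero order_trans)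
  ultimately show ?thesis by blast
qed

text \<open>A sequence of points at which the inverses blow up would accumulate at a point whose invertible
  neighbourhood, with bounded inverses, is given by \<open>inverse_perturbation\<close>.\<close>

lemma uniform_inverse_on_compact:
  fixes g :: "'s::metric_space \<Rightarrow> 'a::{real_normed_algebra_1,banach}"
  assumes S: "compact S" and g: "continuous_on S g" and inv: "\<And>s. s \<in> S \<Longrightarrow> \<exists>x. inverses (g s) x"
  shows "\<exists>\<rho>>0. \<exists>K>0. \<forall>s\<in>S. \<forall>y. norm (y - g s) \<le> \<rho> \<longrightarrow> (\<exists>x. inverses y x \<and> norm x \<le> K)"
proof (rule ccontr)
  assume neg: "\<not> ?thesis"
  have "\<exists>s y. s \<in> S \<and> norm (y - g s) \<le> 1 / Suc n \<and> \<not> (\<exists>x. inverses y x \<and> norm x \<le> Suc n)" for n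
  proof (rule ccontr)
    assume "\<not> ?thesis"
    then have "\<forall>s\<in>S. \<forall>y. norm (y - g s) \<le> 1 / Suc n \<longrightarrow> (\<exists>x. inverses y x \<and> norm x \<le> Suc n)"
      by blast
    moreover have "1 / real (Suc n) > 0" "real (Suc n) > 0" by auto
    ultimately show False using neg by blast
  qed
  then obtain s y where s: "\<And>n. s n \<in> S" and y: "\<And>n. norm (y n - g (s n)) \<le> 1 / Suc n"
    and no: "\<And>n. \<not> (\<exists>x. inverses (y n) x \<and> norm x \<le> Suc n)"
    by metis
  obtain a r where a: "a \<in> S" "strict_mono r" "(s \<circ> r) \<longlonglongrightarrow> a"
    using S s unfolding compact_def by blast
  obtain x where x: "inverses (g a) x" using inv a by blast
  have "(\<lambda>n. g ((s \<circ> r) n)) \<longlonglongrightarrow> g a"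
    by (rule continuous_on_tendsto_compose[OF g a(3) a(1)]) (use s in auto)
  moreover have "(\<lambda>n. y (r n) - g ((s \<circ> r) n)) \<longlonglongrightarrow> 0"
  proof (rule Lim_null_comparison)
    show "\<forall>\<^sub>F n in sequentially. norm (y (r n) - g ((s \<circ> r) n)) \<le> 1 / Suc (r n)"
      using y by simp
    show "(\<lambda>n. 1 / real (Suc (r n))) \<longlonglongrightarrow> 0"
      using LIMSEQ_subseq_LIMSEQ[OF lim_inverse_n' a(2)] LIMSEQ_subseq_LIMSEQ[OF LIMSEQ_inverse_real_of_nat a(2)]
      by (simp add: o_def inverse_eq_divide)
  qed
  ultimately have "(\<lambda>n. y (r n) - g ((s \<circ> r) n) + g ((s \<circ> r) n)) \<longlonglongrightarrow> 0 + g a"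
    by (intro tendsto_add)
  then have lim: "(\<lambda>n. y (r n)) \<longlonglongrightarrow> g a" by simp
  define d where "d = 1 / (2 * norm x + 1)"
  have "d > 0" by (auto simp: d_def add_nonneg_pos)
  obtain N1 where N1: "\<And>n. n \<ge> N1 \<Longrightarrow> norm (y (r n) - g a) < d"
    using LIMSEQ_D[OF lim \<open>d > 0\<close>] by blast
  obtain N2 where N2: "2 * norm x \<le> real N2" using real_arch_simple by blast
  define n where "n = max N1 N2"
  have "norm (y (r n) - g a) * (2 * norm x) \<le> d * (2 * norm x)"
    using N1[of n] by (intro mult_right_mono) (auto simp: n_def)
  also have "\<dots> \<le> 1" by (simp add: d_def divide_le_eq add_nonneg_pos)
  finally obtain x' where x': "inverses (y (r n)) x'" "norm x' \<le> 2 * norm x"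
    using inverse_perturbation[OF x] by blast
  have "N2 \<le> n" "n \<le> r n" using seq_suble[OF a(2)] by (auto simp: n_def)
  then have "norm x' \<le> real (Suc (r n))" using x'(2) N2 by linarith
  with no x' show False by blast
qed

lemma one_minus_power_factor:
  fixes x :: "'a::ring_1"
  shows "(1 - x) * (\<Sum>i<n. x ^ i) = 1 - x ^ n" "(\<Sum>i<n. x ^ i) * (1 - x) = 1 - x ^ n"
proof -
  show "(1 - x) * (\<Sum>i<n. x ^ i) = 1 - x ^ n"
    by (induction n) (simp_all add: distrib_left left_diff_distrib)
  show "(\<Sum>i<n. x ^ i) * (1 - x) = 1 - x ^ n"
  proof (induction n)
    case (Suc n)
    have "(\<Sum>i<Suc n. x ^ i) * (1 - x) = (1 - x ^ n) + x ^ n * (1 - x)"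
      unfolding sum.lessThan_Suc distrib_right Suc ..
    then show ?case by (simp add: right_diff_distrib power_commutes)
  qed simp
qed

text \<open>Invertibility of \<open>x\<close> passes to \<open>exp x - 1\<close> for small \<open>x\<close>, because the cofactor, the power
  series of \<open>(exp x - 1) / x\<close>, is close to \<open>1\<close>.\<close>

lemma exp_minus_one_factor:
  fixes x :: "'a::{real_normed_algebra_1,banach}"
  assumes "norm x \<le> 1"
  shows "\<exists>E. exp x - 1 = x * E \<and> norm (E - 1) \<le> 3 * norm x"
proof -
  have bnd: "norm (x ^ n /\<^sub>R fact (n + k)) \<le> norm x ^ n /\<^sub>R fact n" for n k
  proof -
    have "inverse (fact (n + k)) \<le> inverse (fact n :: real)"
      by (intro le_imp_inverse_le fact_mono) auto
    then show ?thesis by (auto intro!: mult_mono norm_power_ineq simp: abs_mult)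
  qed
  have s: "summable (\<lambda>n. x ^ n /\<^sub>R fact (n + k))" for k
  proof (rule summable_comparison_test')
    show "summable (\<lambda>n. norm x ^ n /\<^sub>R fact n)" by (rule summable_exp_generic)
    show "norm (x ^ n /\<^sub>R fact (n + k)) \<le> norm x ^ n /\<^sub>R fact n" for n by (rule bnd)
  qed
  define E E2 where "E = (\<Sum>n. x ^ n /\<^sub>R fact (n + 1))" and "E2 = (\<Sum>n. x ^ n /\<^sub>R fact (n + 2))"
  have step: "(\<Sum>n. x ^ n /\<^sub>R fact (n + k)) =
      1 /\<^sub>R fact k + x * (\<Sum>n. x ^ n /\<^sub>R fact (n + Suc k))" for k
  proof -
    have "(\<Sum>n. x ^ n /\<^sub>R fact (n + k)) =
        1 /\<^sub>R fact k + (\<Sum>n. x ^ Suc n /\<^sub>R fact (Suc n + k))"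
      using suminf_split_head[OF s[of k]] by simp
    also have "(\<Sum>n. x ^ Suc n /\<^sub>R fact (Suc n + k)) = x * (\<Sum>n. x ^ n /\<^sub>R fact (n + Suc k))"
      by (subst suminf_mult[OF s, symmetric]) simp
    finally show ?thesis .
  qed
  have "exp x = 1 + x * E" using step[of 0] by (simp add: exp_def E_def)
  moreover have "E - 1 = x * E2" using step[of 1] by (simp add: E_def E2_def numeral_2_eq_2)
  moreover have "norm E2 \<le> 3"
  proof -
    have "norm E2 \<le> (\<Sum>n. norm x ^ n /\<^sub>R fact n)"
      unfolding E2_def
    proof (rule norm_suminf_le)
      show "norm (x ^ n /\<^sub>R fact (n + 2)) \<le> norm x ^ n /\<^sub>R fact n" for n by (rule bnd)
    qed (rule summable_exp_generic)
    also have "\<dots> = exp (norm x)" by (simp add: exp_def)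
    also have "\<dots> \<le> exp 1" using assms by simp
    also have "\<dots> \<le> 3" by (rule exp_le)
    finally show ?thesis .
  qed
  moreover have "norm (x * E2) \<le> norm x * 3"
    using norm_mult_ineq[of x E2] \<open>norm E2 \<le> 3\<close> by (meson mult_left_mono norm_ge_zero order_trans)
  ultimately show ?thesis by (intro exI[of _ E]) (simp add: mult.commute)
qed

lemma commute_exp:
  fixes x y :: "'a::{real_normed_algebra_1,banach}"
  assumes "x * y = y * x"
  shows "exp x * y = y * exp x"
proof -
  have "x ^ n * y = y * x ^ n" for n
    by (metis assms power_commuting_commutes)
  then show ?thesis
    unfolding exp_def by (simp add: suminf_mult2 suminf_mult[symmetric] summable_exp_generic)
qed

section \<open>Averages of the resolvent over roots of unity\<close>

text \<open>The embedding of the complex numbers sending the imaginary unit to \<open>j\<close>.  It lets a real Banach algebra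
  containing a square root of \<open>-1\<close> play the role of a complex one, so that complex Banach spaces
  and complexifications of real ones are treated alike.\<close>

definition cscal :: "'a::real_algebra_1 \<Rightarrow> complex \<Rightarrow> 'a" where
  "cscal j z = Re z *\<^sub>R 1 + Im z *\<^sub>R j"

locale complex_unit =
  fixes j :: "'a::{real_normed_algebra_1,banach}"
  assumes jj: "j * j = - 1"
begin

lemma cscal_mult: "cscal j (z * w) = cscal j z * cscal j w"
  unfolding cscal_def by (simp add: algebra_simps jj)

lemma cscal_1 [simp]: "cscal j 1 = 1"
  by (simp add: cscal_def)

lemma cscal_of_real: "cscal j (of_real r) = of_real r"
  by (simp add: cscal_def of_real_def)

lemma cscal_power: "cscal j (z ^ n) = cscal j z ^ n"
  by (induction n) (simp_all add: cscal_mult)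

lemma cscal_commute: "x * j = j * x \<Longrightarrow> x * cscal j z = cscal j z * x"
  unfolding cscal_def by (simp add: algebra_simps)

lemma norm_cscal: "norm (cscal j z) \<le> (1 + norm j) * cmod z"
proof -
  have "norm (cscal j z) \<le> \<bar>Re z\<bar> + \<bar>Im z\<bar> * norm j"
    unfolding cscal_def by (rule order_trans[OF norm_triangle_ineq]) simp
  also have "\<dots> \<le> cmod z + cmod z * norm j"
    by (intro add_mono mult_right_mono abs_Re_le_cmod abs_Im_le_cmod) auto
  finally show ?thesis by (simp add: algebra_simps)
qed

lemma bounded_linear_cscal: "bounded_linear (cscal j)"
proof (rule bounded_linear_intro)
  show "norm (cscal j z) \<le> cmod z * (1 + norm j)" for z using norm_cscal[of z] by (simp add: mult.commute)
qed (simp_all add: cscal_def algebra_simps)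

lemmas cscal_diff = linear_diff[OF bounded_linear.linear[OF bounded_linear_cscal]]

lemma cscal_sum: "cscal j (sum f S) = (\<Sum>i\<in>S. cscal j (f i))"
  by (rule linear_sum[OF bounded_linear.linear[OF bounded_linear_cscal]])

lemma inverses_cscal: "z \<noteq> 0 \<Longrightarrow> inverses (cscal j z) (cscal j (1 / z))"
  unfolding inverses_def by (simp flip: cscal_mult)

lemma exp_cscal: "exp (cscal j z) = cscal j (exp z)"
proof -
  have "cscal j (exp z) = (\<Sum>n. cscal j (z ^ n /\<^sub>R fact n))"
    unfolding exp_def by (rule bounded_linear.suminf[OF bounded_linear_cscal summable_exp_generic])
  also have "\<dots> = exp (cscal j z)"
    unfolding exp_def
    by (simp add: linear_scale[OF bounded_linear.linear[OF bounded_linear_cscal]] cscal_power)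
  finally show ?thesis by simp
qed

text \<open>The part of the spectral mapping theorem that is needed, for a short time \<open>h\<close>.  Away from \<open>z = 1\<close> the number
  \<open>1 - z\<close> dominates \<open>exp (h l) - 1\<close>.  Near \<open>1\<close>, where \<open>z = exp (\<i> \<theta>)\<close> with small \<open>\<theta>\<close>, the element is \<open>1 - exp Z\<close> with the small
  exponent \<open>Z = h l + \<theta> j\<close>, hence \<open>Z\<close> up to an invertible factor, and \<open>Z\<close> is invertible because \<open>l\<close>
  has no spectrum on the imaginary axis.\<close>

lemma exp_unit_circle_invertible:
  assumes lj: "l * j = j * l" and res: "\<And>\<omega>::real. \<exists>x. inverses (\<omega> *\<^sub>R j - l) x"
  shows "\<exists>h>0. \<forall>z. cmod z = 1 \<longrightarrow> (\<exists>x. inverses (1 - cscal j z * exp (h *\<^sub>R l)) x)"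
proof -
  define k where "k = 1 + norm j"
  \<comment> \<open>The choice of \<open>\<mu>\<close>, a bound for \<open>norm (h *\<^sub>R l)\<close>, makes the exponent \<open>Z\<close> below smaller than \<open>1/3\<close>.\<close>
  define \<mu> where "\<mu> = 1 / (100 * k\<^sup>2)"
  define h where "h = \<mu> / (norm l + 1)"
  have k: "k \<ge> 1" by (simp add: k_def)
  then have k2: "k \<le> k\<^sup>2" "1 \<le> k\<^sup>2" by (auto simp: self_le_power one_le_power)
  have \<mu>: "\<mu> > 0" "\<mu> * k\<^sup>2 = 1 / 100" using k by (auto simp: \<mu>_def)
  have \<mu>k: "\<mu> * k \<le> 1 / 100" "\<mu> \<le> 1 / 100"
    using \<mu>(2) mult_left_mono[OF k2(1), of \<mu>] mult_left_mono[OF k2(2), of \<mu>] \<mu>(1) by linarith+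
  have h: "h > 0" using \<mu> by (simp add: h_def add_nonneg_pos)
  have "norm (h *\<^sub>R l) = \<mu> * (norm l / (norm l + 1))" using \<mu> by (simp add: h_def add_nonneg_pos)
  also have "\<dots> \<le> \<mu> * 1" using \<mu> by (intro mult_left_mono) (auto simp: divide_le_eq add_nonneg_pos)
  finally have hl: "norm (h *\<^sub>R l) \<le> \<mu>" by simp
  define M where "M = exp (h *\<^sub>R l)"
  have M1: "norm (M - 1) \<le> 2 * \<mu>"
  proof -
    obtain E where E: "exp (h *\<^sub>R l) - 1 = (h *\<^sub>R l) * E" "norm (E - 1) \<le> 3 * norm (h *\<^sub>R l)"
      using exp_minus_one_factor[of "h *\<^sub>R l"] hl \<mu>k by auto
    have "norm E \<le> norm (1::'a) + norm (E - 1)" by norm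
    then have "norm E \<le> 2" using E(2) hl \<mu>k by simp
    then have "norm ((h *\<^sub>R l) * E) \<le> \<mu> * 2"
      using hl \<mu> by (intro order_trans[OF norm_mult_ineq] mult_mono) auto
    then show ?thesis using E(1) by (simp add: M_def)
  qed
  have "\<exists>x. inverses (1 - cscal j z * M) x" if z: "cmod z = 1" for z
  proof (cases "cmod (z - 1) \<le> 2 * \<mu> * k")
    case False
    then have z1: "cmod (1 - z) > 2 * \<mu> * k" by (simp add: norm_minus_commute)
    moreover have "0 < \<mu> * k" using \<mu> k by auto
    ultimately have z0: "1 - z \<noteq> 0" by auto
    have "norm (cscal j (z / (1 - z)) * (M - 1)) \<le> (k * cmod (z / (1 - z))) * (2 * \<mu>)"
      using norm_cscal[of "z / (1 - z)"] M1 k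
      by (intro order_trans[OF norm_mult_ineq] mult_mono) (auto simp: k_def)
    also have "\<dots> = (2 * \<mu> * k) / cmod (1 - z)" by (simp add: norm_divide z)
    also have "\<dots> < 1" using z1 \<mu> k z0 by (simp add: field_simps)
    finally have "norm (1 - (1 - cscal j (z / (1 - z)) * (M - 1))) < 1" by simp
    then obtain x where x: "inverses (1 - cscal j (z / (1 - z)) * (M - 1)) x"
      using neumann_inverse by blast
    have "cscal j (1 - z) * (1 - cscal j (z / (1 - z)) * (M - 1)) = cscal j (1 - z) - cscal j z * (M - 1)"
      using z0 by (simp add: right_diff_distrib flip: mult.assoc cscal_mult)
    also have "\<dots> = 1 - cscal j z * M" by (simp add: cscal_diff algebra_simps)
    finally show ?thesis using inverses_mult[OF inverses_cscal[OF z0] x] by auto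
  next
    case True
    define \<theta> where "\<theta> = Im (Ln z)"
    have z0: "z \<noteq> 0" using z by auto
    have "Re (Ln z) = 0" using z z0 by simp
    then have "Ln z = \<i> * \<theta>" by (simp add: \<theta>_def complex_eq_iff)
    then have z\<theta>: "exp (\<i> * \<theta>) = z" using exp_Ln[OF z0] by simp
    have "cmod (Ln (1 + (z - 1))) \<le> 2 * cmod (z - 1)"
      by (rule norm_Ln_le) (use True \<mu>k in auto)
    then have "\<bar>\<theta>\<bar> \<le> 4 * \<mu> * k"
      using True abs_Im_le_cmod[of "Ln z"] by (simp add: \<theta>_def)
    define Z where "Z = h *\<^sub>R l + \<theta> *\<^sub>R j"
    have "norm (\<theta> *\<^sub>R j) \<le> (4 * \<mu> * k) * k"
      using \<open>\<bar>\<theta>\<bar> \<le> 4 * \<mu> * k\<close> \<mu> k by (simp only: norm_scaleR, intro mult_mono) (auto simp: k_def)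
    also have "\<dots> = 4 / 100" using \<mu>(2) by (simp add: power2_eq_square)
    finally have "norm Z \<le> 5 / 100"
      unfolding Z_def using hl \<mu>k by (intro order_trans[OF norm_triangle_ineq]) auto
    then obtain E where E: "exp Z - 1 = Z * E" "norm (E - 1) \<le> 3 * norm Z"
      using exp_minus_one_factor[of Z] by auto
    have "norm (1 - E) < 1" using E(2) \<open>norm Z \<le> 5 / 100\<close> by (simp add: norm_minus_commute)
    then obtain E' where E': "inverses E E'" using neumann_inverse by blast
    have "exp Z = exp (h *\<^sub>R l) * exp (\<theta> *\<^sub>R j)"
      unfolding Z_def using lj by (intro exp_add_commuting) simp
    also have "exp (\<theta> *\<^sub>R j) = cscal j z"
      using exp_cscal[of "\<i> * \<theta>"] z\<theta> by (simp add: cscal_def)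
    also have "exp (h *\<^sub>R l) * cscal j z = cscal j z * M"
      unfolding M_def
      by (rule cscal_commute[OF commute_exp]) (use lj in simp)
    finally have eq: "1 - cscal j z * M = - (Z * E)" using E(1) by (simp add: algebra_simps)
    obtain x where x: "inverses ((- \<theta> / h) *\<^sub>R j - l) x" using res by blast
    have "Z = - (h *\<^sub>R ((- \<theta> / h) *\<^sub>R j - l))" using h by (simp add: Z_def algebra_simps)
    then have "inverses Z (- ((1 / h) *\<^sub>R x))"
      using inverses_minus[OF inverses_scaleR[OF x, of h]] h by simp
    from inverses_minus[OF inverses_mult[OF this E']] eq show ?thesis by auto
  qed
  then show ?thesis using h by (auto simp: M_def)
qed

text \<open>Multiplied by \<open>1 - x ^ n\<close>, each summand becomes a finite geometric sum.  Averaging over the roots of unity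
  kills all its terms except the zeroth one.\<close>

lemma average_over_roots_of_unity:
  fixes r :: "nat \<Rightarrow> 'a"
  assumes n: "n > 0" and Mj: "M * j = j * M"
    and r: "\<And>k. k < n \<Longrightarrow> inverses (1 - cscal j (of_real \<sigma> * cis (2 * pi * k / n)) * M) (r k)"
  shows "inverses (1 - \<sigma> ^ n *\<^sub>R M ^ n) ((1 / n) *\<^sub>R (\<Sum>k<n. r k))"
proof -
  define \<omega> where "\<omega> k = cis (2 * pi * real k / real n)" for k
  define x where "x k = cscal j (of_real \<sigma> * \<omega> k) * M" for k
  have pw: "x k ^ i = cscal j ((of_real \<sigma> * \<omega> k) ^ i) * M ^ i" for k i
  proof (induction i)
    case (Suc i)
    have "x k ^ Suc i = cscal j (of_real \<sigma> * \<omega> k) * (M * cscal j ((of_real \<sigma> * \<omega> k) ^ i)) * M ^ i"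
      using Suc by (simp add: x_def mult.assoc)
    also have "M * cscal j ((of_real \<sigma> * \<omega> k) ^ i) = cscal j ((of_real \<sigma> * \<omega> k) ^ i) * M"
      by (rule cscal_commute[OF Mj])
    finally show ?case by (simp add: cscal_mult mult.assoc)
  qed simp
  have cisn: "cis (2 * pi * real k / real n) ^ n = 1" for k
  proof -
    have "cis (2 * pi * real k / real n) ^ n = cis (real n * (2 * pi * real k / real n))"
      by (rule Complex.DeMoivre)
    also have "real n * (2 * pi * real k / real n) = 2 * pi * real k" using n by simp
    finally show ?thesis using cis_multiple_2pi[of "real k"] by simp
  qed
  then have "\<omega> k ^ n = 1" for k by (simp add: \<omega>_def)
  then have xn: "x k ^ n = \<sigma> ^ n *\<^sub>R M ^ n" for k
    using cscal_of_real[of "\<sigma> ^ n"]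
    by (simp add: pw power_mult_distrib scaleR_conv_of_real)
  have zero: "(\<Sum>k<n. \<omega> k ^ i) = 0" if i: "0 < i" "i < n" for i
  proof -
    define c where "c = cis (2 * pi * real i / real n)"
    have c: "c = exp (2 * of_real pi * \<i> * of_nat i / of_nat n)" by (simp add: c_def cis_conv_exp mult_ac)
    have "c \<noteq> 1" unfolding c using complex_root_unity_eq_1[of n i] i by (auto dest: dvd_imp_le)
    moreover have "c ^ n = 1" by (simp add: c_def cisn)
    moreover have "\<omega> k ^ i = c ^ k" for k by (simp add: \<omega>_def c_def Complex.DeMoivre mult_ac)
    ultimately show ?thesis by (simp add: geometric_sum)
  qed
  have sum: "(\<Sum>k<n. \<Sum>i<n. x k ^ i) = of_nat n"
  proof -
    have "(\<Sum>k<n. \<Sum>i<n. x k ^ i) = (\<Sum>i<n. \<Sum>k<n. x k ^ i)" by (rule sum.swap)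
    also have "\<dots> = (\<Sum>i<n. cscal j (of_real \<sigma> ^ i * (\<Sum>k<n. \<omega> k ^ i)) * M ^ i)"
      by (simp add: pw cscal_sum sum_distrib_left sum_distrib_right power_mult_distrib)
    also have "\<dots> = (\<Sum>i<n. if i = 0 then of_nat n else 0)"
    proof (rule sum.cong)
      fix i assume "i \<in> {..<n}"
      then show "cscal j (of_real \<sigma> ^ i * (\<Sum>k<n. \<omega> k ^ i)) * M ^ i = (if i = 0 then of_nat n else 0)"
        using zero[of i] cscal_of_real[of "real n"] by (cases "i = 0") (simp_all add: \<omega>_def cscal_def)
    qed simp
    also have "\<dots> = of_nat n" using n by simp
    finally show ?thesis .
  qed
  have r1: "r k * (1 - \<sigma> ^ n *\<^sub>R M ^ n) = (\<Sum>i<n. x k ^ i)"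
    and r2: "(1 - \<sigma> ^ n *\<^sub>R M ^ n) * r k = (\<Sum>i<n. x k ^ i)" if "k < n" for k
  proof -
    have inv: "(1 - x k) * r k = 1" "r k * (1 - x k) = 1"
      using r[OF that] by (simp_all add: inverses_def x_def \<omega>_def)
    show "r k * (1 - \<sigma> ^ n *\<^sub>R M ^ n) = (\<Sum>i<n. x k ^ i)"
      unfolding xn[symmetric, of k] one_minus_power_factor(1)[symmetric]
      by (simp add: inv flip: mult.assoc)
    show "(1 - \<sigma> ^ n *\<^sub>R M ^ n) * r k = (\<Sum>i<n. x k ^ i)"
      unfolding xn[symmetric, of k] one_minus_power_factor(2)[symmetric]
      by (simp add: inv mult.assoc)
  qed
  have "(1 / real n) *\<^sub>R of_real (real n) = (1 :: 'a)" using n unfolding of_real_def by simp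
  then have "(1 / real n) *\<^sub>R of_nat n = (1 :: 'a)" by simp
  then show ?thesis
    unfolding inverses_def using sum r1 r2
    by (simp add: sum_distrib_left sum_distrib_right)
qed

text \<open>With \<open>N = exp (T l)\<close>, the element \<open>p\<close> is close to the identity where \<open>\<alpha> *\<^sub>R N\<close> is small and close to \<open>0\<close>
  where \<open>\<alpha> *\<^sub>R N\<close> is large, and similarly for \<open>q\<close>: both approximate the spectral projection of \<open>l\<close> onto the
  left half-plane.  They are averages of resolvents over the circles of radius \<open>a\<close> and \<open>b = 1 / a\<close>,
  between which the resolvent is bounded and Lipschitz; this gives \<open>norm (q - p) \<le> 1/4\<close> for all \<open>n\<close>, after
  which \<open>n\<close> can be taken large enough to make \<open>\<alpha> = a ^ n\<close> small.\<close>

theorem approximate_spectral_projections: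
  assumes lj: "l * j = j * l" and res: "\<And>\<omega>::real. \<exists>x. inverses (\<omega> *\<^sub>R j - l) x"
  shows "\<exists>T>0. \<exists>\<alpha>>0. \<exists>p q. inverses (1 - \<alpha> *\<^sub>R exp (T *\<^sub>R l)) p \<and>
    inverses (1 - (1 / \<alpha>) *\<^sub>R exp (T *\<^sub>R l)) q \<and>
    norm (q - p) + \<alpha> * (norm p + norm q + 1) \<le> 1 / 2"
proof -
  obtain h where h: "h > 0"
    and inv: "\<And>z. cmod z = 1 \<Longrightarrow> \<exists>x. inverses (1 - cscal j z * exp (h *\<^sub>R l)) x"
    using exp_unit_circle_invertible[OF assms] by blast
  define M where "M = exp (h *\<^sub>R l)"
  have Mj: "M * j = j * M" unfolding M_def by (rule commute_exp) (simp add: lj)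
  obtain \<rho> K where \<rho>: "\<rho> > 0" and K: "K > 0"
    and unif: "\<And>z y. cmod z = 1 \<Longrightarrow> norm (y - (1 - cscal j z * M)) \<le> \<rho> \<Longrightarrow>
      \<exists>x. inverses y x \<and> norm x \<le> K"
  proof -
    have "\<exists>\<rho>>0. \<exists>K>0. \<forall>z\<in>sphere 0 1. \<forall>y. norm (y - (1 - cscal j z * M)) \<le> \<rho> \<longrightarrow>
        (\<exists>x. inverses y x \<and> norm x \<le> K)"
      by (rule uniform_inverse_on_compact)
        (use inv in \<open>auto simp: M_def intro!: continuous_intros
          bounded_linear.continuous_on[OF bounded_linear_cscal]\<close>)
    then show ?thesis using that by (auto simp: dist_norm)
  qed
  define c where "c = (1 + norm j) * norm M + 1"
  have c: "c > 0" by (auto simp: c_def intro!: add_nonneg_pos)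
  have close: "norm (cscal j w * M) \<le> c * cmod w" for w
  proof -
    have "norm (cscal j w * M) \<le> ((1 + norm j) * cmod w) * norm M"
      using norm_cscal[of w] by (intro order_trans[OF norm_mult_ineq] mult_right_mono) auto
    also have "\<dots> \<le> c * cmod w"
      by (simp add: c_def algebra_simps)
    finally show ?thesis .
  qed
  define \<epsilon> where "\<epsilon> = min (1 / 2) (min (\<rho> / (2 * c)) (1 / (12 * c * K\<^sup>2)))"
  define a b where "a = 1 - \<epsilon>" and "b = 1 / a"
  have \<epsilon>: "0 < \<epsilon>" "\<epsilon> \<le> 1 / 2" "2 * \<epsilon> * c \<le> \<rho>" "3 * \<epsilon> * c * K\<^sup>2 \<le> 1 / 4"
  proof -
    show "0 < \<epsilon>" "\<epsilon> \<le> 1 / 2" using \<rho> c K by (auto simp: \<epsilon>_def)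
    have "\<epsilon> \<le> \<rho> / (2 * c)" "\<epsilon> \<le> 1 / (12 * c * K\<^sup>2)" by (auto simp: \<epsilon>_def)
    then show "2 * \<epsilon> * c \<le> \<rho>" "3 * \<epsilon> * c * K\<^sup>2 \<le> 1 / 4"
      using c K by (auto simp: field_simps)
  qed
  have a: "1 / 2 \<le> a" "a < 1" using \<epsilon> by (auto simp: a_def)
  have "1 / a \<le> 1 + 2 * \<epsilon>" "1 \<le> 1 / a"
    using a \<epsilon>(1,2) by (auto simp: a_def field_simps mult_left_le)
  then have b: "1 \<le> b" "b \<le> 1 + 2 * \<epsilon>" by (auto simp: b_def)
  have ex: "\<exists>x. inverses (1 - cscal j (of_real \<sigma> * z) * M) x \<and> norm x \<le> K"
    if "\<bar>\<sigma> - 1\<bar> \<le> 2 * \<epsilon>" "cmod z = 1" for \<sigma> z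
  proof (rule unif[OF that(2)])
    have "1 - cscal j (of_real \<sigma> * z) * M - (1 - cscal j z * M) = cscal j (z - of_real \<sigma> * z) * M"
      by (simp add: cscal_diff algebra_simps)
    moreover have "cmod (z - of_real \<sigma> * z) = \<bar>\<sigma> - 1\<bar>"
    proof -
      have "z - of_real \<sigma> * z = of_real (1 - \<sigma>) * z" by (simp add: algebra_simps)
      then show ?thesis using that(2) by (simp only: norm_mult norm_of_real) (simp add: abs_minus_commute)
    qed
    ultimately have "norm (1 - cscal j (of_real \<sigma> * z) * M - (1 - cscal j z * M)) \<le> c * (2 * \<epsilon>)"
      using close[of "z - of_real \<sigma> * z"] that(1) c by (metis mult_left_mono less_imp_le order_trans)
    then show "norm (1 - cscal j (of_real \<sigma> * z) * M - (1 - cscal j z * M)) \<le> \<rho>"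
      using \<epsilon>(3) by (simp add: mult_ac)
  qed
  have "\<exists>x. inverses (1 - cscal j (of_real a * z) * M) x \<and> norm x \<le> K" if "cmod z = 1" for z
    by (rule ex) (use a that \<epsilon> in \<open>auto simp: a_def\<close>)
  then obtain ra where ra: "\<And>z. cmod z = 1 \<Longrightarrow> inverses (1 - cscal j (of_real a * z) * M) (ra z)"
    "\<And>z. cmod z = 1 \<Longrightarrow> norm (ra z) \<le> K" by metis
  have "\<exists>x. inverses (1 - cscal j (of_real b * z) * M) x \<and> norm x \<le> K" if "cmod z = 1" for z
    by (rule ex) (use b that \<epsilon> in auto)
  then obtain rb where rb: "\<And>z. cmod z = 1 \<Longrightarrow> inverses (1 - cscal j (of_real b * z) * M) (rb z)"
    "\<And>z. cmod z = 1 \<Longrightarrow> norm (rb z) \<le> K" by metis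
  have rab: "norm (rb z - ra z) \<le> 1 / 4" if z: "cmod z = 1" for z
  proof -
    have "rb z - ra z = rb z * ((1 - cscal j (of_real a * z) * M) - (1 - cscal j (of_real b * z) * M)) * ra z"
    proof -
      have "rb z * (x - y) * ra z = rb z * (x * ra z) - (rb z * y) * ra z" for x y
        by (simp only: right_diff_distrib left_diff_distrib mult.assoc)
      then show ?thesis using ra(1)[OF z] rb(1)[OF z] by (simp only: inverses_def) simp
    qed
    also have "(1 - cscal j (of_real a * z) * M) - (1 - cscal j (of_real b * z) * M)
        = cscal j (of_real (b - a) * z) * M"
      by (simp add: cscal_diff left_diff_distrib)
    finally have "norm (rb z - ra z) \<le> norm (rb z) * norm (cscal j (of_real (b - a) * z) * M) * norm (ra z)"
      by (auto intro!: order_trans[OF norm_mult_ineq] mult_right_mono norm_mult_ineq)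
    also have "\<dots> \<le> K * (c * cmod (of_real (b - a) * z)) * K"
      using ra(2)[OF z] rb(2)[OF z] close c K by (intro mult_mono) auto
    also have "cmod (of_real (b - a) * z) = b - a"
      using a b z by (simp only: norm_mult norm_of_real) simp
    also have "K * (c * (b - a)) * K \<le> K * (c * (3 * \<epsilon>)) * K"
      using b K c by (intro mult_left_mono mult_right_mono) (auto simp: a_def)
    also have "\<dots> \<le> 1 / 4" using \<epsilon>(4) by (simp add: power2_eq_square mult_ac)
    finally show ?thesis .
  qed
  have "(\<lambda>n. a ^ n) \<longlonglongrightarrow> 0" using a by (intro LIMSEQ_realpow_zero) auto
  moreover have "0 < 1 / (4 * (2 * K + 1))" using K by simp
  ultimately have "\<forall>\<^sub>F n in sequentially. a ^ n < 1 / (4 * (2 * K + 1))" by (rule order_tendstoD)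
  then have "\<forall>\<^sub>F n in sequentially. a ^ n < 1 / (4 * (2 * K + 1)) \<and> n > 0"
    using eventually_gt_at_top[of 0] by eventually_elim auto
  then obtain n where n: "n > 0" "a ^ n < 1 / (4 * (2 * K + 1))"
    by (auto dest!: eventually_happens)
  define \<alpha> where "\<alpha> = a ^ n"
  define p q where "p = (1 / n) *\<^sub>R (\<Sum>k<n. ra (cis (2 * pi * k / n)))"
    and "q = (1 / n) *\<^sub>R (\<Sum>k<n. rb (cis (2 * pi * k / n)))"
  have Mn: "M ^ n = exp ((real n * h) *\<^sub>R l)"
  proof -
    have "M ^ i = exp ((real i * h) *\<^sub>R l)" for i
    proof (induction i)
      case (Suc i)
      have "exp ((real (Suc i) * h) *\<^sub>R l) = exp (h *\<^sub>R l + (real i * h) *\<^sub>R l)" by (simp add: algebra_simps)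
      also have "\<dots> = exp (h *\<^sub>R l) * exp ((real i * h) *\<^sub>R l)" by (rule exp_add_commuting) simp
      finally show ?case using Suc by (simp add: M_def)
    qed simp
    then show ?thesis .
  qed
  have p: "inverses (1 - \<alpha> *\<^sub>R exp ((real n * h) *\<^sub>R l)) p"
    unfolding \<alpha>_def p_def Mn[symmetric]
    by (rule average_over_roots_of_unity[OF n(1) Mj]) (use ra in auto)
  have "inverses (1 - b ^ n *\<^sub>R M ^ n) q"
    unfolding q_def by (rule average_over_roots_of_unity[OF n(1) Mj]) (use rb in auto)
  moreover have "b ^ n = 1 / \<alpha>" by (simp add: b_def \<alpha>_def power_one_over)
  ultimately have q: "inverses (1 - (1 / \<alpha>) *\<^sub>R exp ((real n * h) *\<^sub>R l)) q" by (simp add: Mn)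
  have avg: "norm ((1 / real n) *\<^sub>R (\<Sum>k<n. f k)) \<le> C" if "\<And>k. norm (f k) \<le> C" for f :: "nat \<Rightarrow> 'a" and C
  proof -
    have "norm (\<Sum>k<n. f k) \<le> real n * C"
      using sum_norm_le[of "{..<n}" f "\<lambda>_. C"] that by simp
    then show ?thesis using n by (simp add: field_simps)
  qed
  have "norm p \<le> K" "norm q \<le> K"
    unfolding p_def q_def by (rule avg, use ra rb in simp)+
  moreover have "norm (q - p) \<le> 1 / 4"
    unfolding p_def q_def scaleR_diff_right[symmetric] sum_subtractf[symmetric]
    by (rule avg, use rab in simp)
  moreover have "\<alpha> > 0" using a by (simp add: \<alpha>_def)
  ultimately have "\<alpha> * (norm p + norm q + 1) \<le> \<alpha> * (2 * K + 1)" by (intro mult_left_mono) auto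
  also have "\<dots> \<le> 1 / 4" using n(2) K by (simp add: \<alpha>_def field_simps)
  finally have "norm (q - p) + \<alpha> * (norm p + norm q + 1) \<le> 1 / 2"
    using \<open>norm (q - p) \<le> 1 / 4\<close> by simp
  then show ?thesis using p q \<open>\<alpha> > 0\<close> h n by (intro exI[of _ "real n * h"] conjI exI[of _ \<alpha>]) auto
qed

end

section \<open>The Banach algebra of operators\<close>

text \<open>Bounded operators form a Banach algebra in which the identity has norm \<open>1\<close> unless the space is
  trivial.  The complex summand restores this norm in the trivial case as well; complex numbers are used since
  the algebra has to contain a square root of \<open>-1\<close>.\<close>

typedef (overloaded) 'a op_alg = "UNIV :: (complex \<times> ('a::banach \<Rightarrow>\<^sub>L 'a)) set"
  morphisms op_pair Op_alg by simp

setup_lifting type_definition_op_alg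

instantiation op_alg :: (banach) real_normed_algebra_1
begin

lift_definition zero_op_alg :: "'a op_alg" is "(0, 0)" .
lift_definition one_op_alg :: "'a op_alg" is "(1, id_blinfun)" .
lift_definition plus_op_alg :: "'a op_alg \<Rightarrow> 'a op_alg \<Rightarrow> 'a op_alg"
  is "\<lambda>(a, S) (b, T). (a + b, S + T)" .
lift_definition minus_op_alg :: "'a op_alg \<Rightarrow> 'a op_alg \<Rightarrow> 'a op_alg"
  is "\<lambda>(a, S) (b, T). (a - b, S - T)" .
lift_definition uminus_op_alg :: "'a op_alg \<Rightarrow> 'a op_alg" is "\<lambda>(a, S). (- a, - S)" .
lift_definition times_op_alg :: "'a op_alg \<Rightarrow> 'a op_alg \<Rightarrow> 'a op_alg"
  is "\<lambda>(a, S) (b, T). (a * b, S o\<^sub>L T)" .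
lift_definition scaleR_op_alg :: "real \<Rightarrow> 'a op_alg \<Rightarrow> 'a op_alg"
  is "\<lambda>r (a, S). (r *\<^sub>R a, r *\<^sub>R S)" .
lift_definition norm_op_alg :: "'a op_alg \<Rightarrow> real" is "\<lambda>(a, S). max (cmod a) (norm S)" .
definition sgn_op_alg :: "'a op_alg \<Rightarrow> 'a op_alg" where "sgn_op_alg u = inverse (norm u) *\<^sub>R u"
definition dist_op_alg :: "'a op_alg \<Rightarrow> 'a op_alg \<Rightarrow> real" where "dist_op_alg u v = norm (u - v)"
definition uniformity_op_alg :: "('a op_alg \<times> 'a op_alg) filter"
  where "uniformity_op_alg = (INF e\<in>{0 <..}. principal {(x, y). dist x y < e})"
definition open_op_alg :: "'a op_alg set \<Rightarrow> bool"
  where "open_op_alg S = (\<forall>x\<in>S. \<forall>\<^sub>F (x', y) in uniformity. x' = x \<longrightarrow> y \<in> S)"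

instance
proof
  fix x y z :: "'a op_alg" and r s :: real
  show "x + y + z = x + (y + z)" "x + y = y + x" "0 + x = x" "- x + x = 0" "x - y = x + - y"
    "x * y * z = x * (y * z)" "1 * x = x" "x * 1 = x"
    "r *\<^sub>R (x + y) = r *\<^sub>R x + r *\<^sub>R y" "(r + s) *\<^sub>R x = r *\<^sub>R x + s *\<^sub>R x"
    "r *\<^sub>R s *\<^sub>R x = (r * s) *\<^sub>R x" "1 *\<^sub>R x = x"
    "(x + y) * z = x * z + y * z" "x * (y + z) = x * y + x * z"
    "r *\<^sub>R x * y = r *\<^sub>R (x * y)" "x * r *\<^sub>R y = r *\<^sub>R (x * y)"
    by (transfer, auto simp: algebra_simps blinfun_eqI blinfun.bilinear_simps intro!: blinfun_eqI)+
  show "(0 :: 'a op_alg) \<noteq> 1" by transfer auto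
  show "norm (1 :: 'a op_alg) = 1" by transfer (auto simp: norm_blinfun_id_le max_def intro!: antisym)
  show "norm x = 0 \<longleftrightarrow> x = 0" by transfer (auto simp: max_def split: if_splits)
  show "norm (x + y) \<le> norm x + norm y"
    by transfer (auto intro!: norm_triangle_mono split: prod.splits)
  show "norm (r *\<^sub>R x) = \<bar>r\<bar> * norm x"
    by transfer (auto simp: max_mult_distrib_left split: prod.splits)
  show "norm (x * y) \<le> norm x * norm y"
    by transfer (auto intro!: mult_mono order_trans[OF norm_blinfun_compose] simp: norm_mult le_max_iff_disj)
qed (auto simp: sgn_op_alg_def dist_op_alg_def uniformity_op_alg_def open_op_alg_def)

end

definition op_of :: "'a::banach op_alg \<Rightarrow> ('a \<Rightarrow>\<^sub>L 'a)" where "op_of x = snd (op_pair x)"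

lemma bounded_linear_op_of: "bounded_linear op_of"
proof (rule bounded_linear_intro)
  show "norm (op_of x) \<le> norm x * 1" for x :: "'a op_alg"
    by (auto simp: op_of_def norm_op_alg.rep_eq split: prod.splits)
qed (auto simp: op_of_def plus_op_alg.rep_eq scaleR_op_alg.rep_eq split: prod.splits)

lemma op_of_mult: "op_of (x * y) = op_of x o\<^sub>L op_of y"
  by (auto simp: op_of_def times_op_alg.rep_eq split: prod.splits)

lemma op_of_1: "op_of 1 = id_blinfun"
  by (simp add: op_of_def one_op_alg.rep_eq)

instance op_alg :: (banach) banach
proof
  fix X :: "nat \<Rightarrow> 'a op_alg"
  assume X: "Cauchy X"
  define c where "c n = fst (op_pair (X n))" for n
  define S where "S n = op_of (X n)" for n
  have d: "norm (X m - Op_alg (a, T)) \<le> cmod (c m - a) + norm (S m - T)" for m a T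
    unfolding c_def S_def op_of_def
    by (auto simp: norm_op_alg.rep_eq minus_op_alg.rep_eq Op_alg_inverse split: prod.splits)
  have c: "dist (c m) (c n) \<le> dist (X m) (X n)" and S: "dist (S m) (S n) \<le> dist (X m) (X n)" for m n
    unfolding c_def S_def op_of_def dist_norm
    by (auto simp: norm_op_alg.rep_eq minus_op_alg.rep_eq split: prod.splits)
  have "Cauchy c" "Cauchy S"
    using X c S unfolding Cauchy_def by (meson order.strict_trans1)+
  then obtain a T where "c \<longlonglongrightarrow> a" "S \<longlonglongrightarrow> T"
    by (meson Cauchy_convergent convergent_def)
  then have "(\<lambda>m. cmod (c m - a) + norm (S m - T)) \<longlonglongrightarrow> 0"
    by (intro tendsto_add_zero) (simp_all add: LIM_zero tendsto_norm_zero)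
  then have "(\<lambda>m. X m - Op_alg (a, T)) \<longlonglongrightarrow> 0"
    by (rule Lim_null_comparison[rotated]) (use d in auto)
  then show "convergent X"
    unfolding convergent_def using LIM_zero_iff by blast
qed

section \<open>Solutions in the space of continuous functions vanishing at infinity\<close>

lemma dist_c0_apply: "dist (apply_c0 u t) (apply_c0 v t) \<le> dist u v"
  using norm_apply_c0_le[of "u - v" t] by (simp add: dist_norm apply_c0_minus)

lemma vanishes_at_infty_uniform_limit:
  assumes "\<And>\<epsilon>. \<epsilon> > 0 \<Longrightarrow> \<exists>v. vanishes_at_infty v \<and> (\<forall>t. dist (u t) (v t) < \<epsilon>)"
  shows "vanishes_at_infty u"
proof -
  have "(u \<longlongrightarrow> 0) F" if F: "\<And>v. vanishes_at_infty v \<Longrightarrow> (v \<longlongrightarrow> (0::'a)) F" for F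
  proof (rule tendstoI)
    fix \<epsilon> :: real assume "\<epsilon> > 0"
    then obtain v where v: "vanishes_at_infty v" "\<And>t. dist (u t) (v t) < \<epsilon> / 2"
      using assms[of "\<epsilon> / 2"] by auto
    have "\<forall>\<^sub>F t in F. dist (v t) 0 < \<epsilon> / 2"
      using tendstoD[OF F[OF v(1)], of "\<epsilon> / 2"] \<open>\<epsilon> > 0\<close> by simp
    then show "\<forall>\<^sub>F t in F. dist (u t) 0 < \<epsilon>"
    proof eventually_elim
      case (elim t)
      then show ?case using v(2)[of t] dist_triangle[of "u t" 0 "v t"] by linarith
    qed
  qed
  then show ?thesis by (simp add: vanishes_at_infty_def)
qed

text \<open>Completeness makes the fixed point theorem available in the spaces on which the differential operators
  are inverted.\<close>

instance c0 :: (banach) banach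
proof
  fix X :: "nat \<Rightarrow> 'a c0"
  assume X: "Cauchy X"
  define B where "B n = Bcontfun (apply_c0 (X n))" for n
  have B: "apply_bcontfun (B n) = apply_c0 (X n)" for n
    unfolding B_def using apply_c0[of "X n"] bounded_range_c0[of "X n"]
    by (simp add: Bcontfun_inverse bcontfun_def)
  have "dist (B m) (B n) \<le> dist (X m) (X n)" for m n
    by (rule dist_bound) (simp add: B dist_c0_apply)
  then have "Cauchy B" using X unfolding Cauchy_def by (meson order.strict_trans1)
  then obtain w where w: "B \<longlonglongrightarrow> w" by (meson Cauchy_convergent convergent_def)
  have "vanishes_at_infty (apply_bcontfun w)"
  proof (rule vanishes_at_infty_uniform_limit)
    fix \<epsilon> :: real assume "\<epsilon> > 0"
    then obtain n where "dist (B n) w < \<epsilon>" using w unfolding lim_sequentially by blast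
    then have "dist (apply_bcontfun w t) (apply_c0 (X n) t) < \<epsilon>" for t
      using dist_bounded[of "B n" t w] by (simp add: B dist_commute)
    then show "\<exists>v. vanishes_at_infty v \<and> (\<forall>t. dist (apply_bcontfun w t) (v t) < \<epsilon>)"
      using apply_c0[of "X n"] by auto
  qed
  then have u: "apply_c0 (Abs_c0 (apply_bcontfun w)) = apply_bcontfun w"
    by (intro Abs_c0_inverse) auto
  have "(\<lambda>n. X n - Abs_c0 (apply_bcontfun w)) \<longlonglongrightarrow> 0"
  proof (rule Lim_null_comparison)
    show "\<forall>\<^sub>F n in sequentially. norm (X n - Abs_c0 (apply_bcontfun w)) \<le> dist (B n) w"
    proof (intro always_eventually allI norm_c0_le)
      show "norm (apply_c0 (X n - Abs_c0 (apply_bcontfun w)) t) \<le> dist (B n) w" for n t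
        using dist_bounded[of "B n" t w] by (simp add: apply_c0_minus u B dist_norm)
    qed
    show "(\<lambda>n. dist (B n) w) \<longlonglongrightarrow> 0" using w by (rule tendsto_dist_iff[THEN iffD1])
  qed
  then show "convergent X" unfolding convergent_def using LIM_zero_iff by blast
qed

definition in_c0 :: "(real \<Rightarrow> 'a::real_normed_vector) \<Rightarrow> bool" where
  "in_c0 u \<longleftrightarrow> continuous_on UNIV u \<and> vanishes_at_infty u"

lemma in_c0_apply: "in_c0 (apply_c0 u)"
  using apply_c0[of u] by (simp add: in_c0_def)

lemma apply_Abs_c0: "in_c0 u \<Longrightarrow> apply_c0 (Abs_c0 u) = u"
  by (simp add: Abs_c0_inverse in_c0_def)

lemma in_c0_add: "in_c0 u \<Longrightarrow> in_c0 v \<Longrightarrow> in_c0 (\<lambda>t. u t + v t)"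
  and in_c0_diff: "in_c0 u \<Longrightarrow> in_c0 v \<Longrightarrow> in_c0 (\<lambda>t. u t - v t)"
  unfolding in_c0_def by (auto intro: continuous_intros vanishes_at_infty_add vanishes_at_infty_diff)

lemma in_c0_bounded_linear: "bounded_linear T \<Longrightarrow> in_c0 u \<Longrightarrow> in_c0 (\<lambda>t. T (u t))"
  unfolding in_c0_def
  by (auto intro: vanishes_at_infty_bounded_linear bounded_linear.continuous_on)

lemma in_c0_shift: "in_c0 u \<Longrightarrow> in_c0 (\<lambda>t. u (t + c))"
proof -
  assume u: "in_c0 u"
  have "filterlim (\<lambda>t. t + c) at_top at_top" "filterlim (\<lambda>t. t + c) at_bot at_bot"
    using filterlim_tendsto_add_at_top[OF tendsto_const filterlim_ident, of c]
      filterlim_tendsto_add_at_bot_iff[OF tendsto_const, THEN iffD2, OF filterlim_ident, of c]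
    by (simp_all add: add.commute)
  then have "((\<lambda>t. u (t + c)) \<longlongrightarrow> 0) at_top" "((\<lambda>t. u (t + c)) \<longlongrightarrow> 0) at_bot"
    using u filterlim_compose[of u "nhds 0"] unfolding in_c0_def vanishes_at_infty_def by blast+
  moreover have "continuous_on UNIV (\<lambda>t. u (t + c))"
    using u unfolding in_c0_def by (auto intro!: continuous_on_compose2[of UNIV u] continuous_intros)
  ultimately show ?thesis by (simp add: in_c0_def vanishes_at_infty_def)
qed

definition solves :: "(real \<Rightarrow> 'a::real_normed_vector \<Rightarrow>\<^sub>L 'a) \<Rightarrow> (real \<Rightarrow> 'a) \<Rightarrow> (real \<Rightarrow> 'a) \<Rightarrow> bool" where
  "solves A f u \<longleftrightarrow> (\<forall>t. (u has_vector_derivative A t (u t) + f t) (at t))"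

lemma solves_continuous: "solves A f u \<Longrightarrow> continuous_on S u"
  unfolding solves_def
  by (meson continuous_at_imp_continuous_on has_vector_derivative_continuous)

text \<open>The operator sending \<open>u\<close> to \<open>u' - A u\<close> is a bijection onto the continuous functions vanishing at infinity,
  with inverse of norm at most \<open>C\<close> for the supremum norms.  Injectivity is the case \<open>f = 0\<close> of the
  estimate.\<close>

definition c0_invertible :: "(real \<Rightarrow> 'a::real_normed_vector \<Rightarrow>\<^sub>L 'a) \<Rightarrow> real \<Rightarrow> bool" where
  "c0_invertible A C \<longleftrightarrow> C > 0 \<and>
    (\<forall>f :: 'a c0. \<exists>u :: 'a c0. solves A (apply_c0 f) (apply_c0 u)) \<and>
    (\<forall>(f :: 'a c0) (u :: 'a c0). solves A (apply_c0 f) (apply_c0 u) \<longrightarrow> norm u \<le> C * norm f)"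

section \<open>Constant hyperbolic coefficients\<close>

text \<open>The element \<open>l = (1, L)\<close> of the operator algebra and the square root \<open>j = (\<i>, J)\<close> of \<open>-1\<close> satisfy the
  hypotheses of \<open>approximate_spectral_projections\<close>: in the complex summand \<open>\<omega> * \<i> - 1\<close> is never
  zero.\<close>

lemma hyperbolic_propagator_data:
  fixes L J :: "'a::banach \<Rightarrow>\<^sub>L 'a"
  assumes JJ: "\<And>x. J (J x) = - x" and JL: "\<And>x. J (L x) = L (J x)"
    and res: "\<And>\<omega>::real. \<exists>R. bounded_linear R \<and> (\<forall>x. R (\<omega> *\<^sub>R J x - L x) = x) \<and>
      (\<forall>y. \<omega> *\<^sub>R J (R y) - L (R y) = y)"
  obtains T \<alpha> and E :: "real \<Rightarrow> 'a \<Rightarrow>\<^sub>L 'a" and p q :: "'a \<Rightarrow>\<^sub>L 'a"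
  where "T > 0" "\<alpha> > 0"
    "E 0 = id_blinfun" "\<And>t. (E has_vector_derivative (L o\<^sub>L E t)) (at t)"
    "\<And>t x. E t (L x) = L (E t x)" "\<And>t x. E t (E (- t) x) = x"
    "\<And>x. p (x - \<alpha> *\<^sub>R E T x) = x" "\<And>x. q (x - (1 / \<alpha>) *\<^sub>R E T x) = x"
    "\<And>x. p (L x) = L (p x)" "\<And>x. q (L x) = L (q x)"
    "norm (q - p) + \<alpha> * (norm p + norm q + 1) \<le> 1 / 2"
proof -
  define l j where "l = Op_alg (1, L)" and "j = Op_alg (\<i>, J)"
  have rep: "op_pair l = (1, L)" "op_pair j = (\<i>, J)"
    by (simp_all add: l_def j_def Op_alg_inverse)
  note simps = times_op_alg.rep_eq one_op_alg.rep_eq uminus_op_alg.rep_eq minus_op_alg.rep_eq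
    scaleR_op_alg.rep_eq rep Op_alg_inverse
  have opl: "op_of l = L" by (simp add: op_of_def rep)
  interpret complex_unit j
  proof
    show "j * j = - 1"
      unfolding op_pair_inject[symmetric] by (auto simp: simps JJ blinfun.minus_left intro!: blinfun_eqI)
  qed
  have lj: "l * j = j * l"
    unfolding op_pair_inject[symmetric] by (auto simp: simps JL intro!: blinfun_eqI)
  have resolvent: "\<exists>x. inverses (\<omega> *\<^sub>R j - l) x" for \<omega> :: real
  proof -
    obtain R where R: "bounded_linear R" "\<And>x. R (\<omega> *\<^sub>R J x - L x) = x"
      "\<And>y. \<omega> *\<^sub>R J (R y) - L (R y) = y" using res by blast
    have z: "\<omega> *\<^sub>R \<i> - 1 \<noteq> 0" by (auto simp: complex_eq_iff)
    have "inverses (\<omega> *\<^sub>R j - l) (Op_alg (1 / (\<omega> *\<^sub>R \<i> - 1), Blinfun R))"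
      unfolding inverses_def op_pair_inject[symmetric]
      using z by (auto simp: simps R blinfun.bilinear_simps bounded_linear_Blinfun_apply[OF R(1)] intro!: blinfun_eqI)
    then show ?thesis by blast
  qed
  obtain T \<alpha> p q where T: "T > 0" "\<alpha> > 0" and p: "inverses (1 - \<alpha> *\<^sub>R exp (T *\<^sub>R l)) p"
    and q: "inverses (1 - (1 / \<alpha>) *\<^sub>R exp (T *\<^sub>R l)) q"
    and small: "norm (q - p) + \<alpha> * (norm p + norm q + 1) \<le> 1 / 2"
    using approximate_spectral_projections[OF lj resolvent] by metis
  define E where "E t = op_of (exp (t *\<^sub>R l))" for t
  interpret op: bounded_linear "op_of :: 'a op_alg \<Rightarrow> _" by (rule bounded_linear_op_of)
  have norm_op: "norm (op_of x) \<le> norm x" for x :: "'a op_alg"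
    by (auto simp: op_of_def norm_op_alg.rep_eq split: prod.splits)
  have commute: "x * l = l * x" if "inverses (1 - c *\<^sub>R exp (T *\<^sub>R l)) x" for x c
  proof -
    define y where "y = 1 - c *\<^sub>R exp (T *\<^sub>R l)"
    have yl: "y * l = l * y"
      by (simp add: y_def left_diff_distrib right_diff_distrib exp_times_scaleR_commute)
    have xy: "x * y = 1" "y * x = 1" using that by (simp_all add: inverses_def y_def)
    have "x * l = x * (l * y) * x" by (simp add: mult.assoc xy)
    also have "\<dots> = (x * y) * l * x" by (simp only: yl[symmetric] mult.assoc)
    finally show ?thesis by (simp add: xy)
  qed
  have prod: "op_of x o\<^sub>L op_of y = op_of (x * y)" for x y :: "'a op_alg" by (simp add: op_of_mult)
  have op_mult: "op_of x (op_of y v) = op_of (x * y) v" for x y :: "'a op_alg" and v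
    by (simp add: op_of_mult)
  show ?thesis
  proof (rule that[of T \<alpha> E "op_of p" "op_of q"])
    show "E 0 = id_blinfun" by (simp add: E_def op_of_1)
    show "(E has_vector_derivative (L o\<^sub>L E t)) (at t)" for t
      unfolding E_def opl[symmetric] prod
      by (rule op.has_vector_derivative[OF exp_scaleR_has_vector_derivative_left])
    show "E t (L x) = L (E t x)" for t x
      unfolding E_def opl[symmetric] op_mult by (simp add: exp_times_scaleR_commute)
    have "exp (t *\<^sub>R l) * exp ((- t) *\<^sub>R l) = 1" for t
      by (subst exp_add_commuting[symmetric]) auto
    then show "E t (E (- t) x) = x" for t x
      unfolding E_def op_mult by (simp add: op_of_1)
    have inv: "op_of y (x - c *\<^sub>R E T x) = x" if "inverses (1 - c *\<^sub>R exp (T *\<^sub>R l)) y" for c y x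
    proof -
      have "x - c *\<^sub>R E T x = op_of (1 - c *\<^sub>R exp (T *\<^sub>R l)) x"
        by (simp add: op.diff op.scaleR op_of_1 E_def blinfun.bilinear_simps)
      then show ?thesis using that by (simp add: op_mult inverses_def op_of_1)
    qed
    show "op_of p (x - \<alpha> *\<^sub>R E T x) = x" "op_of q (x - (1 / \<alpha>) *\<^sub>R E T x) = x" for x
      by (rule inv[OF p] inv[OF q])+
    show "op_of p (L x) = L (op_of p x)" "op_of q (L x) = L (op_of q x)" for x
      unfolding opl[symmetric] op_mult commute[OF p] commute[OF q] by simp_all
    have "norm (op_of q - op_of p) + \<alpha> * (norm (op_of p) + norm (op_of q) + 1)
      \<le> norm (q - p) + \<alpha> * (norm p + norm q + 1)"
      using norm_op T(2) by (intro add_mono mult_left_mono) (auto simp flip: op.diff)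
    with small show "norm (op_of q - op_of p) + \<alpha> * (norm (op_of p) + norm (op_of q) + 1) \<le> 1 / 2"
      by simp
  qed (use T in auto)
qed

text \<open>Let \<open>S\<close> be the shift by \<open>T\<close> and \<open>N = exp (T L)\<close>.  If \<open>y' = L y + f\<close> then \<open>S y - N y\<close> depends only on \<open>f\<close>,
  in fact on its values on intervals of length \<open>T\<close>, and solves the equation with right-hand side
  \<open>S f - N f\<close>.  From \<open>p (1 - \<alpha> N) = 1\<close> and \<open>q (1 - N / \<alpha>) = 1\<close> one gets the identity
  \<open>\<alpha> p (S - N) + q (1 - N S') = 1 + e\<close> with \<open>S'\<close> the inverse shift and
  \<open>e = (q - p) + \<alpha> p S - \<alpha> (q - 1) S'\<close>, which has norm at most \<open>1/2\<close>.  Applied to right-hand sides it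
  gives solutions up to the error \<open>e\<close>, and a fixed point argument removes the error; applied to
  a solution it gives the estimate.\<close>

theorem c0_invertible_constant:
  fixes L J :: "'a::banach \<Rightarrow>\<^sub>L 'a"
  assumes JJ: "\<And>x. J (J x) = - x" and JL: "\<And>x. J (L x) = L (J x)"
    and res: "\<And>\<omega>::real. \<exists>R. bounded_linear R \<and> (\<forall>x. R (\<omega> *\<^sub>R J x - L x) = x) \<and>
      (\<forall>y. \<omega> *\<^sub>R J (R y) - L (R y) = y)"
  shows "\<exists>C. c0_invertible (\<lambda>_. L) C"
proof -
  obtain T \<alpha> and E :: "real \<Rightarrow> 'a \<Rightarrow>\<^sub>L 'a" and p q :: "'a \<Rightarrow>\<^sub>L 'a"
    where T: "T > 0" and \<alpha>: "\<alpha> > 0"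
    and E0: "E 0 = id_blinfun" and E': "\<And>t. (E has_vector_derivative (L o\<^sub>L E t)) (at t)"
    and EL: "\<And>t x. E t (L x) = L (E t x)" and EE: "\<And>t x. E t (E (- t) x) = x"
    and p: "\<And>x. p (x - \<alpha> *\<^sub>R E T x) = x" and q: "\<And>x. q (x - (1 / \<alpha>) *\<^sub>R E T x) = x"
    and pL: "\<And>x. p (L x) = L (p x)" and qL: "\<And>x. q (L x) = L (q x)"
    and small: "norm (q - p) + \<alpha> * (norm p + norm q + 1) \<le> 1 / 2"
    by (rule hyperbolic_propagator_data[OF assms]) blast
  define N where "N = E T"
  have cE: "continuous_on UNIV E"
    using E' by (meson continuous_at_imp_continuous_on has_vector_derivative_continuous)
  have E'': "((\<lambda>s. E (- s)) has_vector_derivative - (L o\<^sub>L E (- s))) (at s)" for s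
    by (rule has_vector_derivative_reflect[OF E'])
  have "bounded ((\<lambda>s. E (- s)) ` {0..T})"
    by (intro compact_imp_bounded compact_continuous_image continuous_on_compose2[OF cE])
      (auto intro!: continuous_intros)
  then obtain b where b: "b > 0" "\<And>s. 0 \<le> s \<Longrightarrow> s \<le> T \<Longrightarrow> norm (E (- s)) \<le> b"
    unfolding bounded_pos by auto
  define \<kappa> where "\<kappa> = norm N * (T * b)"
  have \<kappa>0: "\<kappa> \<ge> 0" using T b by (simp add: \<kappa>_def)
  have step: "norm (y (t + T) - N (y t)) \<le> \<kappa> * m"
    if y: "solves (\<lambda>_. L) f y" and m: "\<And>s. t \<le> s \<Longrightarrow> s \<le> t + T \<Longrightarrow> norm (f s) \<le> m" for y f t m
  proof -
    define g where "g s = E (- s) (y (s + t))" for s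
    have y': "((\<lambda>s. y (s + t)) has_vector_derivative L (y (s + t)) + f (s + t)) (at s)" for s
      using y has_vector_derivative_shift[of y _ s t] by (auto simp: solves_def)
    have g': "(g has_vector_derivative E (- s) (f (s + t))) (at s)" for s
      unfolding g_def
      using bounded_bilinear.has_vector_derivative[OF bounded_bilinear_blinfun_apply E'' y', of s]
      by (simp add: blinfun.bilinear_simps EL)
    have "norm (g T - g 0) \<le> (b * m) * T - (b * m) * 0"
    proof (rule differentiable_bound_general[OF T])
      show "continuous_on {0..T} g"
        using g' by (meson continuous_at_imp_continuous_on has_vector_derivative_continuous)
      show "((\<lambda>s. (b * m) * s) has_vector_derivative b * m) (at x)" for x
        by (auto intro!: derivative_eq_intros)
      fix x assume x: "0 < x" "x < T"
      show "(g has_vector_derivative E (- x) (f (x + t))) (at x)" by (rule g')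
      show "norm (E (- x) (f (x + t))) \<le> b * m"
        using x b m[of "x + t"] by (intro order_trans[OF norm_blinfun] mult_mono) auto
    qed (auto intro!: continuous_intros)
    then have gb: "norm (g T - g 0) \<le> T * b * m" by (simp add: mult_ac)
    have "y (t + T) - N (y t) = N (g T - g 0)"
      by (simp add: g_def N_def blinfun.bilinear_simps EE E0 add.commute)
    also have "norm \<dots> \<le> norm N * (T * b * m)"
      using gb by (intro order_trans[OF norm_blinfun] mult_left_mono) auto
    finally show ?thesis by (simp add: \<kappa>_def mult_ac)
  qed
  \<comment> \<open>The increment of a solution over the time \<open>T\<close> is determined by \<open>f\<close>, so it decays with \<open>f\<close> even if the
    solution itself grows.\<close>
  have increment: "in_c0 (\<lambda>t. y (t + T) - N (y t)) \<and>
      solves (\<lambda>_. L) (\<lambda>t. f (t + T) - N (f t)) (\<lambda>t. y (t + T) - N (y t)) \<and>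
      (\<forall>t. norm (y (t + T) - N (y t)) \<le> \<kappa> * norm f0)"
    if f: "f = apply_c0 f0" and y: "solves (\<lambda>_. L) f y" for f y f0
  proof (intro conjI allI)
    let ?g = "\<lambda>t. y (t + T) - N (y t)"
    have y': "(y has_vector_derivative L (y t) + f t) (at t)" for t
      using y by (simp add: solves_def)
    have "(?g has_vector_derivative L (?g t) + (f (t + T) - N (f t))) (at t)" for t
    proof -
      have "(?g has_vector_derivative (L (y (t + T)) + f (t + T)) - N (L (y t) + f t)) (at t)"
        by (intro has_vector_derivative_diff has_vector_derivative_shift y'
            bounded_linear.has_vector_derivative[OF blinfun.bounded_linear_right])
      then show ?thesis by (simp add: blinfun.bilinear_simps N_def EL algebra_simps)
    qed
    then show "solves (\<lambda>_. L) (\<lambda>t. f (t + T) - N (f t)) ?g" by (simp add: solves_def)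
    then have cont: "continuous_on UNIV ?g" by (rule solves_continuous)
    show "norm (?g t) \<le> \<kappa> * norm f0" for t
      by (rule step[OF y]) (simp add: f norm_apply_c0_le)
    have lim: "(?g \<longlongrightarrow> 0) F"
      if ev: "\<And>\<epsilon>. \<epsilon> > 0 \<Longrightarrow> \<forall>\<^sub>F t in F. \<forall>s. t \<le> s \<longrightarrow> s \<le> t + T \<longrightarrow> norm (f s) \<le> \<epsilon>" for F
    proof (rule tendstoI)
      fix \<epsilon> :: real assume \<epsilon>: "\<epsilon> > 0"
      define d where "d = \<epsilon> / (\<kappa> + 1)"
      have d: "d > 0" "\<kappa> * d < \<epsilon>" using \<epsilon> \<kappa>0 by (auto simp: d_def field_simps)
      from ev[OF d(1)] show "\<forall>\<^sub>F t in F. dist (?g t) 0 < \<epsilon>"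
      proof eventually_elim
        case (elim t)
        then have "norm (?g t) \<le> \<kappa> * d" by (intro step[OF y]) auto
        then show ?case using d by simp
      qed
    qed
    have ft: "(f \<longlongrightarrow> 0) at_top" "(f \<longlongrightarrow> 0) at_bot"
      using in_c0_apply[of f0] by (auto simp: f in_c0_def vanishes_at_infty_def)
    have "(?g \<longlongrightarrow> 0) at_top"
    proof (rule lim)
      fix \<epsilon> :: real assume "\<epsilon> > 0"
      then obtain a where a: "\<And>s. s \<ge> a \<Longrightarrow> norm (f s) \<le> \<epsilon>"
        using tendstoD[OF ft(1) \<open>\<epsilon> > 0\<close>] unfolding eventually_at_top_linorder dist_norm diff_zero
        by (meson less_imp_le)
      then show "\<forall>\<^sub>F t in at_top. \<forall>s. t \<le> s \<longrightarrow> s \<le> t + T \<longrightarrow> norm (f s) \<le> \<epsilon>"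
        unfolding eventually_at_top_linorder by (intro exI[of _ a]) auto
    qed
    moreover have "(?g \<longlongrightarrow> 0) at_bot"
    proof (rule lim)
      fix \<epsilon> :: real assume "\<epsilon> > 0"
      then obtain a where a: "\<And>s. s \<le> a \<Longrightarrow> norm (f s) \<le> \<epsilon>"
        using tendstoD[OF ft(2) \<open>\<epsilon> > 0\<close>] unfolding eventually_at_bot_linorder dist_norm diff_zero
        by (meson less_imp_le)
      then show "\<forall>\<^sub>F t in at_bot. \<forall>s. t \<le> s \<longrightarrow> s \<le> t + T \<longrightarrow> norm (f s) \<le> \<epsilon>"
        unfolding eventually_at_bot_linorder by (intro exI[of _ "a - T"]) auto
    qed
    ultimately show "in_c0 ?g" using cont by (simp add: in_c0_def vanishes_at_infty_def)
  qed
  define e where "e f t = (q - p) (f t) + \<alpha> *\<^sub>R p (f (t + T)) - \<alpha> *\<^sub>R (q (f (t - T)) - f (t - T))"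
    for f :: "real \<Rightarrow> 'a" and t
  have identity: "\<alpha> *\<^sub>R p (f (t + T) - N (f t)) + q (f t - N (f (t - T))) = f t + e f t" for f t
  proof -
    have "\<alpha> *\<^sub>R p (N x) = p x - x" for x
      using p[of x] by (simp add: N_def blinfun.bilinear_simps algebra_simps)
    moreover have "q (N x) = \<alpha> *\<^sub>R (q x - x)" for x
    proof -
      have "\<alpha> *\<^sub>R q (x - (1 / \<alpha>) *\<^sub>R N x) = \<alpha> *\<^sub>R x" using q[of x] by (simp add: N_def)
      then show ?thesis using \<alpha> by (simp add: blinfun.bilinear_simps algebra_simps)
    qed
    ultimately show ?thesis
      by (simp add: e_def blinfun.bilinear_simps scaleR_diff_right)
  qed
  have in_e: "in_c0 (e f)" if "in_c0 f" for f
    unfolding e_def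
    using in_c0_shift[OF that, of T] in_c0_shift[OF that, of "- T"] that
    by (intro in_c0_add in_c0_diff in_c0_bounded_linear[OF bounded_linear_scaleR_right]
        in_c0_bounded_linear[OF blinfun.bounded_linear_right]) auto
  have triangle: "norm (a + b - c) \<le> norm a + norm b + norm c" for a b c :: 'a by norm
  have e_small: "norm (e (apply_c0 f) t) \<le> 1 / 2 * norm f" for f t
  proof -
    note n = norm_apply_c0_le[of f]
    have "norm (e (apply_c0 f) t) \<le> norm ((q - p) (apply_c0 f t)) + norm (\<alpha> *\<^sub>R p (apply_c0 f (t + T)))
        + norm (\<alpha> *\<^sub>R (q (apply_c0 f (t - T)) - apply_c0 f (t - T)))"
      unfolding e_def by (rule triangle)
    also have "\<dots> \<le> norm (q - p) * norm f + \<alpha> * (norm p * norm f) + \<alpha> * (norm q * norm f + norm f)"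
    proof (intro add_mono)
      show "norm ((q - p) (apply_c0 f t)) \<le> norm (q - p) * norm f"
        by (intro order_trans[OF norm_blinfun] mult_left_mono n) auto
      have "norm (p (apply_c0 f (t + T))) \<le> norm p * norm f"
        by (intro order_trans[OF norm_blinfun] mult_left_mono n) auto
      then show "norm (\<alpha> *\<^sub>R p (apply_c0 f (t + T))) \<le> \<alpha> * (norm p * norm f)" using \<alpha> by simp
      have "norm (q (apply_c0 f (t - T)) - apply_c0 f (t - T)) \<le> norm q * norm f + norm f"
        by (intro order_trans[OF norm_triangle_ineq4] add_mono order_trans[OF norm_blinfun] mult_left_mono n) auto
      then show "norm (\<alpha> *\<^sub>R (q (apply_c0 f (t - T)) - apply_c0 f (t - T))) \<le> \<alpha> * (norm q * norm f + norm f)"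
        using \<alpha> by simp
    qed
    also have "\<dots> = (norm (q - p) + \<alpha> * (norm p + norm q + 1)) * norm f" by (simp add: algebra_simps)
    also have "\<dots> \<le> 1 / 2 * norm f" using small by (rule mult_right_mono) simp
    finally show ?thesis .
  qed
  define C where "C = 2 * ((\<alpha> * norm p + norm q) * \<kappa>) + 1"
  have C: "C > 0" using \<alpha> \<kappa>0 by (auto simp: C_def intro!: add_nonneg_pos)
  have ex: "\<exists>u. solves (\<lambda>_. L) (apply_c0 g) (apply_c0 u)" for g :: "'a c0"
  proof -
    define \<Phi> where "\<Phi> f = g - Abs_c0 (e (apply_c0 f))" for f
    have "\<exists>!f. \<Phi> f = f"
    proof (rule banach_fix_type[of "1 / 2"]; (intro allI)?)
      fix f1 f2
      have "norm (Abs_c0 (e (apply_c0 f2)) - Abs_c0 (e (apply_c0 f1))) \<le> 1 / 2 * norm (f2 - f1)"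
      proof (rule norm_c0_le)
        fix t
        have "apply_c0 (Abs_c0 (e (apply_c0 f2)) - Abs_c0 (e (apply_c0 f1))) t = e (apply_c0 (f2 - f1)) t"
          by (simp add: apply_c0_minus apply_Abs_c0 in_e in_c0_apply e_def blinfun.bilinear_simps algebra_simps)
        then show "norm (apply_c0 (Abs_c0 (e (apply_c0 f2)) - Abs_c0 (e (apply_c0 f1))) t)
            \<le> 1 / 2 * norm (f2 - f1)"
          using e_small by simp
      qed
      then show "dist (\<Phi> f1) (\<Phi> f2) \<le> 1 / 2 * dist f1 f2"
        by (simp add: \<Phi>_def dist_norm norm_minus_commute)
    qed auto
    then obtain f where "\<Phi> f = f" by blast
    then have "apply_c0 (\<Phi> f) t = apply_c0 f t" for t by simp
    then have fg: "apply_c0 f t + e (apply_c0 f) t = apply_c0 g t" for t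
      by (auto simp: \<Phi>_def apply_c0_minus apply_Abs_c0 in_e in_c0_apply algebra_simps)
    have cEf: "continuous_on UNIV (\<lambda>t. E (- t) (apply_c0 f t))"
      using in_c0_apply[of f] unfolding in_c0_def
      by (intro blinfun.continuous_on continuous_on_compose2[OF cE] continuous_intros) auto
    obtain w where w: "\<And>t. (w has_vector_derivative E (- t) (apply_c0 f t)) (at t)"
      using antiderivative_on_real_line[OF cEf, of 0] by metis
    have y: "solves (\<lambda>_. L) (apply_c0 f) (\<lambda>t. E t (w t))"
      unfolding solves_def
    proof
      fix t
      show "((\<lambda>t. E t (w t)) has_vector_derivative L (E t (w t)) + apply_c0 f t) (at t)"
        using bounded_bilinear.has_vector_derivative[OF bounded_bilinear_blinfun_apply E' w, of t]
        by (simp add: EE add.commute)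
    qed
    define If where "If t = E (t + T) (w (t + T)) - N (E t (w t))" for t
    have If: "in_c0 If" "solves (\<lambda>_. L) (\<lambda>t. apply_c0 f (t + T) - N (apply_c0 f t)) If"
      using increment[OF refl y] by (auto simp: If_def[abs_def])
    define v where "v t = \<alpha> *\<^sub>R p (If t) + q (If (t - T))" for t
    have v0: "in_c0 v"
      unfolding v_def
      using If(1) in_c0_shift[OF If(1), of "- T"]
      by (intro in_c0_add in_c0_bounded_linear[OF bounded_linear_scaleR_right]
          in_c0_bounded_linear[OF blinfun.bounded_linear_right]) auto
    have "(v has_vector_derivative L (v t) + apply_c0 g t) (at t)" for t
    proof -
      have If': "(If has_vector_derivative L (If t) + (apply_c0 f (t + T) - N (apply_c0 f t))) (at t)" for t
        using If(2) by (simp add: solves_def)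
      have "(v has_vector_derivative \<alpha> *\<^sub>R p (L (If t) + (apply_c0 f (t + T) - N (apply_c0 f t)))
          + q (L (If (t - T)) + (apply_c0 f (t - T + T) - N (apply_c0 f (t - T))))) (at t)"
        unfolding v_def
        by (intro has_vector_derivative_add bounded_linear.has_vector_derivative[OF bounded_linear_scaleR_right]
            bounded_linear.has_vector_derivative[OF blinfun.bounded_linear_right] If'
            has_vector_derivative_shift[of If _ t "- T", simplified])
      moreover have "\<alpha> *\<^sub>R p (L (If t) + (apply_c0 f (t + T) - N (apply_c0 f t)))
          + q (L (If (t - T)) + (apply_c0 f (t - T + T) - N (apply_c0 f (t - T))))
          = L (v t) + (\<alpha> *\<^sub>R p (apply_c0 f (t + T) - N (apply_c0 f t)) + q (apply_c0 f t - N (apply_c0 f (t - T))))"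
        by (simp add: v_def blinfun.bilinear_simps pL qL algebra_simps)
      ultimately show ?thesis by (simp only: identity fg)
    qed
    then show ?thesis
      by (intro exI[of _ "Abs_c0 v"]) (simp add: apply_Abs_c0 v0 solves_def)
  qed
  have bound: "norm u \<le> C * norm g" if u: "solves (\<lambda>_. L) (apply_c0 g) (apply_c0 u)" for g u
  proof -
    let ?u = "apply_c0 u"
    have I: "norm (?u (t + T) - N (?u t)) \<le> \<kappa> * norm g" for t
      using increment[OF refl u] by blast
    have "norm (?u t) \<le> (\<alpha> * norm p + norm q) * (\<kappa> * norm g) + 1 / 2 * norm u" for t
    proof -
      have "?u t = \<alpha> *\<^sub>R p (?u (t + T) - N (?u t)) + q (?u t - N (?u (t - T))) - e ?u t"
        by (simp add: identity)
      also have "norm \<dots> \<le> norm (\<alpha> *\<^sub>R p (?u (t + T) - N (?u t))) + norm (q (?u t - N (?u (t - T))))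
          + norm (e ?u t)" by (rule triangle)
      also have "\<dots> \<le> \<alpha> * (norm p * (\<kappa> * norm g)) + norm q * (\<kappa> * norm g) + 1 / 2 * norm u"
      proof (intro add_mono e_small)
        have "norm (p (?u (t + T) - N (?u t))) \<le> norm p * (\<kappa> * norm g)"
          by (intro order_trans[OF norm_blinfun] mult_left_mono I) auto
        then show "norm (\<alpha> *\<^sub>R p (?u (t + T) - N (?u t))) \<le> \<alpha> * (norm p * (\<kappa> * norm g))"
          using \<alpha> by simp
        show "norm (q (?u t - N (?u (t - T)))) \<le> norm q * (\<kappa> * norm g)"
          using I[of "t - T"] by (intro order_trans[OF norm_blinfun] mult_left_mono) auto
      qed
      finally show ?thesis by (simp add: algebra_simps)
    qed
    then have "norm u \<le> (\<alpha> * norm p + norm q) * (\<kappa> * norm g) + 1 / 2 * norm u"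
      by (rule norm_c0_le)
    then have "norm u \<le> 2 * ((\<alpha> * norm p + norm q) * (\<kappa> * norm g))" by linarith
    then have "norm u \<le> 2 * ((\<alpha> * norm p + norm q) * \<kappa>) * norm g" by (simp only: mult.assoc)
    also have "\<dots> \<le> C * norm g" by (simp add: C_def distrib_right)
    finally show ?thesis .
  qed
  show ?thesis unfolding c0_invertible_def using C ex bound by blast
qed

section \<open>Hyperbolic operators\<close>

lemma c0_invertible_hyperbolic_complex:
  fixes L :: "'a::complex_banach \<Rightarrow>\<^sub>L 'a"
  assumes "hyperbolic_complex L"
  shows "\<exists>C. c0_invertible (\<lambda>_. L) C"
proof (rule c0_invertible_constant)
  define J :: "'a \<Rightarrow>\<^sub>L 'a" where "J = Blinfun (scaleC \<i>)"
  have J: "J x = \<i> *\<^sub>C x" for x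
    by (simp add: J_def bounded_linear_Blinfun_apply bounded_linear_scaleC)
  interpret L: Vector_Spaces.linear scaleC scaleC "blinfun_apply L"
    using assms by (simp add: hyperbolic_complex_def clinear_op_def)
  show "J (J x) = - x" for x
    using scaleC_of_real[of "-1" x] by (simp add: J scaleC_scaleC)
  show "J (L x) = L (J x)" for x by (simp add: J L.scale)
  have J\<omega>: "\<omega> *\<^sub>R J x = (of_real \<omega> * \<i>) *\<^sub>C x" for \<omega> x
    by (simp only: J scaleC_of_real[symmetric] scaleC_scaleC)
  show "\<exists>R. bounded_linear R \<and> (\<forall>x. R (\<omega> *\<^sub>R J x - L x) = x) \<and>
      (\<forall>y. \<omega> *\<^sub>R J (R y) - L (R y) = y)" for \<omega> :: real
  proof -
    have "of_real \<omega> * \<i> \<notin> op_spectrum scaleC (blinfun_apply L)"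
      using assms by (auto simp: hyperbolic_complex_def)
    then show ?thesis unfolding J\<omega> op_spectrum_def by auto
  qed
qed

text \<open>The complexification is \<open>'a \<times> 'a\<close> with \<open>J (x, y) = (- y, x)\<close>.  Its invertibility is inherited by the
  space of functions with values in the first summand, on which \<open>L \<times> L\<close> acts as \<open>L\<close>.\<close>

lemma c0_invertible_hyperbolic_real:
  fixes L :: "'a::banach \<Rightarrow>\<^sub>L 'a"
  assumes "hyperbolic_real L"
  shows "\<exists>C. c0_invertible (\<lambda>_. L) C"
proof -
  define L2 :: "('a \<times> 'a) \<Rightarrow>\<^sub>L ('a \<times> 'a)" where "L2 = Blinfun (map_prod L L)"
  define J :: "('a \<times> 'a) \<Rightarrow>\<^sub>L ('a \<times> 'a)" where "J = Blinfun (\<lambda>x. (- snd x, fst x))"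
  have "bounded_linear (map_prod (blinfun_apply L) (blinfun_apply L))"
    unfolding map_prod_def split_beta
    by (intro bounded_linear_Pair bounded_linear_compose[OF blinfun.bounded_linear_right]
        bounded_linear_fst bounded_linear_snd)
  then have L2: "L2 (x, y) = (L x, L y)" for x y
    by (simp add: L2_def bounded_linear_Blinfun_apply)
  have "bounded_linear (\<lambda>x :: 'a \<times> 'a. (- snd x, fst x))"
    by (intro bounded_linear_Pair bounded_linear_minus bounded_linear_fst bounded_linear_snd)
  then have J: "J (x, y) = (- y, x)" for x y
    by (simp add: J_def bounded_linear_Blinfun_apply)
  have "\<exists>C. c0_invertible (\<lambda>_. L2) C"
  proof (rule c0_invertible_constant[of J])
    show "J (J x) = - x" "J (L2 x) = L2 (J x)" for x
      by (cases x; simp add: J L2 blinfun.bilinear_simps)+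
    show "\<exists>R. bounded_linear R \<and> (\<forall>x. R (\<omega> *\<^sub>R J x - L2 x) = x) \<and>
        (\<forall>y. \<omega> *\<^sub>R J (R y) - L2 (R y) = y)" for \<omega> :: real
    proof -
      have "of_real \<omega> * \<i> \<notin> op_spectrum complexify_scale (map_prod (blinfun_apply L) (blinfun_apply L))"
        using assms by (auto simp: hyperbolic_real_def)
      moreover have "complexify_scale (of_real \<omega> * \<i>) x = \<omega> *\<^sub>R J x" for x :: "'a \<times> 'a"
        by (cases x) (simp add: complexify_scale_def J)
      moreover have "map_prod (blinfun_apply L) (blinfun_apply L) x = L2 x" for x
        by (cases x) (simp add: L2)
      ultimately show ?thesis unfolding op_spectrum_def by auto
    qed
  qed
  then obtain C where C: "c0_invertible (\<lambda>_. L2) C" by blast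
  have pair: "in_c0 (\<lambda>t. (u t, 0 :: 'a))" if "in_c0 u" for u :: "real \<Rightarrow> 'a"
    by (rule in_c0_bounded_linear[OF _ that])
      (intro bounded_linear_Pair bounded_linear_ident bounded_linear_zero)
  define lift where "lift u = Abs_c0 (\<lambda>t. (apply_c0 u t, 0 :: 'a))" for u :: "'a c0"
  have lift: "apply_c0 (lift u) t = (apply_c0 u t, 0)" for u t
    by (simp add: lift_def apply_Abs_c0 pair in_c0_apply)
  have norm_lift: "norm (lift u) = norm u" for u
  proof (rule antisym; rule norm_c0_le)
    show "norm (apply_c0 (lift u) t) \<le> norm u" for t
      using norm_apply_c0_le[of u t] by (simp add: lift norm_Pair)
    show "norm (apply_c0 u t) \<le> norm (lift u)" for t
      using norm_apply_c0_le[of "lift u" t] by (simp add: lift norm_Pair)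
  qed
  have "c0_invertible (\<lambda>_. L) C"
    unfolding c0_invertible_def
  proof (intro conjI allI impI)
    show "C > 0" using C by (simp add: c0_invertible_def)
    fix f :: "'a c0"
    obtain u where u: "solves (\<lambda>_. L2) (apply_c0 (lift f)) (apply_c0 u)"
      using C unfolding c0_invertible_def by blast
    have "in_c0 (\<lambda>t. fst (apply_c0 u t))"
      by (rule in_c0_bounded_linear[OF bounded_linear_fst in_c0_apply])
    moreover have "solves (\<lambda>_. L) (apply_c0 f) (\<lambda>t. fst (apply_c0 u t))"
      unfolding solves_def
    proof
      fix t
      have "(apply_c0 u has_vector_derivative L2 (apply_c0 u t) + apply_c0 (lift f) t) (at t)"
        using u by (simp add: solves_def)
      from bounded_linear.has_vector_derivative[OF bounded_linear_fst this]
      show "((\<lambda>t. fst (apply_c0 u t)) has_vector_derivative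
          L (fst (apply_c0 u t)) + apply_c0 f t) (at t)"
        by (cases "apply_c0 u t") (simp add: L2 lift)
    qed
    ultimately show "\<exists>u. solves (\<lambda>_. L) (apply_c0 f) (apply_c0 u)"
      by (metis apply_Abs_c0)
  next
    fix f u :: "'a c0"
    assume u: "solves (\<lambda>_. L) (apply_c0 f) (apply_c0 u)"
    have "solves (\<lambda>_. L2) (apply_c0 (lift f)) (apply_c0 (lift u))"
      unfolding solves_def
    proof
      fix t
      have "(apply_c0 u has_vector_derivative L (apply_c0 u t) + apply_c0 f t) (at t)"
        using u by (simp add: solves_def)
      from has_vector_derivative_Pair[OF this has_vector_derivative_const]
      show "(apply_c0 (lift u) has_vector_derivative L2 (apply_c0 (lift u) t) + apply_c0 (lift f) t) (at t)"
        by (simp add: lift[abs_def] L2 blinfun.bilinear_simps)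
    qed
    then have "norm (lift u) \<le> C * norm (lift f)"
      using C unfolding c0_invertible_def by blast
    then show "norm u \<le> C * norm f" by (simp add: norm_lift)
  qed
  then show ?thesis by blast
qed

section \<open>Perturbation and reflection\<close>

lemma solves_diff: "solves A f u \<Longrightarrow> solves A g v \<Longrightarrow> solves A (\<lambda>t. f t - g t) (\<lambda>t. u t - v t)"
  unfolding solves_def
  by (auto intro!: derivative_eq_intros simp: blinfun.bilinear_simps)

lemma solves_add: "solves A f u \<Longrightarrow> solves A g v \<Longrightarrow> solves A (\<lambda>t. f t + g t) (\<lambda>t. u t + v t)"
  unfolding solves_def
  by (auto intro!: derivative_eq_intros simp: blinfun.bilinear_simps)

lemma solves_reflect:
  assumes "solves A f u"
  shows "solves (\<lambda>t. - A (- t)) (\<lambda>t. - f (- t)) (\<lambda>t. u (- t))"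
  unfolding solves_def
proof
  fix t
  show "((\<lambda>t. u (- t)) has_vector_derivative (- A (- t)) (u (- t)) + - f (- t)) (at t)"
    using has_vector_derivative_reflect[of u "A (- t) (u (- t)) + f (- t)" t] assms
    by (simp add: solves_def blinfun.minus_left)
qed

lemma filterlim_reflect:
  "((\<lambda>t::real. u (- t)) \<longlongrightarrow> l) at_top \<longleftrightarrow> (u \<longlongrightarrow> l) at_bot"
  "((\<lambda>t::real. u (- t)) \<longlongrightarrow> l) at_bot \<longleftrightarrow> (u \<longlongrightarrow> l) at_top"
  by (rule filterlim_at_bot_mirror[symmetric] filterlim_at_top_mirror[symmetric])+

lemma in_c0_reflect: "in_c0 u \<Longrightarrow> in_c0 (\<lambda>t. u (- t))"
  unfolding in_c0_def vanishes_at_infty_def filterlim_reflect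
  by (auto intro!: continuous_on_compose2[of UNIV u] continuous_intros)

lemma c0_invertible_reflect:
  fixes A :: "real \<Rightarrow> 'a::banach \<Rightarrow>\<^sub>L 'a"
  assumes C: "c0_invertible A C"
  shows "c0_invertible (\<lambda>t. - A (- t)) C"
proof -
  define r where "r u = Abs_c0 (\<lambda>t. apply_c0 u (- t))" for u :: "'a c0"
  have r: "apply_c0 (r u) = (\<lambda>t. apply_c0 u (- t))" for u
    by (simp add: r_def apply_Abs_c0 in_c0_reflect in_c0_apply)
  have norm_r: "norm (r u) \<le> norm u" for u
    by (rule norm_c0_le) (simp add: r norm_apply_c0_le)
  have rr: "r (r u) = u" for u by (rule c0_eqI) (simp add: r)
  have sol: "solves A (apply_c0 (- r f)) (apply_c0 (r u))"
    if "solves (\<lambda>t. - A (- t)) (apply_c0 f) (apply_c0 u)" for f u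
    using solves_reflect[OF that] by (simp add: r uminus_c0.rep_eq fun_eq_iff[symmetric])
  have sol': "solves (\<lambda>t. - A (- t)) (apply_c0 f) (apply_c0 (r u))"
    if "solves A (apply_c0 (- r f)) (apply_c0 u)" for f u
    using solves_reflect[OF that] by (simp add: r uminus_c0.rep_eq)
  show ?thesis
    unfolding c0_invertible_def
  proof (intro conjI allI impI)
    show "C > 0" using C by (simp add: c0_invertible_def)
    show "\<exists>u. solves (\<lambda>t. - A (- t)) (apply_c0 f) (apply_c0 u)" for f
      using C sol' unfolding c0_invertible_def by blast
    fix f u assume "solves (\<lambda>t. - A (- t)) (apply_c0 f) (apply_c0 u)"
    from sol[OF this] have "norm (r u) \<le> C * norm (- r f)"
      using C unfolding c0_invertible_def by blast
    also have "\<dots> \<le> C * norm f" using norm_r C by (simp add: c0_invertible_def)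
    finally show "norm u \<le> C * norm f" using norm_r[of "r u"] by (simp add: rr)
  qed
qed

text \<open>A solution for \<open>B\<close> is a fixed point of the map that sends \<open>u\<close> to the solution for \<open>A\<close> with right-hand side
  \<open>f + (B - A) u\<close>; this map contracts by the factor \<open>C * (1 / (2 * C))\<close>.\<close>

theorem c0_invertible_perturbation:
  fixes A B :: "real \<Rightarrow> 'a::banach \<Rightarrow>\<^sub>L 'a"
  assumes C: "c0_invertible A C" and cA: "continuous_on UNIV A" and cB: "continuous_on UNIV B"
    and small: "\<And>t. norm (B t - A t) \<le> 1 / (2 * C)"
  shows "c0_invertible B (2 * C)"
proof -
  have C0: "C > 0" using C by (simp add: c0_invertible_def)
  define Q where "Q u = Abs_c0 (\<lambda>t. (B t - A t) (apply_c0 u t))" for u :: "'a c0"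
  have pt: "norm ((B t - A t) x) \<le> 1 / (2 * C) * norm x" for t x
    using small[of t] by (intro order_trans[OF norm_blinfun] mult_right_mono) auto
  have "in_c0 (\<lambda>t. (B t - A t) (apply_c0 u t))" for u
  proof -
    have lim: "((\<lambda>t. (B t - A t) (apply_c0 u t)) \<longlongrightarrow> 0) F" if "(apply_c0 u \<longlongrightarrow> 0) F" for F
    proof (rule Lim_null_comparison)
      show "\<forall>\<^sub>F t in F. norm ((B t - A t) (apply_c0 u t)) \<le> 1 / (2 * C) * norm (apply_c0 u t)"
        using pt by simp
      show "((\<lambda>t. 1 / (2 * C) * norm (apply_c0 u t)) \<longlongrightarrow> 0) F"
        using that by (intro tendsto_mult_right_zero tendsto_norm_zero)
    qed
    then show ?thesis
      using in_c0_apply[of u] unfolding in_c0_def vanishes_at_infty_def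
      by (auto intro!: blinfun.continuous_on continuous_on_diff cA cB)
  qed
  then have Q: "apply_c0 (Q u) t = B t (apply_c0 u t) - A t (apply_c0 u t)" for u t
    by (simp add: Q_def apply_Abs_c0 blinfun.diff_left)
  have Q_add: "Q u - Q v = Q (u - v)" for u v
    by (rule c0_eqI) (simp add: Q apply_c0_minus blinfun.diff_right)
  have Q_small: "norm (Q u) \<le> 1 / (2 * C) * norm u" for u
  proof (rule norm_c0_le)
    fix t
    have "norm (apply_c0 (Q u) t) \<le> 1 / (2 * C) * norm (apply_c0 u t)"
      using pt[of t "apply_c0 u t"] by (simp add: Q blinfun.diff_left)
    also have "\<dots> \<le> 1 / (2 * C) * norm u"
      using C0 norm_apply_c0_le[of u t] by (intro mult_left_mono) auto
    finally show "norm (apply_c0 (Q u) t) \<le> 1 / (2 * C) * norm u" .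
  qed
  have swap: "solves B (apply_c0 f) (apply_c0 u) \<longleftrightarrow> solves A (apply_c0 (f + Q u)) (apply_c0 u)" for f u
    by (simp add: solves_def plus_c0.rep_eq Q algebra_simps)
  have bound: "norm u \<le> C * norm f" if "solves A (apply_c0 f) (apply_c0 u)" for f u
    using C that unfolding c0_invertible_def by blast
  have CQ: "C * norm (Q u) \<le> 1 / 2 * norm u" for u
    using mult_left_mono[OF Q_small[of u], of C] C0 by simp
  show ?thesis
    unfolding c0_invertible_def
  proof (intro conjI allI impI)
    show "2 * C > 0" using C0 by simp
    fix f :: "'a c0"
    have "\<forall>u. \<exists>v. solves A (apply_c0 (f + Q u)) (apply_c0 v)"
      using C unfolding c0_invertible_def by blast
    then obtain \<Phi> where \<Phi>: "\<And>u. solves A (apply_c0 (f + Q u)) (apply_c0 (\<Phi> u))"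
      by metis
    have "\<exists>!u. \<Phi> u = u"
    proof (rule banach_fix_type[of "1 / 2"]; (intro allI)?)
      fix u v
      have "solves A (apply_c0 (Q (u - v))) (apply_c0 (\<Phi> u - \<Phi> v))"
        using solves_diff[OF \<Phi>[of u] \<Phi>[of v]]
        by (simp add: solves_def apply_c0_minus[abs_def] plus_c0.rep_eq Q blinfun.diff_right algebra_simps
            flip: Q_add)
      from bound[OF this] CQ[of "u - v"] show "dist (\<Phi> u) (\<Phi> v) \<le> 1 / 2 * dist u v"
        by (simp add: dist_norm)
    qed auto
    then show "\<exists>u. solves B (apply_c0 f) (apply_c0 u)"
      using \<Phi> by (metis swap)
  next
    fix f u :: "'a c0"
    assume "solves B (apply_c0 f) (apply_c0 u)"
    then have "norm u \<le> C * norm (f + Q u)" by (intro bound) (simp add: swap)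
    also have "\<dots> \<le> C * norm f + C * norm (Q u)"
      using C0 by (simp add: norm_triangle_ineq flip: distrib_left)
    finally show "norm u \<le> 2 * C * norm f" using CQ[of u] by linarith
  qed
qed

section \<open>The propagator\<close>

lemma growth_zero_forward:
  fixes z :: "real \<Rightarrow> 'a::real_normed_vector"
  assumes z: "\<And>t. a \<le> t \<Longrightarrow> (z has_vector_derivative z' t) (at t)"
    and bnd: "\<And>t. a \<le> t \<Longrightarrow> norm (z' t) \<le> K * norm (z t)" and K: "K > 0"
    and z0: "z a = 0" and t: "a \<le> t"
  shows "z t = 0"
  using gronwall[of a t z z' K 0 t] assms by simp

lemma growth_zero:
  fixes z :: "real \<Rightarrow> 'a::real_normed_vector"
  assumes z: "\<And>t. (z has_vector_derivative z' t) (at t)"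
    and bnd: "\<And>t. norm (z' t) \<le> K * norm (z t)" and K: "K > 0" and z0: "z a = 0"
  shows "z t = 0"
proof (cases "a \<le> t")
  case True
  then show ?thesis using growth_zero_forward[of a z z' K t] assms by simp
next
  case False
  have "(\<lambda>t. z (- t)) (- t) = 0"
    by (rule growth_zero_forward[of "- a" "\<lambda>t. z (- t)" "\<lambda>t. - z' (- t)" K])
      (use False bnd K z0 has_vector_derivative_reflect[OF z] in auto)
  then show ?thesis by simp
qed

locale bounded_path =
  fixes A :: "real \<Rightarrow> 'a::banach \<Rightarrow>\<^sub>L 'a" and K :: real
  assumes cont: "continuous_on UNIV A" and K: "K > 0" and bound: "\<And>t. norm (A t) \<le> K"
begin

lemma bound_apply: "norm (A t x) \<le> K * norm x"
  using bound[of t] by (intro order_trans[OF norm_blinfun] mult_right_mono) auto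

lemma solves_unique:
  assumes "solves A f u" "solves A f v" "u t0 = v t0"
  shows "u = v"
proof
  fix t
  have "solves A (\<lambda>_. 0) (\<lambda>t. u t - v t)" using solves_diff[OF assms(1,2)] by simp
  then have d: "((\<lambda>t. u t - v t) has_vector_derivative A t (u t - v t)) (at t)" for t
    by (simp add: solves_def)
  have "u t - v t = 0"
    by (rule growth_zero[OF d bound_apply K, of t0]) (simp add: assms(3))
  then show "u t = v t" by simp
qed

lemma solves_exists:
  assumes f: "in_c0 f"
  obtains u where "u t0 = x0" "solves A f u"
proof -
  have bf: "norm (f t) \<le> norm (Abs_c0 f)" for t
    using norm_apply_c0_le[of "Abs_c0 f" t] f by (simp add: apply_Abs_c0)
  obtain u where "u t0 = x0" "\<And>t. (u has_vector_derivative A t (u t) + f t) (at t)"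
  proof (rule global_picard_lindeloef[of "\<lambda>t x. A t x + f t" K "norm (Abs_c0 f)" t0 x0])
    show "norm (A t x + f t - (A t y + f t)) \<le> K * norm (x - y)" for t x y
      using bound_apply[of t "x - y"] by (simp add: blinfun.diff_right)
    show "continuous_on UNIV (\<lambda>t. A t (u t) + f t)" if "continuous_on UNIV u" for u
      using f by (intro continuous_on_add blinfun.continuous_on cont that) (simp add: in_c0_def)
  qed (use bf K in auto)
  then show ?thesis using that by (simp add: solves_def)
qed

lemma operator_solution_unique:
  assumes X: "X 0 = Y 0" "\<And>t. (X has_vector_derivative (A t o\<^sub>L X t)) (at t)"
    and Y: "\<And>t. (Y has_vector_derivative (A t o\<^sub>L Y t)) (at t)"
  shows "X = Y"
proof
  fix t
  have d: "((\<lambda>t. X t - Y t) has_vector_derivative (A t o\<^sub>L (X t - Y t))) (at t)" for t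
  proof -
    have "(A t o\<^sub>L X t) - (A t o\<^sub>L Y t) = A t o\<^sub>L (X t - Y t)"
      by (rule blinfun_eqI) (simp add: blinfun.bilinear_simps)
    then show ?thesis using has_vector_derivative_diff[OF X(2) Y, of t] by simp
  qed
  have "X t - Y t = 0"
  proof (rule growth_zero[OF d _ K, of 0])
    show "norm (A t o\<^sub>L (X t - Y t)) \<le> K * norm (X t - Y t)" for t
      using bound[of t] by (intro order_trans[OF norm_blinfun_compose] mult_right_mono) auto
  qed (simp add: X(1))
  then show "X t = Y t" by simp
qed

lemma propagator: "propagator A 0 = id_blinfun"
    "(propagator A has_vector_derivative (A t o\<^sub>L propagator A t)) (at t)"
proof -
  obtain X where X: "X 0 = id_blinfun" "\<And>t. (X has_vector_derivative (A t o\<^sub>L X t)) (at t)"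
  proof (rule global_picard_lindeloef[of "\<lambda>t x. A t o\<^sub>L x" K 0 0 "id_blinfun :: 'a \<Rightarrow>\<^sub>L 'a"])
    show "norm ((A t o\<^sub>L x) - (A t o\<^sub>L y)) \<le> K * norm (x - y)" for t and x y :: "'a \<Rightarrow>\<^sub>L 'a"
    proof -
      have "(A t o\<^sub>L x) - (A t o\<^sub>L y) = A t o\<^sub>L (x - y)"
        by (rule blinfun_eqI) (simp add: blinfun.bilinear_simps)
      moreover have "norm (A t o\<^sub>L (x - y)) \<le> K * norm (x - y)"
        using bound[of t] by (intro order_trans[OF norm_blinfun_compose] mult_right_mono) auto
      ultimately show ?thesis by simp
    qed
    show "continuous_on UNIV (\<lambda>t. A t o\<^sub>L u t)" if "continuous_on UNIV u" for u :: "real \<Rightarrow> 'a \<Rightarrow>\<^sub>L 'a"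
      by (rule bounded_bilinear.continuous_on[OF bounded_bilinear_blinfun_compose cont that])
  qed (simp_all add: K)
  have "Y = X" if "Y 0 = id_blinfun \<and> (\<forall>t. (Y has_vector_derivative (A t o\<^sub>L Y t)) (at t))" for Y
    by (rule operator_solution_unique) (use that X in auto)
  then have "propagator A = X"
    unfolding propagator_def using X by (intro the_equality) auto
  then show "propagator A 0 = id_blinfun"
    "(propagator A has_vector_derivative (A t o\<^sub>L propagator A t)) (at t)" using X by auto
qed

lemma solves_propagator: "solves A (\<lambda>_. 0) (\<lambda>t. propagator A t x)"
  unfolding solves_def
proof
  fix t
  show "((\<lambda>t. propagator A t x) has_vector_derivative A t (propagator A t x) + 0) (at t)"
    using bounded_linear.has_vector_derivative[OF blinfun.bounded_linear_left propagator(2), of x t]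
    by simp
qed

lemma solves_homogeneous:
  assumes "solves A (\<lambda>_. 0) z"
  shows "z t = propagator A t (z 0)"
proof -
  have "z = (\<lambda>t. propagator A t (z 0))"
    by (rule solves_unique[OF assms solves_propagator, of 0]) (simp add: propagator(1))
  then show ?thesis by (rule fun_cong)
qed

lemma continuous_propagator: "continuous_on S (propagator A)"
  using propagator(2) by (meson continuous_at_imp_continuous_on has_vector_derivative_continuous)

lemma reflected: "bounded_path (\<lambda>t. - A (- t)) K"
  by unfold_locales
    (use K bound in \<open>auto intro!: continuous_intros continuous_on_compose2[OF cont]\<close>)

lemma propagator_reflected: "propagator (\<lambda>t. - A (- t)) t = propagator A (- t)"
proof -
  have "propagator (\<lambda>t. - A (- t)) = (\<lambda>t. propagator A (- t))"
  proof (rule bounded_path.operator_solution_unique[OF reflected])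
    show "(propagator (\<lambda>t. - A (- t)) has_vector_derivative
        (- A (- t) o\<^sub>L propagator (\<lambda>t. - A (- t)) t)) (at t)" for t
      by (rule bounded_path.propagator(2)[OF reflected])
    show "((\<lambda>t. propagator A (- t)) has_vector_derivative (- A (- t) o\<^sub>L propagator A (- t))) (at t)" for t
    proof -
      have "- A (- t) o\<^sub>L propagator A (- t) = - (A (- t) o\<^sub>L propagator A (- t))"
        by (rule blinfun_eqI) (simp add: blinfun.bilinear_simps blinfun.minus_left)
      then show ?thesis using has_vector_derivative_reflect[OF propagator(2)] by simp
    qed
  qed (simp add: propagator(1) bounded_path.propagator(1)[OF reflected])
  then show ?thesis by simp
qed

lemma unstable_space_reflected: "unstable_space A = stable_space (\<lambda>t. - A (- t))"
  using filterlim_reflect(1)[of "\<lambda>t. propagator A t x" for x]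
  by (simp add: unstable_space_def stable_space_def propagator_reflected)

end

section \<open>Dichotomy on a half-line\<close>

text \<open>A cut-off function with derivative \<open>\<phi> t = max 0 (6 * t * (1 - t))\<close>, which has integral \<open>1\<close>.\<close>

lemma smooth_step:
  obtains \<Phi> \<phi> :: "real \<Rightarrow> real" where "\<And>t. (\<Phi> has_vector_derivative \<phi> t) (at t)" "continuous_on UNIV \<phi>"
    "\<And>t. t \<le> 0 \<Longrightarrow> \<Phi> t = 0" "\<And>t. t \<ge> 1 \<Longrightarrow> \<Phi> t = 1" "\<And>t. t \<le> 0 \<or> t \<ge> 1 \<Longrightarrow> \<phi> t = 0"
    "\<And>t. \<bar>\<phi> t\<bar> \<le> 2"
proof -
  define \<phi> :: "real \<Rightarrow> real" where "\<phi> t = max 0 (6 * t * (1 - t))" for t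
  have cont: "continuous_on UNIV \<phi>" unfolding \<phi>_def by (intro continuous_intros)
  obtain \<Phi> where \<Phi>: "\<Phi> 0 = 0" "\<And>t. (\<Phi> has_vector_derivative \<phi> t) (at t)"
    using antiderivative_on_real_line[OF cont, of 0] by metis
  have zero: "\<phi> t = 0" if "t \<le> 0 \<or> t \<ge> 1" for t
    using that by (auto simp: \<phi>_def max_def mult_le_0_iff zero_le_mult_iff intro!: antisym)
  have "\<phi> t \<le> 2" for t
  proof -
    have "6 * t * (1 - t) = 3 / 2 - 6 * (t - 1 / 2)\<^sup>2" by (simp add: power2_eq_square algebra_simps)
    also have "\<dots> \<le> 2" using zero_le_power2[of "t - 1 / 2"] by linarith
    finally show ?thesis by (simp add: \<phi>_def)
  qed
  then have "\<bar>\<phi> t\<bar> \<le> 2" for t by (simp add: \<phi>_def)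
  moreover have flat: "(\<Phi> has_vector_derivative 0) (at t)" if "t \<le> 0 \<or> t \<ge> 1" for t
    using \<Phi>(2)[of t] zero[OF that] by simp
  moreover have "\<Phi> t = \<Phi> 0" if "t \<le> 0" for t
    by (rule vanishing_derivative_const[of "{..0}"]) (use flat that in auto)
  moreover note \<Phi>(1)
  moreover have "\<Phi> t = 1" if "t \<ge> 1" for t
  proof -
    have "\<Phi> 0 - (3 * 0\<^sup>2 - 2 * 0 ^ 3) = \<Phi> 1 - (3 * 1\<^sup>2 - 2 * 1 ^ 3)"
    proof (rule vanishing_derivative_const[of "{0..1}" "\<lambda>t. \<Phi> t - (3 * t\<^sup>2 - 2 * t ^ 3)"])
      fix t :: real assume t: "t \<in> {0..1}"
      have "((\<lambda>t. 3 * t\<^sup>2 - 2 * t ^ 3) has_vector_derivative 6 * t - 6 * t\<^sup>2) (at t)"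
        by (auto intro!: derivative_eq_intros simp flip: has_real_derivative_iff_has_vector_derivative)
      moreover have "\<phi> t = 6 * t - 6 * t\<^sup>2"
        using t by (simp add: \<phi>_def max_def power2_eq_square algebra_simps mult_left_le)
      ultimately show "((\<lambda>t. \<Phi> t - (3 * t\<^sup>2 - 2 * t ^ 3)) has_vector_derivative 0) (at t)"
        using has_vector_derivative_diff[OF \<Phi>(2)] by fastforce
    qed auto
    then have "\<Phi> 1 = 1" using \<Phi>(1) by simp
    moreover have "\<Phi> t = \<Phi> 1"
      by (rule vanishing_derivative_const[of "{1..}"]) (use flat that in auto)
    ultimately show ?thesis by simp
  qed
  ultimately show ?thesis using that[of \<Phi> \<phi>] \<Phi>(2) cont zero by simp
qed

locale half_line_hyperbolic = bounded_path A K
  for A :: "real \<Rightarrow> 'a::banach \<Rightarrow>\<^sub>L 'a" and K +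
  fixes L :: "'a \<Rightarrow>\<^sub>L 'a" and C :: real
  assumes lim: "(A \<longlongrightarrow> L) at_top" and inv: "c0_invertible (\<lambda>_. L) C"
begin

text \<open>Freezing the coefficient before a large time \<open>N\<close> gives a path on the whole line that stays close to the
  limit \<open>L\<close> and agrees with the given one on \<open>[N, \<infinity>)\<close>.\<close>

lemma frozen_path:
  obtains N where "N \<ge> 0" "c0_invertible (\<lambda>t. A (max N t)) (2 * C)"
proof -
  have "C > 0" using inv by (simp add: c0_invertible_def)
  then obtain M where M: "\<And>t. t \<ge> M \<Longrightarrow> norm (A t - L) < 1 / (2 * C)"
    using tendstoD[OF lim, of "1 / (2 * C)"] unfolding eventually_at_top_linorder dist_norm by auto
  show ?thesis
  proof (rule that[of "max 0 M"])
    show "c0_invertible (\<lambda>t. A (max (max 0 M) t)) (2 * C)"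
    proof (rule c0_invertible_perturbation[OF inv])
      show "norm (A (max (max 0 M) t) - L) \<le> 1 / (2 * C)" for t
        by (rule less_imp_le, rule M) auto
    qed (auto intro!: continuous_intros continuous_on_compose2[OF cont])
  qed auto
qed

text \<open>After time \<open>N\<close> the solution is the one of the frozen equation.  It is continued back to \<open>0\<close> by
  solving the Cauchy problem at time \<open>N\<close>, at the cost of a factor that depends on \<open>N\<close> only.\<close>

lemma decaying_solution:
  shows "\<exists>D. \<forall>f :: 'a c0. \<exists>v. solves A (apply_c0 f) v \<and> (v \<longlongrightarrow> 0) at_top \<and> norm (v 0) \<le> D * norm f"
proof -
  obtain N where N: "N \<ge> 0" and invN: "c0_invertible (\<lambda>t. A (max N t)) (2 * C)"
    by (rule frozen_path)
  define D where "D = 2 * exp (2 * K * N) * (2 * C + N)"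
  have "\<exists>v. solves A (apply_c0 f) v \<and> (v \<longlongrightarrow> 0) at_top \<and> norm (v 0) \<le> D * norm f" for f :: "'a c0"
  proof -
    obtain u where u: "solves (\<lambda>t. A (max N t)) (apply_c0 f) (apply_c0 u)"
      using invN unfolding c0_invertible_def by blast
    have bu: "norm u \<le> 2 * C * norm f"
      using invN u unfolding c0_invertible_def by blast
    obtain v where v: "v N = apply_c0 u N" "solves A (apply_c0 f) v"
      using solves_exists[OF in_c0_apply] by blast
    have vu: "v t = apply_c0 u t" if "t \<ge> N" for t
    proof -
      have "v t - apply_c0 u t = 0"
      proof (rule growth_zero_forward[of N _ "\<lambda>t. A t (v t - apply_c0 u t)" K])
        show "((\<lambda>t. v t - apply_c0 u t) has_vector_derivative A s (v s - apply_c0 u s)) (at s)"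
          if "N \<le> s" for s
        proof -
          have "(v has_vector_derivative A s (v s) + apply_c0 f s) (at s)"
            "(apply_c0 u has_vector_derivative A s (apply_c0 u s) + apply_c0 f s) (at s)"
            using v(2) u[unfolded solves_def, rule_format, of s] that
            by (simp_all add: solves_def max_absorb2)
          from has_vector_derivative_diff[OF this] show ?thesis by (simp add: blinfun.diff_right)
        qed
      qed (use bound_apply K v(1) that in auto)
      then show ?thesis by simp
    qed
    have "(apply_c0 u \<longlongrightarrow> 0) at_top"
      using in_c0_apply[of u] by (simp add: in_c0_def vanishes_at_infty_def)
    then have lim: "(v \<longlongrightarrow> 0) at_top"
      by (rule Lim_transform_eventually)
        (use vu in \<open>auto simp: eventually_at_top_linorder intro!: exI[of _ N]\<close>)
    have "norm (v (- N + N)) \<le> 2 * exp (2 * K * (N - 0)) * (norm (v (- 0 + N)) + norm f * (N - 0))"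
    proof (rule gronwall[where z="\<lambda>s. v (- s + N)"])
      show "((\<lambda>s. v (- s + N)) has_vector_derivative
          - (A (- s + N) (v (- s + N)) + apply_c0 f (- s + N))) (at s)" for s
        using v(2) by (intro has_vector_derivative_reflect[where u="\<lambda>s. v (s + N)"] has_vector_derivative_shift)
          (simp add: solves_def)
      show "norm (- (A (- s + N) (v (- s + N)) + apply_c0 f (- s + N))) \<le> K * norm (v (- s + N)) + norm f" for s
        unfolding norm_minus_cancel
        by (intro order_trans[OF norm_triangle_ineq] add_mono bound_apply norm_apply_c0_le)
    qed (use K N in auto)
    also have "\<dots> \<le> 2 * exp (2 * K * N) * (2 * C * norm f + norm f * N)"
      using bu v(1) norm_apply_c0_le[of u N] N by (intro mult_mono add_mono) auto
    also have "\<dots> = D * norm f" by (simp add: D_def algebra_simps)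
    finally show ?thesis using v(2) lim by auto
  qed
  then show ?thesis by blast
qed

text \<open>Cutting off a decaying solution \<open>y\<close> before time \<open>N\<close> gives a solution of the frozen equation with right-hand
  side \<open>\<phi> (t - N) *\<^sub>R y t\<close>, supported in \<open>[N, N + 1]\<close>.  The estimate for the frozen equation then bounds
  \<open>y\<close> at all later times by its values on that interval.\<close>

lemma stable_space_uniform:
  obtains M N where "\<And>x t. x \<in> stable_space A \<Longrightarrow> t \<ge> N \<Longrightarrow> norm (propagator A t x) \<le> M * norm x"
proof -
  obtain N where N: "N \<ge> 0" and invN: "c0_invertible (\<lambda>t. A (max N t)) (2 * C)"
    by (rule frozen_path)
  obtain \<Phi> \<phi> :: "real \<Rightarrow> real" where \<Phi>: "\<And>t. (\<Phi> has_vector_derivative \<phi> t) (at t)"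
    and c\<phi>: "continuous_on UNIV \<phi>" and \<Phi>0: "\<And>t. t \<le> 0 \<Longrightarrow> \<Phi> t = 0" and \<Phi>1: "\<And>t. t \<ge> 1 \<Longrightarrow> \<Phi> t = 1"
    and \<phi>0: "\<And>t. t \<le> 0 \<or> t \<ge> 1 \<Longrightarrow> \<phi> t = 0" and \<phi>2: "\<And>t. \<bar>\<phi> t\<bar> \<le> 2"
    by (rule smooth_step) blast
  have "bounded (propagator A ` {N..N + 1})"
    by (intro compact_imp_bounded compact_continuous_image continuous_propagator) auto
  then obtain b where b: "b > 0" "\<And>t. N \<le> t \<Longrightarrow> t \<le> N + 1 \<Longrightarrow> norm (propagator A t) \<le> b"
    unfolding bounded_pos by auto
  have "norm (propagator A t x) \<le> (2 * C * (2 * b)) * norm x"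
    if x: "x \<in> stable_space A" and t: "t \<ge> N + 1" for x t
  proof -
    let ?y = "\<lambda>t. propagator A t x"
    define z where "z t = \<Phi> (t - N) *\<^sub>R ?y t" for t
    define f where "f t = \<phi> (t - N) *\<^sub>R ?y t" for t
    have cy: "continuous_on UNIV ?y" by (rule solves_continuous[OF solves_propagator])
    have dz: "solves (\<lambda>t. A (max N t)) f z"
      unfolding solves_def
    proof
      fix t
      have "((\<lambda>t. \<Phi> (t + - N)) has_vector_derivative \<phi> (t - N)) (at t)"
        using has_vector_derivative_shift[of \<Phi> "\<phi> (t - N)" t "- N"] \<Phi>[of "t - N"] by simp
      moreover have "(?y has_vector_derivative A t (?y t)) (at t)"
        using solves_propagator[of x] by (simp add: solves_def)
      ultimately have "((\<lambda>t. \<Phi> (t + - N) *\<^sub>R ?y t) has_vector_derivative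
          \<Phi> (t + - N) *\<^sub>R A t (?y t) + \<phi> (t - N) *\<^sub>R ?y t) (at t)"
        by (rule bounded_bilinear.has_vector_derivative[OF bounded_bilinear_scaleR])
      moreover have "\<Phi> (t - N) *\<^sub>R A t (?y t) = A (max N t) (\<Phi> (t - N) *\<^sub>R ?y t)"
        using \<Phi>0[of "t - N"] by (cases "t \<le> N") (auto simp: blinfun.scaleR_right max_def)
      ultimately show "(z has_vector_derivative A (max N t) (z t) + f t) (at t)"
        by (simp add: z_def[abs_def] f_def)
    qed
    have cf: "continuous_on UNIV f"
      unfolding f_def by (intro continuous_on_scaleR cy continuous_on_compose2[OF c\<phi>] continuous_intros) auto
    have "in_c0 f"
      unfolding in_c0_def vanishes_at_infty_def
    proof (intro conjI cf)
      show "(f \<longlongrightarrow> 0) at_top"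
        by (rule tendsto_eventually) (auto simp: eventually_at_top_linorder f_def \<phi>0 intro!: exI[of _ "N + 1"])
      show "(f \<longlongrightarrow> 0) at_bot"
        by (rule tendsto_eventually) (auto simp: eventually_at_bot_linorder f_def \<phi>0 intro!: exI[of _ N])
    qed
    have "in_c0 z"
      unfolding in_c0_def vanishes_at_infty_def
    proof (intro conjI solves_continuous[OF dz])
      have "(?y \<longlongrightarrow> 0) at_top" using x by (simp add: stable_space_def)
      then show "(z \<longlongrightarrow> 0) at_top"
        by (rule Lim_transform_eventually)
          (auto simp: eventually_at_top_linorder z_def \<Phi>1 intro!: exI[of _ "N + 1"])
      show "(z \<longlongrightarrow> 0) at_bot"
        by (rule tendsto_eventually) (auto simp: eventually_at_bot_linorder z_def \<Phi>0 intro!: exI[of _ N])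
    qed
    have "solves (\<lambda>t. A (max N t)) (apply_c0 (Abs_c0 f)) (apply_c0 (Abs_c0 z))"
      using dz by (simp add: apply_Abs_c0 \<open>in_c0 f\<close> \<open>in_c0 z\<close>)
    then have "norm (Abs_c0 z) \<le> 2 * C * norm (Abs_c0 f)"
      using invN unfolding c0_invertible_def by blast
    also have "norm (Abs_c0 f) \<le> 2 * (b * norm x)"
    proof (rule norm_c0_le)
      fix s
      show "norm (apply_c0 (Abs_c0 f) s) \<le> 2 * (b * norm x)"
      proof (cases "N \<le> s \<and> s \<le> N + 1")
        case True
        then have "norm (?y s) \<le> b * norm x"
          by (intro order_trans[OF norm_blinfun] mult_right_mono b) auto
        then show ?thesis
          using \<phi>2[of "s - N"] by (simp add: apply_Abs_c0 \<open>in_c0 f\<close> f_def mult_mono)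
      next
        case False
        then have "\<phi> (s - N) = 0" by (intro \<phi>0) auto
        then show ?thesis using b by (simp add: apply_Abs_c0 \<open>in_c0 f\<close> f_def)
      qed
    qed
    finally have "norm (Abs_c0 z) \<le> 2 * C * (2 * (b * norm x))"
      using inv by (simp add: c0_invertible_def)
    moreover have "?y t = apply_c0 (Abs_c0 z) t"
      using t by (simp add: apply_Abs_c0 \<open>in_c0 z\<close> z_def \<Phi>1)
    ultimately show ?thesis
      using norm_apply_c0_le[of "Abs_c0 z" t] by (simp add: mult_ac)
  qed
  then show ?thesis by (rule that)
qed

text \<open>By the uniform bound, orbits of a convergent sequence of stable vectors converge uniformly for large times.\<close>

lemma closed_stable_space: "closed (stable_space A)"
proof -
  obtain M N where MN: "\<And>x t. x \<in> stable_space A \<Longrightarrow> t \<ge> N \<Longrightarrow> norm (propagator A t x) \<le> M * norm x"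
    by (rule stable_space_uniform) blast
  have diff: "x - y \<in> stable_space A" if "x \<in> stable_space A" "y \<in> stable_space A" for x y
    using tendsto_diff[of _ 0 at_top _ 0] that by (fastforce simp: stable_space_def blinfun.diff_right)
  show ?thesis
    unfolding closed_sequential_limits
  proof (intro allI impI, elim conjE)
    fix xs x assume xs: "\<forall>n. xs n \<in> stable_space A" "xs \<longlonglongrightarrow> x"
    have close: "norm (propagator A t (xs n - x)) \<le> M * norm (xs n - x)" if "t \<ge> N" for t n
    proof (rule tendsto_le[of sequentially])
      show "(\<lambda>m. norm (propagator A t (xs n - xs m))) \<longlonglongrightarrow> norm (propagator A t (xs n - x))"
        "(\<lambda>m. M * norm (xs n - xs m)) \<longlonglongrightarrow> M * norm (xs n - x)"
        by (intro tendsto_intros blinfun.tendsto xs)+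
      show "\<forall>\<^sub>F m in sequentially. norm (propagator A t (xs n - xs m)) \<le> M * norm (xs n - xs m)"
        using MN[OF diff that] xs(1) by simp
    qed simp
    have "((\<lambda>t. propagator A t x) \<longlongrightarrow> 0) at_top"
    proof (rule tendstoI)
      fix \<epsilon> :: real assume "\<epsilon> > 0"
      have "(\<lambda>n. M * norm (xs n - x)) \<longlonglongrightarrow> M * norm (x - x)"
        by (intro tendsto_intros xs)
      then obtain n where n: "M * norm (xs n - x) < \<epsilon> / 2"
        using order_tendstoD(2)[of "\<lambda>n. M * norm (xs n - x)" 0 sequentially "\<epsilon> / 2"] \<open>\<epsilon> > 0\<close>
        by (auto dest!: eventually_happens)
      have "((\<lambda>t. propagator A t (xs n)) \<longlongrightarrow> 0) at_top" using xs(1) by (simp add: stable_space_def)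
      then have "\<forall>\<^sub>F t in at_top. dist (propagator A t (xs n)) 0 < \<epsilon> / 2"
        using \<open>\<epsilon> > 0\<close> by (intro tendstoD) auto
      then show "\<forall>\<^sub>F t in at_top. dist (propagator A t x) 0 < \<epsilon>"
        using eventually_ge_at_top[of N]
      proof eventually_elim
        case (elim t)
        have "norm (propagator A t x) \<le> norm (propagator A t (xs n)) + norm (propagator A t (xs n - x))"
          using norm_triangle_ineq4[of "propagator A t (xs n)" "propagator A t (xs n - x)"]
          by (simp add: blinfun.diff_right)
        with elim close[of t n] n show ?case by simp
      qed
    qed
    then show "x \<in> stable_space A" by (simp add: stable_space_def)
  qed
qed

end

section \<open>Dimension and codimension under linear correspondences\<close>

lemma edim_injective_image:
  assumes g: "Vector_Spaces.linear sc1 sc2 g" and V: "module.subspace sc1 V" and inj: "inj_on g V"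
  shows "edim sc2 (g ` V) = edim sc1 V"
proof -
  interpret g: Vector_Spaces.linear sc1 sc2 g by fact
  obtain B where B: "B \<subseteq> V" "g.vs1.independent B" "V \<subseteq> g.vs1.span B" "card B = g.vs1.dim V"
    using g.vs1.basis_exists by blast
  have span: "g.vs1.span B = V"
    using B(1,3) g.vs1.span_minimal[OF B(1) V] by blast
  have ind: "g.vs2.independent (g ` B)"
    by (rule g.independent_injective_image[OF B(2)]) (simp add: span inj)
  have gV: "g ` V = g.vs2.span (g ` B)" by (simp add: g.span_image span)
  have injB: "inj_on g B" using inj B(1) by (rule inj_on_subset)
  have "g.vs2.dim (g ` V) = card (g ` B)"
    using gV ind by (simp add: g.vs2.dim_eq_card_independent)
  then have dim: "g.vs2.dim (g ` V) = g.vs1.dim V"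
    using B(4) injB by (simp add: card_image)
  have "(\<exists>C. finite C \<and> g ` V \<subseteq> g.vs2.span C) \<longleftrightarrow> (\<exists>C. finite C \<and> V \<subseteq> g.vs1.span C)"
  proof
    assume "\<exists>C. finite C \<and> g ` V \<subseteq> g.vs2.span C"
    then obtain C where "finite C" "g ` B \<subseteq> g.vs2.span C" using B(1) by blast
    then have "finite (g ` B)" using g.vs2.independent_span_bound[OF _ ind] by blast
    then have "finite B" using injB by (rule finite_imageD)
    then show "\<exists>C. finite C \<and> V \<subseteq> g.vs1.span C" using B(3) by blast
  next
    assume "\<exists>C. finite C \<and> V \<subseteq> g.vs1.span C"
    then show "\<exists>C. finite C \<and> g ` V \<subseteq> g.vs2.span C"
      by (metis finite_imageI g.span_image image_mono)
  qed
  then show ?thesis by (simp add: edim_def dim)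
qed

text \<open>If every relation modulo \<open>R\<close> among the vectors \<open>\<sigma> b\<close> is a relation modulo \<open>W\<close> among the vectors \<open>b\<close>,
  then independence modulo \<open>W\<close> passes to the images.  This is used in both directions below.\<close>

lemma quotient_independence_transfer:
  fixes sc1 :: "'k::field \<Rightarrow> 'e::ab_group_add \<Rightarrow> 'e" and sc2 :: "'k \<Rightarrow> 'f::ab_group_add \<Rightarrow> 'f"
  assumes vs2: "vector_space sc2" and R: "module.subspace sc2 R"
    and B: "\<And>T c. finite T \<Longrightarrow> T \<subseteq> B \<Longrightarrow> (\<Sum>b\<in>T. sc1 (c b) b) \<in> W \<Longrightarrow> \<forall>b\<in>T. c b = 0"
    and transfer: "\<And>T c. finite T \<Longrightarrow> T \<subseteq> B \<Longrightarrow> (\<Sum>b\<in>T. sc2 (c b) (\<sigma> b)) \<in> R \<Longrightarrow>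
      (\<Sum>b\<in>T. sc1 (c b) b) \<in> W"
  shows "inj_on \<sigma> B"
    and "\<forall>T c. finite T \<longrightarrow> T \<subseteq> \<sigma> ` B \<longrightarrow> (\<Sum>b\<in>T. sc2 (c b) b) \<in> R \<longrightarrow> (\<forall>b\<in>T. c b = 0)"
proof -
  interpret vs2: vector_space sc2 by fact
  show inj: "inj_on \<sigma> B"
  proof (rule inj_onI, rule ccontr)
    fix x y assume xy: "x \<in> B" "y \<in> B" "\<sigma> x = \<sigma> y" "x \<noteq> y"
    have "\<forall>b\<in>{x, y}. (if b = x then 1 else - 1 :: 'k) = 0"
    proof (rule B[OF _ _ transfer])
      have "(\<Sum>b\<in>{x, y}. sc2 (if b = x then 1 else - 1) (\<sigma> b)) = 0" using xy by auto
      then show "(\<Sum>b\<in>{x, y}. sc2 (if b = x then 1 else - 1) (\<sigma> b)) \<in> R"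
        using vs2.subspace_0[OF R] by simp
    qed (use xy in auto)
    then show False by auto
  qed
  show "\<forall>T c. finite T \<longrightarrow> T \<subseteq> \<sigma> ` B \<longrightarrow> (\<Sum>b\<in>T. sc2 (c b) b) \<in> R \<longrightarrow> (\<forall>b\<in>T. c b = 0)"
  proof (intro allI impI)
    fix T c assume T: "finite T" "T \<subseteq> \<sigma> ` B" "(\<Sum>b\<in>T. sc2 (c b) b) \<in> R"
    from T(2) obtain U where U: "U \<subseteq> B" "T = \<sigma> ` U" by (auto simp: subset_image_iff)
    have injU: "inj_on \<sigma> U" using inj U(1) by (rule inj_on_subset)
    then have "finite U" using T(1) U(2) by (simp add: finite_image_iff)
    moreover have "(\<Sum>b\<in>U. sc2 (c (\<sigma> b)) (\<sigma> b)) \<in> R"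
      using T(3) by (simp add: U(2) sum.reindex[OF injU])
    ultimately have "\<forall>b\<in>U. c (\<sigma> b) = 0"
      using B[of U "\<lambda>b. c (\<sigma> b)"] transfer[of U "\<lambda>b. c (\<sigma> b)"] U(1) by auto
    then show "\<forall>b\<in>T. c b = 0" by (simp add: U(2))
  qed
qed

text \<open>The hypotheses say that \<open>S\<close> induces an isomorphism of the quotients by \<open>W\<close> and \<open>R\<close>.  A basis of the first
  quotient is carried over by \<open>S\<close>, a basis of the second one by any choice of representatives \<open>\<xi>\<close>.\<close>

lemma ecodim_transfer:
  fixes sc1 :: "'k::field \<Rightarrow> 'e::ab_group_add \<Rightarrow> 'e" and sc2 :: "'k \<Rightarrow> 'f::ab_group_add \<Rightarrow> 'f"
  assumes S: "Vector_Spaces.linear sc1 sc2 S"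
    and W: "module.subspace sc1 W" and R: "module.subspace sc2 R"
    and SR: "\<And>x. S x \<in> R \<longleftrightarrow> x \<in> W" and onto: "\<And>f. \<exists>x. f - S x \<in> R"
  shows "ecodim sc2 R = ecodim sc1 W"
proof -
  interpret S: Vector_Spaces.linear sc1 sc2 S by fact
  have image: "finite (S ` B) \<and> quotient_basis sc2 R (S ` B) \<and> card (S ` B) = card B"
    if B: "finite B" "quotient_basis sc1 W B" for B
  proof -
    have ind: "\<And>T c. finite T \<Longrightarrow> T \<subseteq> B \<Longrightarrow> (\<Sum>b\<in>T. sc1 (c b) b) \<in> W \<Longrightarrow> \<forall>b\<in>T. c b = 0"
      using B(2) unfolding quotient_basis_def by blast
    have transfer: "(\<Sum>b\<in>T. sc1 (c b) b) \<in> W"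
      if "finite T" "T \<subseteq> B" "(\<Sum>b\<in>T. sc2 (c b) (S b)) \<in> R" for T c
      using that SR by (simp add: S.sum[symmetric] S.scale[symmetric])
    have "f \<in> S.vs2.span (R \<union> S ` B)" for f
    proof -
      obtain x where x: "f - S x \<in> R" using onto by blast
      have "x \<in> S.vs1.span (W \<union> B)" using B(2) by (simp add: quotient_basis_def)
      then have "S x \<in> S.vs2.span (S ` (W \<union> B))" by (auto simp: S.span_image)
      moreover have "S ` (W \<union> B) \<subseteq> R \<union> S ` B" using SR by auto
      ultimately have "S x \<in> S.vs2.span (R \<union> S ` B)" using S.vs2.span_mono by blast
      moreover have "f - S x \<in> S.vs2.span (R \<union> S ` B)" using x by (intro S.vs2.span_base) auto
      ultimately have "(f - S x) + S x \<in> S.vs2.span (R \<union> S ` B)" by (intro S.vs2.span_add)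
      then show ?thesis by simp
    qed
    then have "S.vs2.span (R \<union> S ` B) = UNIV" by blast
    note q = quotient_independence_transfer[where \<sigma>=S, OF S.vs2.vector_space_axioms R ind transfer]
    have "quotient_basis sc2 R (S ` B)"
      unfolding quotient_basis_def by (intro conjI q(2)) fact
    moreover have "card (S ` B) = card B" by (rule card_image[OF q(1)])
    ultimately show ?thesis using B(1) by simp
  qed
  obtain \<xi> where \<xi>: "\<And>f. f - S (\<xi> f) \<in> R" using onto by metis
  have preimage: "finite (\<xi> ` B) \<and> quotient_basis sc1 W (\<xi> ` B)"
    if B: "finite B" "quotient_basis sc2 R B" for B
  proof -
    have eq: "S (\<Sum>b\<in>T. sc1 (c b) (\<xi> b)) = (\<Sum>b\<in>T. sc2 (c b) b) - (\<Sum>b\<in>T. sc2 (c b) (b - S (\<xi> b)))" for T c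
      by (simp add: S.sum S.scale S.vs2.scale_right_diff_distrib sum_subtractf)
    have inR: "(\<Sum>b\<in>T. sc2 (c b) (b - S (\<xi> b))) \<in> R" for T c
      by (intro S.vs2.subspace_sum[OF R] S.vs2.subspace_scale[OF R] \<xi>)
    have ind: "\<And>T c. finite T \<Longrightarrow> T \<subseteq> B \<Longrightarrow> (\<Sum>b\<in>T. sc2 (c b) b) \<in> R \<Longrightarrow> \<forall>b\<in>T. c b = 0"
      using B(2) unfolding quotient_basis_def by blast
    have transfer: "(\<Sum>b\<in>T. sc2 (c b) b) \<in> R"
      if "finite T" "T \<subseteq> B" "(\<Sum>b\<in>T. sc1 (c b) (\<xi> b)) \<in> W" for T c
    proof -
      have "(\<Sum>b\<in>T. sc2 (c b) b) = S (\<Sum>b\<in>T. sc1 (c b) (\<xi> b)) + (\<Sum>b\<in>T. sc2 (c b) (b - S (\<xi> b)))"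
        by (simp only: eq diff_add_cancel)
      moreover have "S (\<Sum>b\<in>T. sc1 (c b) (\<xi> b)) \<in> R" using that(3) SR by blast
      ultimately show ?thesis using S.vs2.subspace_add[OF R _ inR] by simp
    qed
    have "x \<in> S.vs1.span (W \<union> \<xi> ` B)" for x
    proof -
      have "S x \<in> S.vs2.span (R \<union> B)" using B(2) by (simp add: quotient_basis_def)
      then obtain r s where rs: "S x = r + s" "r \<in> S.vs2.span R" "s \<in> S.vs2.span B"
        unfolding S.vs2.span_Un by auto
      then obtain c where c: "s = (\<Sum>b\<in>B. sc2 (c b) b)"
        using S.vs2.span_finite[OF B(1)] by auto
      have r: "r \<in> R" using rs(2) R by (simp add: S.vs2.span_eq_iff[THEN iffD2])
      have "S (x - (\<Sum>b\<in>B. sc1 (c b) (\<xi> b))) = r + (\<Sum>b\<in>B. sc2 (c b) (b - S (\<xi> b)))"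
        by (simp add: S.diff eq rs(1) c)
      then have "x - (\<Sum>b\<in>B. sc1 (c b) (\<xi> b)) \<in> W"
        using S.vs2.subspace_add[OF R r inR] by (simp add: SR[symmetric])
      then have "x - (\<Sum>b\<in>B. sc1 (c b) (\<xi> b)) \<in> S.vs1.span (W \<union> \<xi> ` B)"
        by (intro S.vs1.span_base) auto
      moreover have "(\<Sum>b\<in>B. sc1 (c b) (\<xi> b)) \<in> S.vs1.span (W \<union> \<xi> ` B)"
        by (intro S.vs1.span_sum S.vs1.span_scale S.vs1.span_base) auto
      ultimately have "(x - (\<Sum>b\<in>B. sc1 (c b) (\<xi> b))) + (\<Sum>b\<in>B. sc1 (c b) (\<xi> b)) \<in> S.vs1.span (W \<union> \<xi> ` B)"
        by (rule S.vs1.span_add)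
      then show ?thesis by simp
    qed
    then have "S.vs1.span (W \<union> \<xi> ` B) = UNIV" by blast
    note q = quotient_independence_transfer(2)[where \<sigma>=\<xi>, OF S.vs1.vector_space_axioms W ind transfer]
    have "quotient_basis sc1 W (\<xi> ` B)"
      unfolding quotient_basis_def by (intro conjI q) fact
    then show ?thesis using B(1) by simp
  qed
  show ?thesis
  proof (cases "\<exists>B. finite B \<and> quotient_basis sc1 W B")
    case True
    then obtain B where "finite B" "quotient_basis sc1 W B" by blast
    then show ?thesis
      using image[of B] ecodim_eq_card[OF S.vs1.vector_space_axioms W, of B]
        ecodim_eq_card[OF S.vs2.vector_space_axioms R, of "S ` B"] by simp
  next
    case False
    then have "\<not> (\<exists>B. finite B \<and> quotient_basis sc2 R B)" using preimage by blast
    with False show ?thesis by (simp add: ecodim_def)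
  qed
qed

section \<open>The range and the kernel of the operator\<close>

locale asymptotically_hyperbolic_path = bounded_path A K
  for A :: "real \<Rightarrow> 'a::banach \<Rightarrow>\<^sub>L 'a" and K +
  fixes L1 L2 :: "'a \<Rightarrow>\<^sub>L 'a" and C1 C2 :: real
  assumes top: "(A \<longlongrightarrow> L1) at_top" and inv1: "c0_invertible (\<lambda>_. L1) C1"
    and bot: "(A \<longlongrightarrow> L2) at_bot" and inv2: "c0_invertible (\<lambda>_. L2) C2"
begin

sublocale pos: half_line_hyperbolic A K L1 C1
  by unfold_locales (fact top inv1)+

sublocale neg: half_line_hyperbolic "\<lambda>t. - A (- t)" K "- L2" C2
proof -
  interpret bounded_path "\<lambda>t. - A (- t)" K by (rule reflected)
  show "half_line_hyperbolic (\<lambda>t. - A (- t)) K (- L2) C2"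
  proof
    show "((\<lambda>t. - A (- t)) \<longlongrightarrow> - L2) at_top"
      using bot by (intro tendsto_minus) (simp add: filterlim_reflect)
    show "c0_invertible (\<lambda>_. - L2) C2" using c0_invertible_reflect[OF inv2] .
  qed
qed

definition F where "F = F_op A"
definition Ws where "Ws = stable_space A"
definition Wu where "Wu = unstable_space A"
definition W where "W = subspace_sum Ws Wu"

lemma closed_Ws: "closed Ws" unfolding Ws_def by (rule pos.closed_stable_space)
lemma closed_Wu: "closed Wu"
  unfolding Wu_def unstable_space_reflected by (rule neg.closed_stable_space)

lemma F_eq_iff: "F u = f \<longleftrightarrow> solves A (apply_c0 f) (apply_c01 u)"
proof -
  have "apply_c0 (F u) t = vector_derivative (apply_c01 u) (at t) - A t (apply_c01 u t)" for t
    unfolding F_def by (rule apply_F_op[OF cont top bot])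
  then have *: "solves A (apply_c0 (F u)) (apply_c01 u)"
    unfolding solves_def using c01_has_vector_derivative by auto
  show ?thesis
  proof
    assume "solves A (apply_c0 f) (apply_c01 u)"
    with * have "A t (apply_c01 u t) + apply_c0 (F u) t = A t (apply_c01 u t) + apply_c0 f t" for t
      unfolding solves_def by (blast intro: vector_derivative_unique_at)
    then show "F u = f" by (intro c0_eqI) simp
  qed (use * in simp)
qed

lemma solves_F: "solves A (apply_c0 (F u)) (apply_c01 u)"
  using F_eq_iff by blast

lemma vanishing_solution_in_c01:
  assumes w: "solves A (apply_c0 f) w" and van: "vanishes_at_infty w"
  obtains u where "apply_c01 u = w" "F u = f"
proof -
  have w': "(w has_vector_derivative A t (w t) + apply_c0 f t) (at t)" for t
    using w by (simp add: solves_def)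
  have d: "vector_derivative w (at t) = A t (w t) + apply_c0 f t" for t
    by (rule vector_derivative_at[OF w'])
  have lim: "((\<lambda>t. A t (w t) + apply_c0 f t) \<longlongrightarrow> 0) G"
    if "(A \<longlongrightarrow> L) G" "(w \<longlongrightarrow> 0) G" "(apply_c0 f \<longlongrightarrow> 0) G" for L G
    using tendsto_add[OF blinfun.tendsto[OF that(1,2)] that(3)] by simp
  have "vanishes_at_infty (\<lambda>t. vector_derivative w (at t))"
    using van lim[OF top] lim[OF bot] in_c0_apply[of f]
    by (simp add: d vanishes_at_infty_def in_c0_def)
  moreover have "w C1_differentiable_on UNIV"
    unfolding C1_differentiable_on_def
  proof (intro exI conjI)
    show "\<forall>x\<in>UNIV. (w has_vector_derivative A x (w x) + apply_c0 f x) (at x)" using w' by blast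
    show "continuous_on UNIV (\<lambda>x. A x (w x) + apply_c0 f x)"
      using in_c0_apply[of f] unfolding in_c0_def
      by (intro continuous_on_add blinfun.continuous_on cont solves_continuous[OF w]) auto
  qed
  ultimately have "apply_c01 (Abs_c01 w) = w" using van by (intro Abs_c01_inverse) auto
  then show ?thesis using that F_eq_iff w by metis
qed

lemma decaying_solutions:
  obtains D where "D \<ge> 0" "\<And>f. \<exists>v. solves A (apply_c0 f) v \<and> (v \<longlongrightarrow> 0) at_top \<and> norm (v 0) \<le> D * norm f"
    "\<And>f. \<exists>v. solves A (apply_c0 f) v \<and> (v \<longlongrightarrow> 0) at_bot \<and> norm (v 0) \<le> D * norm f"
proof -
  obtain D1 where D1: "\<And>f. \<exists>v. solves A (apply_c0 f) v \<and> (v \<longlongrightarrow> 0) at_top \<and> norm (v 0) \<le> D1 * norm f"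
    using pos.decaying_solution by blast
  obtain D2 where D2: "\<And>f. \<exists>v. solves (\<lambda>t. - A (- t)) (apply_c0 f) v \<and> (v \<longlongrightarrow> 0) at_top \<and>
      norm (v 0) \<le> D2 * norm f"
    using neg.decaying_solution by blast
  define D where "D = max 0 (max D1 D2)"
  have D: "D1 * norm f \<le> D * norm f" "D2 * norm f \<le> D * norm f" for f :: "'a c0"
    by (auto simp: D_def intro: mult_right_mono)
  have "\<exists>v. solves A (apply_c0 f) v \<and> (v \<longlongrightarrow> 0) at_bot \<and> norm (v 0) \<le> D * norm f" for f
  proof -
    define g where "g = Abs_c0 (\<lambda>t. - apply_c0 f (- t))"
    have g: "apply_c0 g = (\<lambda>t. - apply_c0 f (- t))"
      unfolding g_def
      by (intro apply_Abs_c0 in_c0_bounded_linear[OF bounded_linear_minus[OF bounded_linear_ident]]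
          in_c0_reflect in_c0_apply)
    have "norm g \<le> norm f" by (rule norm_c0_le) (simp add: g norm_apply_c0_le)
    obtain v where v: "solves (\<lambda>t. - A (- t)) (apply_c0 g) v" "(v \<longlongrightarrow> 0) at_top" "norm (v 0) \<le> D2 * norm g"
      using D2 by blast
    have "D2 * norm g \<le> D * norm g" by (rule D)
    also have "\<dots> \<le> D * norm f" using \<open>norm g \<le> norm f\<close> by (intro mult_left_mono) (auto simp: D_def)
    finally have "norm (v (- 0)) \<le> D * norm f" using v(3) by simp
    moreover have "solves A (apply_c0 f) (\<lambda>t. v (- t))"
      using solves_reflect[OF v(1)] by (simp add: g)
    moreover have "((\<lambda>t. v (- t)) \<longlongrightarrow> 0) at_bot" using v(2) by (simp add: filterlim_reflect)
    ultimately show ?thesis by blast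
  qed
  moreover have "\<exists>v. solves A (apply_c0 f) v \<and> (v \<longlongrightarrow> 0) at_top \<and> norm (v 0) \<le> D * norm f" for f
    using D1[of f] D(1)[of f] by (meson order_trans)
  ultimately show ?thesis using that[of D] by (auto simp: D_def)
qed

lemma homogeneous_decay:
  assumes "solves A (\<lambda>_. 0) z"
  shows "(z \<longlongrightarrow> 0) at_top \<longleftrightarrow> z 0 \<in> Ws" "(z \<longlongrightarrow> 0) at_bot \<longleftrightarrow> z 0 \<in> Wu"
proof -
  have "z = (\<lambda>t. propagator A t (z 0))" using solves_homogeneous[OF assms] by blast
  then show "(z \<longlongrightarrow> 0) at_top \<longleftrightarrow> z 0 \<in> Ws" "(z \<longlongrightarrow> 0) at_bot \<longleftrightarrow> z 0 \<in> Wu"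
    by (simp_all add: Ws_def Wu_def stable_space_def unstable_space_def)
qed

text \<open>A solution \<open>u\<close> decaying at both ends differs from \<open>v\<close> by a homogeneous solution with stable initial
  value, and from \<open>w\<close> by one with unstable initial value.  Conversely, a decomposition of \<open>w 0 - v 0\<close> makes
  the two corrected solutions agree at \<open>0\<close>, hence everywhere.\<close>

lemma range_criterion:
  assumes v: "solves A (apply_c0 f) v" "(v \<longlongrightarrow> 0) at_top"
    and w: "solves A (apply_c0 f) w" "(w \<longlongrightarrow> 0) at_bot"
  shows "f \<in> range F \<longleftrightarrow> w 0 - v 0 \<in> W"
proof
  assume "f \<in> range F"
  then obtain u where u: "solves A (apply_c0 f) (apply_c01 u)" using F_eq_iff by auto
  have lim: "(apply_c01 u \<longlongrightarrow> 0) at_top" "(apply_c01 u \<longlongrightarrow> 0) at_bot"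
    using c01_vanishes[of u] by (auto simp: vanishes_at_infty_def)
  have "apply_c01 u 0 - v 0 \<in> Ws"
    using homogeneous_decay(1)[of "\<lambda>t. apply_c01 u t - v t"] solves_diff[OF u v(1)]
      tendsto_diff[OF lim(1) v(2)] by simp
  moreover have "w 0 - apply_c01 u 0 \<in> Wu"
    using homogeneous_decay(2)[of "\<lambda>t. w t - apply_c01 u t"] solves_diff[OF w(1) u]
      tendsto_diff[OF w(2) lim(2)] by simp
  moreover have "w 0 - v 0 = (apply_c01 u 0 - v 0) + (w 0 - apply_c01 u 0)" by simp
  ultimately show "w 0 - v 0 \<in> W"
    unfolding W_def subspace_sum_def by blast
next
  assume "w 0 - v 0 \<in> W"
  then obtain a b where ab: "w 0 - v 0 = a + b" "a \<in> Ws" "b \<in> Wu"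
    by (auto simp: W_def subspace_sum_def)
  let ?u = "\<lambda>t. v t + propagator A t a"
  have u: "solves A (apply_c0 f) ?u" using solves_add[OF v(1) solves_propagator] by simp
  have "solves A (apply_c0 f) (\<lambda>t. w t - propagator A t b)"
    using solves_diff[OF w(1) solves_propagator] by simp
  from solves_unique[OF u this, of 0] have uw: "?u = (\<lambda>t. w t - propagator A t b)"
    using ab(1) by (simp add: propagator(1) algebra_simps)
  have "(?u \<longlongrightarrow> 0) at_top"
    using tendsto_add[OF v(2), of "\<lambda>t. propagator A t a" 0] ab(2) by (simp add: Ws_def stable_space_def)
  moreover have "(?u \<longlongrightarrow> 0) at_bot"
    unfolding uw using tendsto_diff[OF w(2), of "\<lambda>t. propagator A t b" 0] ab(3)
    by (simp add: Wu_def unstable_space_def)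
  ultimately obtain u where "F u = f"
    using vanishing_solution_in_c01[OF u] by (auto simp: vanishes_at_infty_def)
  then show "f \<in> range F" by auto
qed

text \<open>If \<open>f\<close> is a limit of elements of the range, the decaying solutions for \<open>f\<close> are corrected by those for the small
  differences; the corrected values at \<open>0\<close> satisfy the criterion, which passes to the limit.  The
  decaying solutions may be chosen arbitrarily, since only their size matters.\<close>

lemma closed_range_if: "closed W \<Longrightarrow> closed (range F)"
  unfolding closed_sequential_limits[of "range F"]
proof (intro allI impI, elim conjE)
  fix fs f
  assume W: "closed W" and fs: "\<forall>n. fs n \<in> range F" "fs \<longlonglongrightarrow> f"
  obtain D where D: "D \<ge> 0"
    "\<And>f. \<exists>v. solves A (apply_c0 f) v \<and> (v \<longlongrightarrow> 0) at_top \<and> norm (v 0) \<le> D * norm f"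
    "\<And>f. \<exists>v. solves A (apply_c0 f) v \<and> (v \<longlongrightarrow> 0) at_bot \<and> norm (v 0) \<le> D * norm f"
    by (rule decaying_solutions) blast
  obtain v where v: "\<And>f. solves A (apply_c0 f) (v f)" "\<And>f. (v f \<longlongrightarrow> 0) at_top" "\<And>f. norm (v f 0) \<le> D * norm f"
    using D(2) by metis
  obtain w where w: "\<And>f. solves A (apply_c0 f) (w f)" "\<And>f. (w f \<longlongrightarrow> 0) at_bot" "\<And>f. norm (w f 0) \<le> D * norm f"
    using D(3) by metis
  define d where "d n = f - fs n" for n
  have "(w f 0 - w (d n) 0) - (v f 0 - v (d n) 0) \<in> W" for n
  proof (rule range_criterion[THEN iffD1])
    have fsn: "apply_c0 (fs n) = (\<lambda>t. apply_c0 f t - apply_c0 (d n) t)"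
      by (simp add: d_def apply_c0_minus fun_eq_iff)
    show "solves A (apply_c0 (fs n)) (\<lambda>t. v f t - v (d n) t)"
      "solves A (apply_c0 (fs n)) (\<lambda>t. w f t - w (d n) t)"
      unfolding fsn by (intro solves_diff v w)+
    show "((\<lambda>t. v f t - v (d n) t) \<longlongrightarrow> 0) at_top" "((\<lambda>t. w f t - w (d n) t) \<longlongrightarrow> 0) at_bot"
      using tendsto_diff[OF v(2) v(2)] tendsto_diff[OF w(2) w(2)] by simp_all
    show "fs n \<in> range F" using fs(1) by blast
  qed
  moreover have d0: "(\<lambda>n. D * norm (d n)) \<longlonglongrightarrow> 0"
    unfolding d_def using tendsto_diff[OF tendsto_const fs(2), of f]
    by (intro tendsto_mult_right_zero tendsto_norm_zero) simp
  have "(\<lambda>n. w (d n) 0) \<longlonglongrightarrow> 0" "(\<lambda>n. v (d n) 0) \<longlonglongrightarrow> 0"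
    by (rule Lim_null_comparison[OF _ d0]; use v(3) w(3) in simp)+
  then have "(\<lambda>n. (w f 0 - w (d n) 0) - (v f 0 - v (d n) 0)) \<longlonglongrightarrow> (w f 0 - 0) - (v f 0 - 0)"
    by (intro tendsto_intros)
  ultimately have "w f 0 - v f 0 \<in> W"
    using W unfolding closed_sequential_limits by (metis (no_types, lifting) diff_zero)
  then show "f \<in> range F" using range_criterion[OF v(1,2) w(1,2)] by blast
qed

text \<open>For \<open>f = S x\<close> explicit decaying solutions are \<open>(\<Phi> t - 1) *\<^sub>R X t x\<close> and \<open>\<Phi> t *\<^sub>R X t x\<close>, which vanish after
  time \<open>1\<close> and before time \<open>0\<close>.  Their values at \<open>0\<close> differ by \<open>x\<close>, so the range criterion for \<open>S x\<close> reads
  \<open>x \<in> W\<close>, and subtracting \<open>S (w 0 - v 0)\<close> from \<open>f\<close> makes the difference vanish.\<close>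

lemma bump_operator:
  obtains S :: "'a \<Rightarrow> 'a c0" and \<phi> :: "real \<Rightarrow> real" where "bounded_linear S"
    "\<And>x t. apply_c0 (S x) t = \<phi> t *\<^sub>R propagator A t x"
    "\<And>x. S x \<in> range F \<longleftrightarrow> x \<in> W" "\<And>f. \<exists>x. f - S x \<in> range F"
proof -
  obtain \<Phi> \<phi> :: "real \<Rightarrow> real" where \<Phi>: "\<And>t. (\<Phi> has_vector_derivative \<phi> t) (at t)"
    and c\<phi>: "continuous_on UNIV \<phi>" and \<Phi>0: "\<And>t. t \<le> 0 \<Longrightarrow> \<Phi> t = 0" and \<Phi>1: "\<And>t. t \<ge> 1 \<Longrightarrow> \<Phi> t = 1"
    and \<phi>0: "\<And>t. t \<le> 0 \<or> t \<ge> 1 \<Longrightarrow> \<phi> t = 0" and \<phi>2: "\<And>t. \<bar>\<phi> t\<bar> \<le> 2"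
    by (rule smooth_step) blast
  define S where "S x = Abs_c0 (\<lambda>t. \<phi> t *\<^sub>R propagator A t x)" for x
  have "in_c0 (\<lambda>t. \<phi> t *\<^sub>R propagator A t x)" for x
    unfolding in_c0_def vanishes_at_infty_def
  proof (intro conjI)
    show "continuous_on UNIV (\<lambda>t. \<phi> t *\<^sub>R propagator A t x)"
      by (intro continuous_on_scaleR c\<phi> solves_continuous[OF solves_propagator])
    show "((\<lambda>t. \<phi> t *\<^sub>R propagator A t x) \<longlongrightarrow> 0) at_top"
      by (rule tendsto_eventually) (auto simp: eventually_at_top_linorder \<phi>0 intro!: exI[of _ 1])
    show "((\<lambda>t. \<phi> t *\<^sub>R propagator A t x) \<longlongrightarrow> 0) at_bot"
      by (rule tendsto_eventually) (auto simp: eventually_at_bot_linorder \<phi>0 intro!: exI[of _ 0])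
  qed
  then have S: "apply_c0 (S x) t = \<phi> t *\<^sub>R propagator A t x" for x t
    by (simp add: S_def apply_Abs_c0)
  have "bounded (propagator A ` {0..1})"
    by (intro compact_imp_bounded compact_continuous_image continuous_propagator) auto
  then obtain b where b: "b > 0" "\<And>t. 0 \<le> t \<Longrightarrow> t \<le> 1 \<Longrightarrow> norm (propagator A t) \<le> b"
    unfolding bounded_pos by auto
  have blS: "bounded_linear S"
  proof (rule bounded_linear_intro)
    show "S (x + y) = S x + S y" "S (r *\<^sub>R x) = r *\<^sub>R S x" for x y r
      by (rule c0_eqI, simp add: S plus_c0.rep_eq scaleR_c0.rep_eq blinfun.bilinear_simps algebra_simps)+
    show "norm (S x) \<le> norm x * (2 * b)" for x
    proof (rule norm_c0_le)
      show "norm (apply_c0 (S x) t) \<le> norm x * (2 * b)" for t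
      proof (cases "0 \<le> t \<and> t \<le> 1")
        case True
        then have "norm (propagator A t x) \<le> b * norm x"
          by (intro order_trans[OF norm_blinfun] mult_right_mono b) auto
        then have "\<bar>\<phi> t\<bar> * norm (propagator A t x) \<le> 2 * (b * norm x)"
          by (intro mult_mono \<phi>2) auto
        then show ?thesis by (simp add: S mult_ac)
      next
        case False
        then have "\<phi> t = 0" by (intro \<phi>0) auto
        then show ?thesis using b(1) by (simp add: S)
      qed
    qed
  qed
  have sol: "solves A (apply_c0 (S x)) (\<lambda>t. (\<Phi> t - c) *\<^sub>R propagator A t x)" for x c
    unfolding solves_def
  proof
    fix t
    have "((\<lambda>t. \<Phi> t - c) has_vector_derivative \<phi> t) (at t)"
      using has_vector_derivative_diff[OF \<Phi> has_vector_derivative_const] by simp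
    moreover have "((\<lambda>t. propagator A t x) has_vector_derivative A t (propagator A t x)) (at t)"
      using solves_propagator[of x] by (simp add: solves_def)
    ultimately have "((\<lambda>t. (\<Phi> t - c) *\<^sub>R propagator A t x) has_vector_derivative
        (\<Phi> t - c) *\<^sub>R A t (propagator A t x) + \<phi> t *\<^sub>R propagator A t x) (at t)"
      by (rule bounded_bilinear.has_vector_derivative[OF bounded_bilinear_scaleR])
    then show "((\<lambda>t. (\<Phi> t - c) *\<^sub>R propagator A t x) has_vector_derivative
        A t ((\<Phi> t - c) *\<^sub>R propagator A t x) + apply_c0 (S x) t) (at t)"
      by (simp add: S blinfun.scaleR_right)
  qed
  have top': "((\<lambda>t. (\<Phi> t - 1) *\<^sub>R propagator A t x) \<longlongrightarrow> 0) at_top" for x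
    by (rule tendsto_eventually) (auto simp: eventually_at_top_linorder \<Phi>1 intro!: exI[of _ 1])
  have bot': "((\<lambda>t. (\<Phi> t - 0) *\<^sub>R propagator A t x) \<longlongrightarrow> 0) at_bot" for x
    by (rule tendsto_eventually) (auto simp: eventually_at_bot_linorder \<Phi>0 intro!: exI[of _ 0])
  have SW: "S x \<in> range F \<longleftrightarrow> x \<in> W" for x
    using range_criterion[OF sol top' sol bot'] by (simp add: propagator(1) \<Phi>0)
  have onto: "\<exists>x. f - S x \<in> range F" for f
  proof -
    obtain v where v: "solves A (apply_c0 f) v" "(v \<longlongrightarrow> 0) at_top"
      by (rule decaying_solutions) blast
    obtain w where w: "solves A (apply_c0 f) w" "(w \<longlongrightarrow> 0) at_bot"
      by (rule decaying_solutions) blast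
    define x where "x = w 0 - v 0"
    have eq: "apply_c0 (f - S x) = (\<lambda>t. apply_c0 f t - apply_c0 (S x) t)"
      by (simp add: apply_c0_minus fun_eq_iff)
    have "0 \<in> Ws" "0 \<in> Wu"
      by (simp_all add: Ws_def Wu_def stable_space_def unstable_space_def blinfun.zero_right)
    then have "0 + 0 \<in> W" unfolding W_def subspace_sum_def by blast
    moreover have "solves A (apply_c0 (f - S x)) (\<lambda>t. v t - (\<Phi> t - 1) *\<^sub>R propagator A t x)"
      "solves A (apply_c0 (f - S x)) (\<lambda>t. w t - (\<Phi> t - 0) *\<^sub>R propagator A t x)"
      unfolding eq by (intro solves_diff v w sol)+
    moreover have "((\<lambda>t. v t - (\<Phi> t - 1) *\<^sub>R propagator A t x) \<longlongrightarrow> 0) at_top"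
      "((\<lambda>t. w t - (\<Phi> t - 0) *\<^sub>R propagator A t x) \<longlongrightarrow> 0) at_bot"
      using tendsto_diff[OF v(2) top'[of x]] tendsto_diff[OF w(2) bot'[of x]] by simp_all
    moreover have "(w 0 - (\<Phi> 0 - 0) *\<^sub>R propagator A 0 x) - (v 0 - (\<Phi> 0 - 1) *\<^sub>R propagator A 0 x) = 0 + 0"
      by (simp add: propagator(1) \<Phi>0 x_def)
    ultimately have "f - S x \<in> range F"
      using range_criterion by (metis (no_types, lifting))
    then show ?thesis by blast
  qed
  show ?thesis using that[of S \<phi>] blS S SW onto by blast
qed

lemma closed_range_iff: "closed (range F) \<longleftrightarrow> closed W"
proof
  assume R: "closed (range F)"
  obtain S where S: "bounded_linear S" "\<And>x. S x \<in> range F \<longleftrightarrow> x \<in> W"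
    by (rule bump_operator) blast
  have "closed (S -` range F)"
    by (rule continuous_closed_vimage[OF R]) (rule linear_continuous_at[OF S(1)])
  moreover have "S -` range F = W" using S(2) by auto
  ultimately show "closed W" by simp
qed (rule closed_range_if)

lemma F_add: "F (u + v) = F u + F v"
  unfolding F_eq_iff using solves_add[OF solves_F solves_F, of u v]
  by (simp add: plus_c01.rep_eq[abs_def] plus_c0.rep_eq[abs_def])

lemma surj_iff: "surj F \<longleftrightarrow> W = UNIV"
proof
  obtain S where S: "\<And>x. S x \<in> range F \<longleftrightarrow> x \<in> W" "\<And>f. \<exists>x. f - S x \<in> range F"
    by (rule bump_operator) blast
  show "W = UNIV" if "surj F" using S(1) that by auto
  show "surj F" if W: "W = UNIV"
  proof -
    have "f \<in> range F" for f
    proof -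
      obtain x where "f - S x \<in> range F" using S(2) by blast
      then obtain u v where "f - S x = F u" "S x = F v" using S(1)[of x] W by auto
      then have "f = F (u + v)" by (simp add: F_add algebra_simps)
      then show ?thesis by blast
    qed
    then show ?thesis by blast
  qed
qed

lemma norm_F: "norm (F u) \<le> (1 + K) * norm u"
proof (rule norm_c0_le)
  fix t
  have "apply_c0 (F u) t = apply_c0 (c01_deriv u) t - A t (apply_c0 (c01_incl u) t)"
    unfolding F_def by (simp add: apply_F_op[OF cont top bot] c01_deriv.rep_eq c01_incl.rep_eq)
  also have "norm \<dots> \<le> norm (c01_deriv u) + K * norm (c01_incl u)"
    using K by (intro order_trans[OF norm_triangle_ineq4] add_mono norm_apply_c0_le
        order_trans[OF bound_apply] mult_left_mono) auto
  also have "\<dots> \<le> (1 + K) * norm u"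
    using K by (simp add: norm_c01_def algebra_simps)
  finally show "norm (apply_c0 (F u) t) \<le> (1 + K) * norm u" .
qed

end

section \<open>Scalar multiplications\<close>

text \<open>The index theorem holds for any scalar multiplication by bounded operators that commute with the path and
  act pointwise on functions; the real and the complex case are two instances.\<close>

locale scalar_path = asymptotically_hyperbolic_path A K L1 L2 C1 C2
  for A :: "real \<Rightarrow> 'a::banach \<Rightarrow>\<^sub>L 'a" and K L1 L2 C1 C2 +
  fixes sc :: "'k::field \<Rightarrow> 'a \<Rightarrow> 'a" and sc0 :: "'k \<Rightarrow> 'a c0 \<Rightarrow> 'a c0" and sc1 :: "'k \<Rightarrow> 'a c01 \<Rightarrow> 'a c01"
  assumes vs: "vector_space sc" and bl: "\<And>c. bounded_linear (sc c)"
    and A_sc: "\<And>t c x. A t (sc c x) = sc c (A t x)"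
    and sc0: "\<And>c f t. apply_c0 (sc0 c f) t = sc c (apply_c0 f t)"
    and sc1: "\<And>c f t. apply_c01 (sc1 c f) t = sc c (apply_c01 f t)"
begin

interpretation sc: vector_space sc by (rule vs)

interpretation sc0: vector_space sc0
  by unfold_locales
    (rule c0_eqI, simp add: sc0 plus_c0.rep_eq sc.scale_right_distrib sc.scale_left_distrib)+

interpretation sc1: vector_space sc1
  by unfold_locales
    (rule c01_eqI, simp add: sc1 plus_c01.rep_eq sc.scale_right_distrib sc.scale_left_distrib)+

lemma solves_scale: "solves A f u \<Longrightarrow> solves A (\<lambda>t. sc c (f t)) (\<lambda>t. sc c (u t))"
  unfolding solves_def
proof
  fix t
  assume "\<forall>t. (u has_vector_derivative A t (u t) + f t) (at t)"
  then have "((\<lambda>t. sc c (u t)) has_vector_derivative sc c (A t (u t) + f t)) (at t)"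
    by (intro bounded_linear.has_vector_derivative[OF bl]) auto
  then show "((\<lambda>t. sc c (u t)) has_vector_derivative A t (sc c (u t)) + sc c (f t)) (at t)"
    by (simp add: A_sc sc.scale_right_distrib)
qed

lemma propagator_scale: "propagator A t (sc c x) = sc c (propagator A t x)"
  using solves_homogeneous[of "\<lambda>t. sc c (propagator A t x)" t] solves_scale[OF solves_propagator, of c x]
  by (simp add: propagator(1))

lemma linear_F: "Vector_Spaces.linear sc1 sc0 F"
proof unfold_locales
  show "F (u + v) = F u + F v" for u v by (rule F_add)
  show "F (sc1 c u) = sc0 c (F u)" for c u
    unfolding F_eq_iff using solves_scale[OF solves_F, of c u] by (simp add: sc1[abs_def] sc0[abs_def])
qed

lemma subspaces: "sc.subspace Ws" "sc.subspace Wu" "sc.subspace W"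
proof -
  have add: "((\<lambda>t. propagator A t (x + y)) \<longlongrightarrow> 0) G"
    if "((\<lambda>t. propagator A t x) \<longlongrightarrow> 0) G" "((\<lambda>t. propagator A t y) \<longlongrightarrow> 0) G" for x y G
    using tendsto_add[OF that] by (simp add: blinfun.add_right)
  have scale: "((\<lambda>t. propagator A t (sc c x)) \<longlongrightarrow> 0) G"
    if "((\<lambda>t. propagator A t x) \<longlongrightarrow> 0) G" for x c G
    using bounded_linear.tendsto_zero[OF bl that] by (simp add: propagator_scale)
  show s: "sc.subspace Ws" and u: "sc.subspace Wu"
    unfolding sc.subspace_def Ws_def Wu_def stable_space_def unstable_space_def
    using add scale by (auto simp: blinfun.zero_right)
  show "sc.subspace W"
    unfolding W_def subspace_sum_def using sc.subspace_sums[OF s u] by (simp add: conj_commute)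
qed

text \<open>A solution of the homogeneous equation is determined by its value at \<open>0\<close>, and it decays at both ends exactly
  if that value is both stable and unstable.\<close>

lemma edim_kernel: "edim sc1 {u. F u = 0} = edim sc (Ws \<inter> Wu)"
proof -
  let ?ev = "\<lambda>u. apply_c01 u 0"
  have ker: "F u = 0 \<longleftrightarrow> solves A (\<lambda>_. 0) (apply_c01 u)" for u
    by (simp add: F_eq_iff zero_c0.rep_eq[abs_def])
  have lin: "Vector_Spaces.linear sc1 sc ?ev"
    by unfold_locales (simp_all add: plus_c01.rep_eq sc1)
  have "?ev ` {u. F u = 0} = Ws \<inter> Wu"
  proof safe
    fix u assume "F u = 0"
    then have u: "solves A (\<lambda>_. 0) (apply_c01 u)" by (simp add: ker)
    then show "apply_c01 u 0 \<in> Ws" "apply_c01 u 0 \<in> Wu"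
      using homogeneous_decay[OF u] c01_vanishes[of u] by (simp_all add: vanishes_at_infty_def)
  next
    fix x assume x: "x \<in> Ws" "x \<in> Wu"
    have "solves A (apply_c0 0) (\<lambda>t. propagator A t x)"
      using solves_propagator by (simp add: zero_c0.rep_eq[abs_def])
    moreover have "vanishes_at_infty (\<lambda>t. propagator A t x)"
      using x by (simp add: vanishes_at_infty_def Ws_def Wu_def stable_space_def unstable_space_def)
    ultimately obtain u where "apply_c01 u = (\<lambda>t. propagator A t x)" "F u = 0"
      by (rule vanishing_solution_in_c01) blast
    then show "x \<in> ?ev ` {u. F u = 0}" by (intro image_eqI[of _ _ u]) (auto simp: propagator(1))
  qed
  moreover have "inj_on ?ev {u. F u = 0}"
  proof (rule inj_onI)
    fix u v assume "u \<in> {u. F u = 0}" "v \<in> {u. F u = 0}" "?ev u = ?ev v"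
    then have "apply_c01 u = apply_c01 v" using solves_unique ker by blast
    then show "u = v" by (simp add: apply_c01_inject)
  qed
  moreover have "sc1.subspace {u. F u = 0}"
    using module_hom.subspace_kernel[OF Vector_Spaces.linear.axioms(3)[OF linear_F]] .
  ultimately show ?thesis using edim_injective_image[OF lin] by metis
qed

lemma ecodim_range: "ecodim sc0 (range F) = ecodim sc W"
proof -
  obtain S \<phi> where S: "\<And>x t. apply_c0 (S x) t = \<phi> t *\<^sub>R propagator A t x"
    "\<And>x. S x \<in> range F \<longleftrightarrow> x \<in> W" "\<And>f. \<exists>x. f - S x \<in> range F" "bounded_linear S"
    by (rule bump_operator) blast
  show ?thesis
  proof (rule ecodim_transfer)
    show "Vector_Spaces.linear sc sc0 S"
    proof unfold_locales
      show "S (x + y) = S x + S y" for x y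
        by (rule c0_eqI) (simp add: S(1) plus_c0.rep_eq blinfun.add_right scaleR_add_right)
      show "S (sc c x) = sc0 c (S x)" for c x
        by (rule c0_eqI) (simp add: S(1) sc0 propagator_scale linear_scale[OF bounded_linear.linear[OF bl]])
    qed
    show "sc0.subspace (range F)"
      using module_hom.subspace_image[OF Vector_Spaces.linear.axioms(3)[OF linear_F] sc1.subspace_UNIV] .
  qed (use subspaces S in auto)
qed

theorem fredholm_theorem:
  "closed (range (F_op A)) \<longleftrightarrow> closed (subspace_sum (stable_space A) (unstable_space A))"
  "surj (F_op A) \<longleftrightarrow> subspace_sum (stable_space A) (unstable_space A) = UNIV"
  "semi_fredholm sc1 sc0 (F_op A) \<longleftrightarrow> semi_fredholm_pair sc (stable_space A) (unstable_space A)"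
  "fredholm_index sc1 sc0 (F_op A) = pair_index sc (stable_space A) (unstable_space A)"
proof -
  have bounded: "\<exists>K. \<forall>u. norm (F u) \<le> K * norm u" using norm_F by blast
  have "closed (range F) \<longleftrightarrow> closed W" "surj F \<longleftrightarrow> W = UNIV"
    "semi_fredholm sc1 sc0 F \<longleftrightarrow> semi_fredholm_pair sc Ws Wu"
    "fredholm_index sc1 sc0 F = pair_index sc Ws Wu"
    using closed_range_iff surj_iff linear_F bounded subspaces closed_Ws closed_Wu edim_kernel ecodim_range
    unfolding semi_fredholm_def semi_fredholm_pair_def fredholm_index_def pair_index_def
    by (simp_all add: W_def)
  then show "closed (range (F_op A)) \<longleftrightarrow> closed (subspace_sum (stable_space A) (unstable_space A))"
    "surj (F_op A) \<longleftrightarrow> subspace_sum (stable_space A) (unstable_space A) = UNIV"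
    "semi_fredholm sc1 sc0 (F_op A) \<longleftrightarrow> semi_fredholm_pair sc (stable_space A) (unstable_space A)"
    "fredholm_index sc1 sc0 (F_op A) = pair_index sc (stable_space A) (unstable_space A)"
    by (simp_all add: F_def Ws_def Wu_def W_def)
qed

end

lemma bounded_if_limits_at_infty:
  fixes A :: "real \<Rightarrow> 'b::real_normed_vector"
  assumes cont: "continuous_on UNIV A" and top: "(A \<longlongrightarrow> L1) at_top" and bot: "(A \<longlongrightarrow> L2) at_bot"
  obtains K where "K > 0" "\<And>t. norm (A t) \<le> K"
proof -
  obtain a where a: "\<And>t. t \<ge> a \<Longrightarrow> dist (A t) L1 < 1"
    using tendstoD[OF top, of 1] by (auto simp: eventually_at_top_linorder)
  obtain b where b: "\<And>t. t \<le> b \<Longrightarrow> dist (A t) L2 < 1"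
    using tendstoD[OF bot, of 1] by (auto simp: eventually_at_bot_linorder)
  have "bounded (A ` {b..a})"
    by (intro compact_imp_bounded compact_continuous_image continuous_on_subset[OF cont]) auto
  moreover have "bounded (A ` {a..})" "bounded (A ` {..b})"
    by (rule bounded_subset[OF bounded_ball[of L1 1]]; use a in \<open>auto simp: dist_commute\<close>)
      (rule bounded_subset[OF bounded_ball[of L2 1]]; use b in \<open>auto simp: dist_commute\<close>)
  ultimately have "bounded (A ` {b..a} \<union> A ` {a..} \<union> A ` {..b})" by simp
  moreover have "range A \<subseteq> A ` {b..a} \<union> A ` {a..} \<union> A ` {..b}" by force
  ultimately have "bounded (range A)" by (rule bounded_subset)
  then show ?thesis using that unfolding bounded_pos by auto
qed

theorem theorem2p2:
  fixes A :: "real \<Rightarrow> 'a::banach \<Rightarrow>\<^sub>L 'a"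
    and B :: "real \<Rightarrow> 'b::complex_banach \<Rightarrow>\<^sub>L 'b"
  shows
    "(asymptotically_hyperbolic_real A \<longrightarrow>
        (closed (range (F_op A)) \<longleftrightarrow> closed (subspace_sum (stable_space A) (unstable_space A))) \<and>
        (surj (F_op A) \<longleftrightarrow> subspace_sum (stable_space A) (unstable_space A) = UNIV) \<and>
        (semi_fredholm scaleR scaleR (F_op A) \<longleftrightarrow>
           semi_fredholm_pair scaleR (stable_space A) (unstable_space A)) \<and>
        (semi_fredholm scaleR scaleR (F_op A) \<longrightarrow>
           fredholm_index scaleR scaleR (F_op A)
             = pair_index scaleR (stable_space A) (unstable_space A)))
     \<and>
     (asymptotically_hyperbolic_complex B \<longrightarrow>
        (closed (range (F_op B)) \<longleftrightarrow> closed (subspace_sum (stable_space B) (unstable_space B))) \<and>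
        (surj (F_op B) \<longleftrightarrow> subspace_sum (stable_space B) (unstable_space B) = UNIV) \<and>
        (semi_fredholm scaleC scaleC (F_op B) \<longleftrightarrow>
           semi_fredholm_pair scaleC (stable_space B) (unstable_space B)) \<and>
        (semi_fredholm scaleC scaleC (F_op B) \<longrightarrow>
           fredholm_index scaleC scaleC (F_op B)
             = pair_index scaleC (stable_space B) (unstable_space B)))"
proof (intro conjI impI)
  assume "asymptotically_hyperbolic_real A"
  then obtain L1 L2 where A: "continuous_on UNIV A" "(A \<longlongrightarrow> L1) at_top" "hyperbolic_real L1"
      "(A \<longlongrightarrow> L2) at_bot" "hyperbolic_real L2"
    unfolding asymptotically_hyperbolic_real_def by blast
  obtain K where K: "K > 0" "\<And>t. norm (A t) \<le> K"
    by (rule bounded_if_limits_at_infty[OF A(1,2,4)]) blast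
  obtain C1 C2 where C: "c0_invertible (\<lambda>_. L1) C1" "c0_invertible (\<lambda>_. L2) C2"
    using c0_invertible_hyperbolic_real A(3,5) by blast
  interpret scalar_path A K L1 L2 C1 C2 scaleR scaleR scaleR
    by (intro scalar_path.intro asymptotically_hyperbolic_path.intro bounded_path.intro
        asymptotically_hyperbolic_path_axioms.intro scalar_path_axioms.intro)
      (simp_all add: A K C scaleR_c0.rep_eq scaleR_c01.rep_eq blinfun.scaleR_right
        bounded_linear_scaleR_right real_vector.vector_space_axioms)
  show "closed (range (F_op A)) \<longleftrightarrow> closed (subspace_sum (stable_space A) (unstable_space A))"
    "surj (F_op A) \<longleftrightarrow> subspace_sum (stable_space A) (unstable_space A) = UNIV"
    "semi_fredholm scaleR scaleR (F_op A) \<longleftrightarrow>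
      semi_fredholm_pair scaleR (stable_space A) (unstable_space A)"
    "fredholm_index scaleR scaleR (F_op A) = pair_index scaleR (stable_space A) (unstable_space A)"
    by (rule fredholm_theorem)+
next
  assume "asymptotically_hyperbolic_complex B"
  then obtain L1 L2 where B: "continuous_on UNIV B" "(B \<longlongrightarrow> L1) at_top" "hyperbolic_complex L1"
      "(B \<longlongrightarrow> L2) at_bot" "hyperbolic_complex L2" and lin: "\<And>t. clinear_op (blinfun_apply (B t))"
    unfolding asymptotically_hyperbolic_complex_def by blast
  obtain K where K: "K > 0" "\<And>t. norm (B t) \<le> K"
    by (rule bounded_if_limits_at_infty[OF B(1,2,4)]) blast
  obtain C1 C2 where C: "c0_invertible (\<lambda>_. L1) C1" "c0_invertible (\<lambda>_. L2) C2"
    using c0_invertible_hyperbolic_complex B(3,5) by blast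
  have B_scale: "B t (c *\<^sub>C x) = c *\<^sub>C B t x" for t c x
    using lin[of t] module_hom.scale[OF Vector_Spaces.linear.axioms(3)] by (auto simp: clinear_op_def)
  interpret scalar_path B K L1 L2 C1 C2 scaleC scaleC scaleC
    by (intro scalar_path.intro asymptotically_hyperbolic_path.intro bounded_path.intro
        asymptotically_hyperbolic_path_axioms.intro scalar_path_axioms.intro)
      (simp_all add: B K C B_scale scaleC_c0.rep_eq scaleC_c01.rep_eq bounded_linear_scaleC
        vector_space_scaleC)
  show "closed (range (F_op B)) \<longleftrightarrow> closed (subspace_sum (stable_space B) (unstable_space B))"
    "surj (F_op B) \<longleftrightarrow> subspace_sum (stable_space B) (unstable_space B) = UNIV"
    "semi_fredholm scaleC scaleC (F_op B) \<longleftrightarrow>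
      semi_fredholm_pair scaleC (stable_space B) (unstable_space B)"
    "fredholm_index scaleC scaleC (F_op B) = pair_index scaleC (stable_space B) (unstable_space B)"
    by (rule fredholm_theorem)+
qed

end
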